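(* Let $X_t^x$ be the Feller diffusion generated by the operator $Lg(x)=a(x)\Delta g(x)$ in $\mathbb{R}^d$ with a nonnegative bounded smooth function $a(x)$. Then, for all $x,y\in\mathbb{R}^d$ (and $t\ge0$), $$\mathbf{E}\frac{1}{|X_t^x-y|^{d-2}}=\mathbf{E}\frac{1}{|X_t^y-x|^{d-2}}\quad\text{if } d\ge3,$$ $$\mathbf{E}\log|X_t^x-y|=\mathbf{E}\log|X_t^y-x|\quad\text{if } d=2.$$
   Context: $\Delta$ is the Laplacian on $\mathbb{R}^d$; the superscript of $X_t^x$ denotes the initial point. *)

theory Defs
  imports "HOL-Probability.Probability"
begin

section \<open>Differential operators and function classes\<close>

definition partial_derivative ::
  "'a::euclidean_space \<Rightarrow> ('a \<Rightarrow> real) \<Rightarrow> 'a \<Rightarrow> real"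
where
  "partial_derivative b f x = frechet_derivative f (at x) b"

definition laplacian :: "('a::euclidean_space \<Rightarrow> real) \<Rightarrow> 'a \<Rightarrow> real" where
  "laplacian f x = (\<Sum>b\<in>Basis. partial_derivative b (partial_derivative b f) x)"

primrec C_k :: "nat \<Rightarrow> ('a::euclidean_space \<Rightarrow> real) \<Rightarrow> bool" where
  "C_k 0 f \<longleftrightarrow> continuous_on UNIV f"
| "C_k (Suc k) f \<longleftrightarrow>
     (\<forall>x. f differentiable (at x)) \<and> (\<forall>b\<in>Basis. C_k k (partial_derivative b f))"

definition smooth :: "('a::euclidean_space \<Rightarrow> real) \<Rightarrow> bool" where
  "smooth f \<longleftrightarrow> (\<forall>k. C_k k f)"

definition smooth_compact_support :: "('a::euclidean_space \<Rightarrow> real) set" where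
  "smooth_compact_support = {f. smooth f \<and> compact (closure {x. f x \<noteq> 0})}"

definition C_zero :: "('a::euclidean_space \<Rightarrow> real) set" where
  "C_zero = {f. continuous_on UNIV f \<and> (f \<longlongrightarrow> 0) at_infinity}"


section \<open>Feller semigroups and Feller diffusions\<close>

text \<open>
  The operators are total functions on all real-valued functions, but only their values on
  \<open>C_zero\<close> are constrained. Strong continuity and the generator refer to the
  supremum norm.
\<close>

definition feller_semigroup ::
  "(real \<Rightarrow> ('a::euclidean_space \<Rightarrow> real) \<Rightarrow> 'a \<Rightarrow> real) \<Rightarrow> bool"
where
  "feller_semigroup T \<longleftrightarrow>
     (\<forall>t\<ge>0. \<forall>f\<in>C_zero. T t f \<in> C_zero) \<and>
     (\<forall>t\<ge>0. \<forall>f\<in>C_zero. \<forall>g\<in>C_zero. \<forall>\<alpha> \<beta>.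
        T t (\<lambda>x. \<alpha> * f x + \<beta> * g x) = (\<lambda>x. \<alpha> * T t f x + \<beta> * T t g x)) \<and>
     (\<forall>t\<ge>0. \<forall>f\<in>C_zero. (\<forall>x. 0 \<le> f x \<and> f x \<le> 1) \<longrightarrow> (\<forall>x. 0 \<le> T t f x \<and> T t f x \<le> 1)) \<and>
     (\<forall>f\<in>C_zero. T 0 f = f) \<and>
     (\<forall>s\<ge>0. \<forall>t\<ge>0. \<forall>f\<in>C_zero. T (s + t) f = T s (T t f)) \<and>
     (\<forall>f\<in>C_zero. uniform_limit UNIV (\<lambda>t. T t f) f (at_right 0))"

text \<open>\<open>in_generator T f h\<close>: \<open>f\<close> is in the domain of the generator \<open>A\<close> of \<open>T\<close>, and \<open>A f = h\<close>.\<close>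

definition in_generator ::
  "(real \<Rightarrow> ('a::euclidean_space \<Rightarrow> real) \<Rightarrow> 'a \<Rightarrow> real) \<Rightarrow> ('a \<Rightarrow> real) \<Rightarrow> ('a \<Rightarrow> real) \<Rightarrow> bool"
where
  "in_generator T f h \<longleftrightarrow>
     f \<in> C_zero \<and> h \<in> C_zero \<and>
     uniform_limit UNIV (\<lambda>t x. (T t f x - f x) / t) h (at_right 0)"

definition natural_filtration ::
  "'w measure \<Rightarrow> (real \<Rightarrow> 'w \<Rightarrow> 'a::euclidean_space) \<Rightarrow> real \<Rightarrow> 'w measure"
where
  "natural_filtration M X s =
     sigma (space M) {X u -` A \<inter> space M | u A. 0 \<le> u \<and> u \<le> s \<and> A \<in> sets borel}"

definition markov_process_from ::
  "(real \<Rightarrow> ('a::euclidean_space \<Rightarrow> real) \<Rightarrow> 'a \<Rightarrow> real) \<Rightarrow>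
   'w measure \<Rightarrow> (real \<Rightarrow> 'w \<Rightarrow> 'a) \<Rightarrow> 'a \<Rightarrow> bool"
where
  "markov_process_from T M X x \<longleftrightarrow>
     prob_space M \<and>
     (\<forall>t\<ge>0. X t \<in> borel_measurable M) \<and>
     (AE \<omega> in M. X 0 \<omega> = x) \<and>
     (\<forall>s\<ge>0. \<forall>t\<ge>0. \<forall>f\<in>C_zero. AE \<omega> in M.
        real_cond_exp M (natural_filtration M X s) (\<lambda>\<omega>. f (X (s + t) \<omega>)) \<omega> = T t f (X s \<omega>))"

text \<open>
  \<open>X x\<close> is the process started at \<open>x\<close>, on its own probability space \<open>M x\<close>. As is usual for
  Feller diffusions, being generated by the differential operator \<open>L\<close> means that the domain of the
  generator contains the smooth compactly supported functions and that the generator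
  agrees with \<open>L\<close> on them.
\<close>

definition feller_diffusion ::
  "(('a::euclidean_space \<Rightarrow> real) \<Rightarrow> 'a \<Rightarrow> real) \<Rightarrow>
   ('a \<Rightarrow> 'w measure) \<Rightarrow> ('a \<Rightarrow> real \<Rightarrow> 'w \<Rightarrow> 'a) \<Rightarrow> bool"
where
  "feller_diffusion L M X \<longleftrightarrow>
     (\<exists>T. feller_semigroup T \<and>
          (\<forall>g\<in>smooth_compact_support. in_generator T g (L g)) \<and>
          (\<forall>x. markov_process_from T (M x) (X x) x \<and>
               (AE \<omega> in M x. continuous_on {0..} (\<lambda>t. X x t \<omega>))))"


section \<open>Extended-real logarithm and expectation\<close>

text \<open>\<open>ln 0 = 0\<close> in HOL, whereas here the logarithm at \<open>0\<close> is \<open>-\<infinity>\<close>.\<close>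

definition log_ext :: "real \<Rightarrow> ereal" where
  "log_ext r = (if r \<le> 0 then - \<infinity> else ereal (ln r))"

text \<open>
  \<open>e2ennreal\<close> sends negative values to \<open>0\<close>, so the two integrals below are those of the positive and
  negative parts; the expectation is meaningful if at most one of them is infinite.
\<close>

definition ext_expectation_exists :: "'w measure \<Rightarrow> ('w \<Rightarrow> ereal) \<Rightarrow> bool" where
  "ext_expectation_exists M f \<longleftrightarrow>
     f \<in> borel_measurable M \<and>
     ((\<integral>\<^sup>+ \<omega>. e2ennreal (f \<omega>) \<partial>M) < \<infinity> \<or> (\<integral>\<^sup>+ \<omega>. e2ennreal (- f \<omega>) \<partial>M) < \<infinity>)"

definition ext_expectation :: "'w measure \<Rightarrow> ('w \<Rightarrow> ereal) \<Rightarrow> ereal" where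
  "ext_expectation M f =
     enn2ereal (\<integral>\<^sup>+ \<omega>. e2ennreal (f \<omega>) \<partial>M) - enn2ereal (\<integral>\<^sup>+ \<omega>. e2ennreal (- f \<omega>) \<partial>M)"

end

theory Submission
  imports Defs "HOL-Real_Asymp.Real_Asymp"
begin

text \<open>Let \<open>P\<^sub>t\<^sup>x\<close> be the law of \<open>X\<^sub>t\<^sup>x\<close>, \<open>\<mu>\<^sub>x\<close> the resolvent measure \<open>\<integral> l exp (- l t) P\<^sub>t\<^sup>x dt\<close> and \<open>G\<close> the Newton
  kernel, regularised to \<open>G\<^sub>e(z) = N(|z|\<^sup>2 + e)\<close> with \<open>- \<Delta> G\<^sub>e = \<phi>\<^sub>e\<close>. The generator gives
  \<open>\<integral> G\<^sub>e(z - p) d\<mu>\<^sub>x(z) = G\<^sub>e(x - p) - W\<^sub>e(x, p) / l\<close> with \<open>W\<^sub>e(x, p) = \<integral> a(z) \<phi>\<^sub>e(z - p) d\<mu>\<^sub>x(z)\<close>.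
  Integrating this over \<open>p\<close> against \<open>\<mu>\<^sub>y\<close>, and exchanging \<open>x\<close> and \<open>y\<close>, yields
  \<open>W\<^sub>e(x, y) - W\<^sub>e(y, x) = \<integral>\<integral> \<phi>\<^sub>e(z - u) (a(u) - a(z)) d\<mu>\<^sub>x(u) d\<mu>\<^sub>y(z)\<close>.
  As \<open>e\<close> tends to \<open>0\<close> the positive part of the inner integral tends to \<open>0\<close> pointwise: where \<open>a(z) > 0\<close> by
  continuity of \<open>a\<close>, and where \<open>a(z) = 0\<close> because then \<open>a(u) = O(|u - z|\<^sup>2)\<close> by smoothness.
  It is dominated by \<open>W\<^sub>e(x, z) \<le> l G(x - z) + const\<close>, which is \<open>\<mu>\<^sub>y\<close>-integrable for \<open>x \<noteq> y\<close>.
  Hence the limit of \<open>W\<^sub>e\<close> is symmetric for every \<open>l\<close>, and injectivity of the Laplace transform gives the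
  claim at fixed times.
  To have test functions vanishing at infinity also in dimension two, all kernels are differences
  \<open>G\<^sub>e - G\<^sub>r\<close>.\<close>


text \<open>Formally the theorem is an intertwining relation. The adjoint of
  \<open>L = a \<Delta>\<close> is \<open>\<Delta> a\<close>; if \<open>G\<close> inverts
  \<open>- \<Delta>\<close>, then applying \<open>L\<close> after \<open>G\<close>, or
  \<open>G\<close> after the adjoint, gives multiplication by \<open>- a\<close> both times, so the
  kernel of \<open>T t G\<close> is symmetric. The obstacle is that \<open>a\<close> may vanish: no
  density of the laws is available, and they may have atoms, as for \<open>a = 0\<close>. The
  commutator is therefore kept as a double integral against two laws. Exponential times suit this
  because the resolvent identity trades one use of the generator for the factor \<open>l\<close>, so
  both orders of integration produce terms of the same kind. The estimate is one-sided. The positive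
  part of the inner integral inherits the majorant of \<open>W_e\<close>, whereas the subtracted
  term contains the mollified measure \<open>\<mu>_x\<close>, which is not controlled; the other
  inequality comes from exchanging the two points. At a zero of \<open>a\<close>, second order
  vanishing turns the order \<open>|z|^(-d)\<close> of the mollifier into \<open>|z|^(2-d)\<close>,
  the order of \<open>G\<close> (for \<open>d = 2\<close>: bounded, below the logarithm). Estimates
  of singular kernels need \<open>x \<noteq> y\<close>; for \<open>x = y\<close> both sides
  coincide.\<close>

section \<open>Newton kernels and their regularisations\<close>

text \<open>As functions of \<open>s = |z|\<^sup>2\<close> in dimension \<open>d\<close>: \<open>newton d\<close> is the Newton kernel with the normalisation
  \<open>newton' = - s powr (- d / 2)\<close>, and \<open>mollifier d e\<close> is minus the Laplacian of \<open>newton d (|z|\<^sup>2 + e)\<close>.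
  The singular case \<open>e = 0\<close> is meaningful for \<open>s > 0\<close> only; \<open>newton d 0\<close> is a junk value.\<close>

definition newton :: "nat \<Rightarrow> real \<Rightarrow> real" where
  "newton d s = (if d = 2 then - ln s else 2 / (real d - 2) * s powr (1 - real d / 2))"

definition newton_gap :: "nat \<Rightarrow> real \<Rightarrow> real \<Rightarrow> real \<Rightarrow> real" where
  "newton_gap d e r s = newton d (s + e) - newton d (s + r)"

definition mollifier :: "nat \<Rightarrow> real \<Rightarrow> real \<Rightarrow> real" where
  "mollifier d e s = 2 * real d * e * (s + e) powr (- real d / 2 - 1)"

lemma newton_deriv:
  assumes "s > 0"
  shows "(newton d has_real_derivative - (s powr (- real d / 2))) (at s)"
proof (cases "d = 2")
  case True
  have "((\<lambda>s. - ln s) has_real_derivative - (1 / s)) (at s)"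
    using assms by (auto intro!: derivative_eq_intros)
  then show ?thesis
    using True assms by (simp add: newton_def[abs_def] powr_minus_divide)
next
  case False
  then have d: "real d - 2 \<noteq> 0" by (metis eq_iff_diff_eq_0 of_nat_eq_iff of_nat_numeral)
  have "((\<lambda>s. 2 / (real d - 2) * s powr (1 - real d / 2)) has_real_derivative
     2 / (real d - 2) * ((1 - real d / 2) * s powr (1 - real d / 2 - 1))) (at s)"
    using assms by (intro DERIV_cmult has_real_derivative_powr)
  also have "2 / (real d - 2) * ((1 - real d / 2) * s powr (1 - real d / 2 - 1)) = - (s powr (- real d / 2))"
    using d by (simp add: field_simps)
  finally show ?thesis using False by (simp add: newton_def[abs_def])
qed

lemma newton_diff:
  assumes "0 < s" "s < t"
  obtains u where "s < u" "u < t" "newton d s - newton d t = (t - s) * u powr (- real d / 2)"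
proof -
  have "\<exists>z>s. z < t \<and> newton d t - newton d s = (t - s) * (- (z powr (- real d / 2)))"
    using assms by (intro MVT2 newton_deriv) auto
  then show ?thesis using that by (auto simp: algebra_simps)
qed

lemma newton_antimono:
  assumes "0 < s" "s \<le> t"
  shows "newton d t \<le> newton d s"
proof (cases "s = t")
  case False
  then obtain u where "s < u" "newton d s - newton d t = (t - s) * u powr (- real d / 2)"
    using newton_diff[of s t d] assms by auto
  then show ?thesis using assms
    by (smt (verit, best) mult_nonneg_nonneg powr_ge_zero)
qed auto

lemma newton_diff_le:
  assumes "0 < s" "s \<le> t"
  shows "newton d s - newton d t \<le> (t - s) * s powr (- real d / 2)"
proof (cases "s = t")
  case False
  then obtain u where u: "s < u" "newton d s - newton d t = (t - s) * u powr (- real d / 2)"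
    using newton_diff[of s t d] assms by auto
  have "u powr (- real d / 2) \<le> s powr (- real d / 2)"
    using u assms by (intro powr_mono2') auto
  then show ?thesis using u assms by (simp add: mult_left_mono)
qed auto

lemma newton_diff_ge:
  assumes "0 < s" "s \<le> t"
  shows "(t - s) * t powr (- real d / 2) \<le> newton d s - newton d t"
proof (cases "s = t")
  case False
  then obtain u where u: "s < u" "u < t" "newton d s - newton d t = (t - s) * u powr (- real d / 2)"
    using newton_diff[of s t d] assms by auto
  have "t powr (- real d / 2) \<le> u powr (- real d / 2)"
    using u assms by (intro powr_mono2') auto
  then show ?thesis using u assms by (simp add: mult_left_mono)
qed auto

text \<open>With \<open>q = d/2 - 1\<close> the kernel is \<open>s powr (- q) / q\<close>, and
  \<open>1 + v \<le> exp v\<close> at \<open>v = - q * ln s\<close> compares it with the case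
  \<open>d = 2\<close>. The logarithm is thus the weakest singularity, and blow-up at 0 follows in
  all dimensions at once.\<close>

lemma newton_ge_ln:
  assumes "d \<ge> 2" "0 < s"
  shows "- ln s + newton d 1 \<le> newton d s"
proof (cases "d = 2")
  case True then show ?thesis by (simp add: newton_def)
next
  case False
  define q where "q = (real d - 2) / 2"
  have q: "q > 0" using False assms by (auto simp: q_def)
  have *: "1 - real d / 2 = - q" "2 / (real d - 2) = 1 / q" using q by (auto simp: q_def field_simps)
  have "1 + (- q * ln s) \<le> exp (- q * ln s)" by (rule exp_ge_add_one_self)
  also have "\<dots> = s powr (- q)" using assms by (simp add: powr_def)
  finally have "q * (- ln s) \<le> s powr (-q) - 1" by simp
  then have "- ln s \<le> (s powr (-q) - 1) / q" using q by (simp add: field_simps)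
  then show ?thesis using False by (simp add: newton_def * diff_divide_distrib)
qed

lemma newton_filterlim:
  assumes "d \<ge> 2"
  shows "filterlim (newton d) at_top (at_right 0)"
proof (rule filterlim_at_top_mono)
  show "filterlim (\<lambda>s::real. - ln s + newton d 1) at_top (at_right 0)"
    by real_asymp
  show "\<forall>\<^sub>F x in at_right 0. - ln x + newton d 1 \<le> newton d x"
    using newton_ge_ln[OF assms] by (auto simp: eventually_at_right_less intro: eventually_mono[OF eventually_at_right_less])
qed

lemma isCont_newton: "s > 0 \<Longrightarrow> isCont (newton d) s"
  using newton_deriv DERIV_isCont by blast

lemma newton_measurable [measurable]: "newton d \<in> borel_measurable borel"
  unfolding newton_def[abs_def] by measurable

lemma newton_gap_measurable [measurable]: "newton_gap d e r \<in> borel_measurable borel"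
  unfolding newton_gap_def[abs_def] by measurable

lemma mollifier_measurable [measurable]: "mollifier d e \<in> borel_measurable borel"
  unfolding mollifier_def[abs_def] by measurable

lemma newton_gap_nonneg: "0 < s + e \<Longrightarrow> e \<le> r \<Longrightarrow> 0 \<le> newton_gap d e r s"
  unfolding newton_gap_def using newton_antimono[of "s + e" "s + r"] by simp

lemma newton_gap_antimono: "0 < s + e' \<Longrightarrow> e' \<le> e \<Longrightarrow> newton_gap d e r s \<le> newton_gap d e' r s"
  unfolding newton_gap_def using newton_antimono[of "s + e'" "s + e"] by simp

lemma newton_gap_le:
  assumes "0 < e" "e \<le> r" "0 \<le> s" shows "newton_gap d e r s \<le> (r - e) * (s + e) powr (- real d / 2)"
  unfolding newton_gap_def using newton_diff_le[of "s + e" "s + r" d] assms by simp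

lemma newton_gap_swap: "newton_gap d r e s = - newton_gap d e r s"
  by (simp add: newton_gap_def)

lemma newton_gap_abs_bound:
  assumes "0 < e" "0 < r"
  obtains C where "\<And>s. 0 \<le> s \<Longrightarrow> \<bar>newton_gap d e r s\<bar> \<le> C" 
proof -
  have *: "\<bar>newton_gap d e r s\<bar> \<le> (r - e) * e powr (- real d / 2)" if "0 < e" "e \<le> r" "0 \<le> s" for e r s
  proof -
    have "(s + e) powr (- real d / 2) \<le> e powr (- real d / 2)" using that by (intro powr_mono2') auto
    then have "(r - e) * (s + e) powr (- real d / 2) \<le> (r - e) * e powr (- real d / 2)"
      using that by (intro mult_left_mono) auto
    with newton_gap_le[OF that, of d] newton_gap_nonneg[of s e r d] that show ?thesis by simp
  qed
  show ?thesis
  proof (cases "e \<le> r")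
    case True then show ?thesis using * assms that by blast
  next
    case False
    have "\<And>s. 0 \<le> s \<Longrightarrow> \<bar>newton_gap d e r s\<bar> \<le> (e - r) * r powr (- real d / 2)"
      using *[of r e] assms False by (simp add: newton_gap_swap[of d r e])
    then show ?thesis using that by blast
  qed
qed

text \<open>The reason for working with gaps: in dimension two the logarithm is unbounded at
  infinity, but by the mean value theorem a gap decays like \<open>s powr (- d / 2)\<close>, which
  puts it into \<open>C_zero\<close>.\<close>

lemma newton_gap_tendsto_0:
  assumes "0 < e" "0 < r" "d \<noteq> 0"
  shows "(newton_gap d e r \<longlongrightarrow> 0) at_top"
proof -
  have *: "(newton_gap d e r \<longlongrightarrow> 0) at_top" if "0 < e" "e \<le> r" for e r
  proof (rule tendsto_sandwich)
    show "\<forall>\<^sub>F s in at_top. 0 \<le> newton_gap d e r s"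
      using eventually_ge_at_top[of 0] by eventually_elim (use that in \<open>auto intro: newton_gap_nonneg\<close>)
    show "\<forall>\<^sub>F s in at_top. newton_gap d e r s \<le> (r - e) * (s + e) powr (- real d / 2)"
      using eventually_ge_at_top[of 0] by eventually_elim (use that in \<open>intro newton_gap_le, auto\<close>)
    have "((\<lambda>s. (s + e) powr (- real d / 2)) \<longlongrightarrow> 0) at_top"
      using assms by (intro tendsto_neg_powr, simp, real_asymp)
    then show "((\<lambda>s. (r - e) * (s + e) powr (- real d / 2)) \<longlongrightarrow> 0) at_top"
      by (rule tendsto_mult_right_zero)
  qed auto
  show ?thesis
  proof (cases "e \<le> r")
    case False
    then have "(newton_gap d r e \<longlongrightarrow> 0) at_top" using * assms by simp
    then show ?thesis using tendsto_minus[of "newton_gap d r e" 0] by (simp add: newton_gap_swap[of d r e])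
  qed (use * assms in auto)
qed

lemma newton_gap_tendsto:
  assumes "e \<longlonglongrightarrow> e0" "s + e0 > 0"
  shows "(\<lambda>n::nat. newton_gap d (e n) r s) \<longlonglongrightarrow> newton_gap d e0 r s"
  unfolding newton_gap_def by (intro tendsto_intros isCont_tendsto_compose[OF isCont_newton] assms)

lemma mollifier_nonneg: "0 \<le> e \<Longrightarrow> 0 \<le> mollifier d e s"
  by (simp add: mollifier_def)

lemma mollifier_antimono: "0 \<le> e \<Longrightarrow> 0 < s + e \<Longrightarrow> s \<le> t \<Longrightarrow> mollifier d e t \<le> mollifier d e s"
  unfolding mollifier_def by (intro mult_left_mono powr_mono2') auto

text \<open>The maximum is at \<open>s = 0\<close>. For \<open>e = 1\<close> the bound is
  \<open>2 * d\<close>, the origin of the constant \<open>A * (2 * d)\<close> in later estimates;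
  for growing \<open>e\<close> it tends to 0, which removes the auxiliary second parameter of the
  gaps.\<close>

lemma mollifier_le:
  assumes "0 < e" "0 \<le> s" shows "mollifier d e s \<le> 2 * real d * e powr (- real d / 2)"
proof -
  have "mollifier d e s \<le> mollifier d e 0" using assms by (intro mollifier_antimono) auto
  also have "\<dots> = 2 * real d * e powr (- real d / 2)"
    using assms powr_mult_base[of e "- real d / 2 - 1"] by (simp add: mollifier_def)
  finally show ?thesis .
qed

lemma mollifier_le2:
  assumes "0 < e" "0 < s" shows "mollifier d e s \<le> 2 * real d * e * s powr (- real d / 2 - 1)"
  unfolding mollifier_def using assms by (intro mult_left_mono powr_mono2') auto

lemma mollifier_isCont: "s + e > 0 \<Longrightarrow> isCont (mollifier d e) s"
  unfolding mollifier_def[abs_def] by (intro continuous_intros) auto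

lemma mollifier_tendsto_0:
  assumes "0 < e"
  shows "(mollifier d e \<longlongrightarrow> 0) at_top"
proof -
  have "((\<lambda>s. (s + e) powr (- real d / 2 - 1)) \<longlongrightarrow> 0) at_top"
    by (rule tendsto_neg_powr, simp, real_asymp)
  then show ?thesis unfolding mollifier_def[abs_def] by (rule tendsto_mult_right_zero)
qed

text \<open>Since \<open>s \<le> 1\<close>, the interval from \<open>s\<close> to
  \<open>2 * s\<close> lies in that from \<open>s\<close> to \<open>s + 1\<close>, and on it the
  derivative has modulus at least \<open>(2 * s) powr (- d / 2)\<close>. The power on the left
  thereby becomes integrable wherever the singular gap is.\<close>

lemma newton_gap_near_zero:
  assumes "0 < s" "s \<le> 1"
  shows "s powr (1 - real d / 2) \<le> 2 powr (real d / 2) * newton_gap d 0 1 s"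
proof -
  have "s * (2 * s) powr (- real d / 2) \<le> newton d s - newton d (2 * s)"
    using newton_diff_ge[of s "2 * s" d] assms by simp
  also have "\<dots> \<le> newton_gap d 0 1 s" unfolding newton_gap_def using newton_antimono[of "2 * s" "s + 1" d] assms by simp
  finally have "2 powr (real d / 2) * (s * (2 * s) powr (- real d / 2)) \<le> 2 powr (real d / 2) * newton_gap d 0 1 s"
    by (rule mult_left_mono) simp
  moreover have "2 powr (real d / 2) * (s * (2 * s) powr (- real d / 2)) = s powr (1 - real d / 2)"
  proof -
    have "2 powr (real d / 2) * (s * (2 * s) powr (- real d / 2)) =
      (2 powr (real d / 2) * 2 powr (- real d / 2)) * (s * s powr (- real d / 2))"
      using assms by (simp add: powr_mult)
    also have "\<dots> = s powr (1 - real d / 2)"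
      using assms powr_mult_base[of s "- real d / 2"] by (simp flip: powr_add)
    finally show ?thesis .
  qed
  ultimately show ?thesis by argo
qed

text \<open>A domination uniform in \<open>e\<close>, for use near a zero of \<open>a\<close>: there
  \<open>a\<close> supplies the factor \<open>s\<close>, which compensates the part of the
  mollifier's singularity that exceeds the Newton kernel.\<close>

lemma mollifier_mult_le:
  assumes "0 < e" "0 < s" "s \<le> 1"
  shows "mollifier d e s * s \<le> 2 * real d * 2 powr (real d / 2) * newton_gap d 0 1 s"
proof -
  have "e * (s + e) powr (- real d / 2 - 1) * s \<le> (s + e) * (s + e) powr (- real d / 2 - 1) * s"
    using assms by (intro mult_right_mono) auto
  also have "\<dots> = (s + e) powr (- real d / 2) * s"
    using assms powr_mult_base[of "s + e" "- real d / 2 - 1"] by simp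
  also have "\<dots> \<le> s powr (- real d / 2) * s"
    using assms by (intro mult_right_mono powr_mono2') auto
  also have "\<dots> = s powr (1 - real d / 2)"
    using assms powr_mult_base[of s "- real d / 2"] by (simp add: mult.commute)
  also have "\<dots> \<le> 2 powr (real d / 2) * newton_gap d 0 1 s" by (rule newton_gap_near_zero[OF assms(2,3)])
  finally have "2 * real d * (e * (s + e) powr (- real d / 2 - 1) * s) \<le> 2 * real d * (2 powr (real d / 2) * newton_gap d 0 1 s)"
    by (intro mult_left_mono) auto
  then show ?thesis by (simp add: mollifier_def algebra_simps)
qed

text \<open>The derivative in the shift \<open>u\<close> is
  \<open>(s + u) powr (- d / 2) - u powr (- d / 2)\<close>, which is nonpositive. This makes the
  passage of the second gap parameter to infinity a monotone limit.\<close>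

lemma newton_shift_antimono:
  assumes "0 \<le> s" "0 < r" "r \<le> r'"
  shows "newton d r' - newton d (s + r') \<le> newton d r - newton d (s + r)"
proof (rule DERIV_nonpos_imp_nonincreasing[OF assms(3)])
  fix u assume u: "r \<le> u" "u \<le> r'"
  have "((\<lambda>u. newton d (s + u)) has_real_derivative - ((s + u) powr (- real d / 2))) (at u)"
    by (rule DERIV_chain2[OF newton_deriv, THEN DERIV_cong]) (use u assms in \<open>auto intro!: derivative_eq_intros\<close>)
  with newton_deriv[of u d]
  have "((\<lambda>u. newton d u - newton d (s + u)) has_real_derivative - (u powr (- real d / 2)) - - ((s + u) powr (- real d / 2))) (at u)"
    using u assms by (intro DERIV_diff) auto
  moreover have "(s + u) powr (- real d / 2) \<le> u powr (- real d / 2)"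
    using u assms by (intro powr_mono2') auto
  ultimately show "\<exists>y. ((\<lambda>u. newton d u - newton d (s + u)) has_real_derivative y) (at u) \<and> y \<le> 0"
    by (intro exI[of _ "- (u powr (- real d / 2)) - - ((s + u) powr (- real d / 2))"]) auto
qed

lemma newton_shift_tendsto_0:
  assumes "0 \<le> s" "d \<noteq> 0"
  shows "(\<lambda>n. newton d (real (Suc n)) - newton d (s + real (Suc n))) \<longlonglongrightarrow> 0"
proof (rule tendsto_sandwich)
  show "\<forall>\<^sub>F n in sequentially. 0 \<le> newton d (real (Suc n)) - newton d (s + real (Suc n))"
    using newton_antimono[of "real (Suc _)" "s + real (Suc _)" d] assms by (intro always_eventually allI) simp
  show "\<forall>\<^sub>F n in sequentially. newton d (real (Suc n)) - newton d (s + real (Suc n)) \<le> s * (real (Suc n)) powr (- real d / 2)"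
  proof (intro always_eventually allI)
    show "newton d (real (Suc n)) - newton d (s + real (Suc n)) \<le> s * (real (Suc n)) powr (- real d / 2)" for n
      using newton_diff_le[of "real (Suc n)" "s + real (Suc n)" d] assms by simp
  qed
  have "(\<lambda>n. (real (Suc n)) powr (- real d / 2)) \<longlonglongrightarrow> 0"
    by (rule tendsto_neg_powr, use assms in simp, real_asymp)
  then show "(\<lambda>n. s * (real (Suc n)) powr (- real d / 2)) \<longlonglongrightarrow> 0" by (rule tendsto_mult_right_zero)
qed auto

section \<open>Smooth cut-off and radial functions\<close>

text \<open>The case \<open>m = 0\<close> is the classical flat function
  \<open>exp (- 1 / s)\<close>. The powers in the denominator make the family, up to linear
  combinations, closed under differentiation.\<close>

definition bump :: "nat \<Rightarrow> real \<Rightarrow> real" where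
  "bump m s = (if s \<le> 0 then 0 else exp (- (1 / s)) / s ^ m)"

lemma bump_tendsto_0: "(bump m \<longlongrightarrow> 0) (at_right 0)"
proof (rule Lim_transform_eventually)
  have "((\<lambda>u::real. u ^ m / exp u) \<longlongrightarrow> 0) at_top"
    by (rule tendsto_power_div_exp_0)
  then have "((\<lambda>s::real. inverse s ^ m / exp (inverse s)) \<longlongrightarrow> 0) (at_right 0)"
    by (rule filterlim_compose[OF _ filterlim_inverse_at_top_right])
  then show "((\<lambda>s::real. inverse s ^ m / exp (inverse s)) \<longlongrightarrow> 0) (at_right 0)" .
  show "\<forall>\<^sub>F s in at_right 0. inverse s ^ m / exp (inverse s) = bump m s"
    using eventually_at_right_less[of "0::real"]
    by eventually_elim (auto simp: bump_def exp_minus field_simps)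
qed

lemma bump_deriv: "(bump m has_real_derivative bump (m + 2) s - real m * bump (m + 1) s) (at s)"
proof -
  consider "s > 0" | "s < 0" | "s = 0" by linarith
  then show ?thesis
  proof cases
    case 1
    have "((\<lambda>s. exp (- (1 / s))) has_real_derivative exp (- (1 / s)) * (1 / s^2)) (at s)"
      using 1 by (auto intro!: derivative_eq_intros simp: power2_eq_square)
    moreover have "((\<lambda>s. inverse s ^ m) has_real_derivative real m * (- (inverse s ^ 2) * inverse s ^ (m - 1))) (at s)"
      using 1 DERIV_power[OF DERIV_inverse[of s UNIV], of m] by (simp add: numeral_2_eq_2)
    ultimately have "((\<lambda>s. exp (- (1 / s)) * inverse s ^ m) has_real_derivative
       exp (- (1 / s)) * (1 / s^2) * inverse s ^ m + exp (- (1 / s)) * (real m * inverse s ^ (m - 1) * (- (inverse s ^ 2)))) (at s)"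
      by (rule DERIV_mult[THEN DERIV_cong]) (simp add: algebra_simps)
    also have "exp (- (1 / s)) * (1 / s^2) * inverse s ^ m + exp (- (1 / s)) * (real m * inverse s ^ (m - 1) * (- (inverse s ^ 2)))
      = bump (m + 2) s - real m * bump (m + 1) s"
    proof (cases m)
      case (Suc k)
      have "exp (- (1 / s)) * (real m * inverse s ^ (m - 1) * (- (inverse s ^ 2))) = - real m * bump (m + 1) s"
        using 1 Suc by (simp add: bump_def power2_eq_square divide_inverse power_inverse algebra_simps)
      moreover have "exp (- (1 / s)) * (1 / s^2) * inverse s ^ m = bump (m + 2) s"
        using 1 by (simp add: bump_def power2_eq_square divide_inverse power_inverse)
      ultimately show ?thesis by simp
    qed (use 1 in \<open>simp add: bump_def power2_eq_square\<close>)
    finally show ?thesis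
    proof (rule DERIV_cong_ev[THEN iffD1, rotated -1])
      have "\<forall>\<^sub>F u in nhds s. u > 0" using 1 by (intro eventually_nhds_in_open[of "{0<..}", simplified]) auto
      then show "\<forall>\<^sub>F x in nhds s. exp (- (1 / x)) * inverse x ^ m = bump m x"
        by eventually_elim (auto simp: bump_def field_simps)
    qed auto
  next
    case 2
    have "((\<lambda>s. 0) has_real_derivative 0) (at s)" by simp
    then show ?thesis
    proof (rule DERIV_cong_ev[THEN iffD1, rotated -1])
      have "\<forall>\<^sub>F u in nhds s. u < 0" using 2 by (intro eventually_nhds_in_open[of "{..<0}", simplified]) auto
      then show "\<forall>\<^sub>F x in nhds s. 0 = bump m x"
        by eventually_elim (auto simp: bump_def)
    qed (use 2 in \<open>auto simp: bump_def\<close>)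
  next
    case 3
    have "((\<lambda>h. bump m h / h) \<longlongrightarrow> 0) (at_right 0)"
    proof (rule Lim_transform_eventually[OF bump_tendsto_0[of "m + 1"]])
      show "\<forall>\<^sub>F s in at_right 0. bump (m + 1) s = bump m s / s"
        using eventually_at_right_less[of "0::real"]
        by eventually_elim (auto simp: bump_def)
    qed
    moreover have "((\<lambda>h. bump m h / h) \<longlongrightarrow> 0) (at_left 0)"
    proof (rule Lim_transform_eventually[OF tendsto_const])
      show "\<forall>\<^sub>F s in at_left 0. 0 = bump m s / s"
        using eventually_at_left_real[of "-1" "0::real"]
        by (auto simp: bump_def elim!: eventually_mono)
    qed
    ultimately have "((\<lambda>h. bump m h / h) \<longlongrightarrow> 0) (at 0)"
      by (simp add: filterlim_at_split)
    then show ?thesis using 3 by (simp add: DERIV_def bump_def)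
  qed
qed

lemma continuous_on_bump: "continuous_on A (bump m)"
  using bump_deriv DERIV_isCont continuous_at_imp_continuous_on by blast

text \<open>The algebra contains every function that occurs in an iterated partial derivative of a cut-off
  Newton kernel and is closed under partial derivatives; this is what yields smoothness.\<close>

inductive radial_alg :: "'a::euclidean_space \<Rightarrow> real \<Rightarrow> ('a \<Rightarrow> real) \<Rightarrow> bool" for p :: 'a and N :: real where
  const: "radial_alg p N (\<lambda>x. c)"
| coord: "radial_alg p N (\<lambda>x. (x - p) \<bullet> b)"
| bump: "radial_alg p N (\<lambda>x. bump m (1 - (norm (x - p))\<^sup>2 / N))"
| powr: "e > 0 \<Longrightarrow> radial_alg p N (\<lambda>x. ((norm (x - p))\<^sup>2 + e) powr q)"
| newton: "e > 0 \<Longrightarrow> radial_alg p N (\<lambda>x. newton d ((norm (x - p))\<^sup>2 + e))"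
| add: "radial_alg p N f \<Longrightarrow> radial_alg p N g \<Longrightarrow> radial_alg p N (\<lambda>x. f x + g x)"
| mult: "radial_alg p N f \<Longrightarrow> radial_alg p N g \<Longrightarrow> radial_alg p N (\<lambda>x. f x * g x)"

lemma has_derivative_radial:
  fixes p x :: "'a::euclidean_space"
  assumes "(g has_real_derivative g') (at ((norm (x - p))\<^sup>2))"
  shows "((\<lambda>x. g ((norm (x - p))\<^sup>2)) has_derivative (\<lambda>h. g' * (2 * ((x - p) \<bullet> h)))) (at x)"
proof -
  have "((\<lambda>x. (norm (x - p))\<^sup>2) has_derivative (\<lambda>h. 2 * ((x - p) \<bullet> h))) (at x)"
    unfolding power2_norm_eq_inner
    by (auto intro!: derivative_eq_intros simp: inner_commute)
  then show ?thesis
    using assms by (auto intro!: has_derivative_compose[of _ _ x UNIV g "\<lambda>h. g' * h", simplified] simp: has_field_derivative_def mult_ac)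
qed

lemma radial_alg_deriv:
  fixes p :: "'a::euclidean_space"
  assumes "radial_alg p N f"
  shows "\<exists>f'. (\<forall>x. (f has_derivative f' x) (at x)) \<and> (\<forall>b. radial_alg p N (\<lambda>x. f' x b))"
  using assms
proof induction
  case (const c)
  then show ?case by (intro exI[of _ "\<lambda>x h. 0"]) (auto intro: radial_alg.const)
next
  case (coord b)
  show ?case
    by (intro exI[of _ "\<lambda>x h. h \<bullet> b"]) (auto intro: radial_alg.const intro!: derivative_eq_intros)
next
  case (bump m)
  \<comment> \<open>The difference from \<open>bump_deriv\<close> is written as a sum with the
    constant factor \<open>- real m\<close>, since \<open>radial_alg\<close> has rules for sums and
    products only.\<close>
  have "((\<lambda>x. bump m (1 - (norm (x - p))\<^sup>2 / N)) has_derivative 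
      (\<lambda>h. ((bump (m + 2) (1 - (norm (x - p))\<^sup>2 / N) + (- real m) * bump (m + 1) (1 - (norm (x - p))\<^sup>2 / N)) * (- 1 / N)) * (2 * ((x - p) \<bullet> h)))) (at x)" for x
  proof (rule has_derivative_radial[where g = "\<lambda>s. bump m (1 - s / N)"])
    show "((\<lambda>s. bump m (1 - s / N)) has_real_derivative
       (bump (m + 2) (1 - (norm (x - p))\<^sup>2 / N) + (- real m) * bump (m + 1) (1 - (norm (x - p))\<^sup>2 / N)) * (- 1 / N)) (at ((norm (x - p))\<^sup>2))"
    proof (rule DERIV_chain2[OF bump_deriv, THEN DERIV_cong])
      show "((\<lambda>s. 1 - s / N) has_real_derivative 0 - 1 / N) (at ((norm (x - p))\<^sup>2))"
        by (intro DERIV_diff DERIV_const DERIV_cdivide DERIV_ident)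
    qed simp
  qed
  then show ?case
    by (intro exI[of _ "\<lambda>x h. ((bump (m + 2) (1 - (norm (x - p))\<^sup>2 / N) + (- real m) * bump (m + 1) (1 - (norm (x - p))\<^sup>2 / N)) * (- 1 / N)) * (2 * ((x - p) \<bullet> h))"] conjI)
       (assumption | intro allI radial_alg.intros)+
next
  case (powr e q)
  have "((\<lambda>x. ((norm (x - p))\<^sup>2 + e) powr q) has_derivative 
      (\<lambda>h. (q * ((norm (x - p))\<^sup>2 + e) powr (q - 1)) * (2 * ((x - p) \<bullet> h)))) (at x)" for x
  proof (rule has_derivative_radial[where g = "\<lambda>s. (s + e) powr q"])
    have "(norm (x - p))\<^sup>2 + e > 0" using powr by (simp add: add_nonneg_pos)
    then show "((\<lambda>s. (s + e) powr q) has_real_derivative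
       (q * ((norm (x - p))\<^sup>2 + e) powr (q - 1))) (at ((norm (x - p))\<^sup>2))"
      by (intro DERIV_chain2[OF has_real_derivative_powr, THEN DERIV_cong]) (auto intro!: derivative_eq_intros)
  qed
  with powr show ?case
    by (intro exI[of _ "\<lambda>x h. (q * ((norm (x - p))\<^sup>2 + e) powr (q - 1)) * (2 * ((x - p) \<bullet> h))"])
       (auto intro!: radial_alg.intros)
next
  case (newton e d)
  have "((\<lambda>x. newton d ((norm (x - p))\<^sup>2 + e)) has_derivative 
      (\<lambda>h. ((-1) * ((norm (x - p))\<^sup>2 + e) powr (- real d / 2)) * (2 * ((x - p) \<bullet> h)))) (at x)" for x
  proof (rule has_derivative_radial[where g = "\<lambda>s. newton d (s + e)"])
    have "(norm (x - p))\<^sup>2 + e > 0" using newton by (simp add: add_nonneg_pos)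
    then show "((\<lambda>s. newton d (s + e)) has_real_derivative
       ((-1) * ((norm (x - p))\<^sup>2 + e) powr (- real d / 2))) (at ((norm (x - p))\<^sup>2))"
      by (intro DERIV_chain2[OF newton_deriv, THEN DERIV_cong]) (auto intro!: derivative_eq_intros)
  qed
  with newton show ?case
    by (intro exI[of _ "\<lambda>x h. ((-1) * ((norm (x - p))\<^sup>2 + e) powr (- real d / 2)) * (2 * ((x - p) \<bullet> h))"] conjI)
       (assumption | intro allI radial_alg.intros)+
next
  case (add f g)
  then obtain f' g' where "\<forall>x. (f has_derivative f' x) (at x)" "\<forall>b. radial_alg p N (\<lambda>x. f' x b)"
    "\<forall>x. (g has_derivative g' x) (at x)" "\<forall>b. radial_alg p N (\<lambda>x. g' x b)" by blast
  then show ?case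
    by (intro exI[of _ "\<lambda>x h. f' x h + g' x h"]) (auto intro!: radial_alg.intros has_derivative_add)
next
  case (mult f g)
  then obtain f' g' where "\<forall>x. (f has_derivative f' x) (at x)" "\<forall>b. radial_alg p N (\<lambda>x. f' x b)"
    "\<forall>x. (g has_derivative g' x) (at x)" "\<forall>b. radial_alg p N (\<lambda>x. g' x b)" by blast
  then show ?case using mult.hyps
    by (intro exI[of _ "\<lambda>x h. f x * g' x h + f' x h * g x"]) (auto intro!: radial_alg.intros has_derivative_mult)
qed

lemma smooth_radial_alg:
  assumes "radial_alg p N f" shows "smooth f"
proof -
  have "C_k k f" for k
    using assms
  proof (induction k arbitrary: f)
    case 0
    then show ?case using radial_alg_deriv[OF 0] has_derivative_continuous
      by (metis C_k.simps(1) continuous_at_imp_continuous_on)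
  next
    case (Suc k)
    obtain f' where f': "\<And>x. (f has_derivative f' x) (at x)" "\<And>b. radial_alg p N (\<lambda>x. f' x b)"
      using radial_alg_deriv[OF Suc.prems] by blast
    have "partial_derivative b f = (\<lambda>x. f' x b)" for b
      using frechet_derivative_at[OF f'(1)] by (auto simp: partial_derivative_def)
    then show ?case using f' Suc.IH by (auto simp: differentiable_def)
  qed
  then show ?thesis by (simp add: smooth_def)
qed

section \<open>Radial Laplacians and cut-off kernels\<close>

lemma laplacian_radial:
  fixes p x :: "'a::euclidean_space"
  assumes g: "\<And>s. 0 \<le> s \<Longrightarrow> (g has_real_derivative g1 s) (at s)"
    and g1: "\<And>s. 0 \<le> s \<Longrightarrow> (g1 has_real_derivative g2 s) (at s)"
  shows "laplacian (\<lambda>x. g ((norm (x - p))\<^sup>2)) x =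
    4 * (norm (x - p))\<^sup>2 * g2 ((norm (x - p))\<^sup>2) + 2 * real DIM('a) * g1 ((norm (x - p))\<^sup>2)"
proof -
  let ?q = "\<lambda>x. (norm (x - p))\<^sup>2"
  have p1: "partial_derivative b (\<lambda>x. g (?q x)) = (\<lambda>x. g1 (?q x) * (2 * ((x - p) \<bullet> b)))" for b
    unfolding partial_derivative_def
    by (subst frechet_derivative_at[OF has_derivative_radial[OF g], symmetric]) auto
  have p2: "partial_derivative b (partial_derivative b (\<lambda>x. g (?q x))) x = 
     4 * g2 (?q x) * ((x - p) \<bullet> b)\<^sup>2 + 2 * g1 (?q x)" if b: "b \<in> Basis" for b
  proof -
    have "((\<lambda>x. g1 (?q x) * (2 * ((x - p) \<bullet> b))) has_derivative
       (\<lambda>h. g1 (?q x) * (2 * (h \<bullet> b)) + (g2 (?q x) * (2 * ((x - p) \<bullet> h))) * (2 * ((x - p) \<bullet> b)))) (at x)"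
      by (intro has_derivative_mult has_derivative_radial g1) (auto intro!: derivative_eq_intros)
    from frechet_derivative_at[OF this, symmetric] show ?thesis
      unfolding p1 partial_derivative_def using b by (simp add: power2_eq_square inner_same_Basis)
  qed
  have "laplacian (\<lambda>x. g (?q x)) x = (\<Sum>b\<in>Basis. 4 * g2 (?q x) * ((x - p) \<bullet> b)\<^sup>2 + 2 * g1 (?q x))"
    unfolding laplacian_def using p2 by (intro sum.cong) auto
  also have "\<dots> = 4 * g2 (?q x) * (\<Sum>b\<in>Basis. ((x - p) \<bullet> b)\<^sup>2) + 2 * real DIM('a) * g1 (?q x)"
    by (simp add: sum.distrib sum_distrib_left)
  also have "(\<Sum>b\<in>Basis. ((x - p) \<bullet> b)\<^sup>2) = ?q x"
    using euclidean_inner[of "x - p" "x - p"] unfolding power2_norm_eq_inner by (simp add: power2_eq_square)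
  finally show ?thesis by simp
qed

text \<open>The factor \<open>exp 1\<close> normalises the cut-off to 1 at \<open>s = 0\<close>,
  because \<open>bump 0 1 = exp (- 1)\<close>. It vanishes for \<open>s \<ge> N\<close>, so the
  radius in space is \<open>sqrt N\<close>.\<close>

definition cut_newton_gap :: "nat \<Rightarrow> real \<Rightarrow> real \<Rightarrow> real \<Rightarrow> real \<Rightarrow> real" where
  "cut_newton_gap d e r N s = newton_gap d e r s * (exp 1 * bump 0 (1 - s / N))"

lemma bump_bound: obtains B where "B > 0" "\<And>s. s \<le> 1 \<Longrightarrow> \<bar>bump m s\<bar> \<le> B"
proof -
  have "bounded (bump m ` {0..1})"
    by (intro compact_imp_bounded compact_continuous_image continuous_on_bump) auto
  then obtain B where B: "\<And>y. y \<in> bump m ` {0..1} \<Longrightarrow> norm y \<le> B" unfolding bounded_iff by blast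
  have "\<bar>bump m s\<bar> \<le> max B 1" if "s \<le> 1" for s
    using B[of "bump m s"] that by (cases "s \<ge> 0") (auto simp: bump_def)
  then show ?thesis by (rule that[of "max B 1", rotated]) auto
qed

text \<open>\<open>g1\<close> and \<open>g2\<close> are the derivatives in \<open>s = |z|^2\<close>,
  and \<open>4 * s * g2 + 2 * d * g1\<close> is the Laplacian of the radial function. The generator
  is known on compactly supported functions only; the bound \<open>B\<close>, which does not depend
  on \<open>N\<close>, and the pointwise limits allow dominated convergence to carry its formula
  over to the full gap.\<close>

lemma cut_newton_gap_properties:
  fixes d :: nat
  assumes e: "0 < e" and r: "0 < r"
  obtains g1 g2 :: "real \<Rightarrow> real \<Rightarrow> real" and B where
    "\<And>N s. 0 < N \<Longrightarrow> 0 \<le> s \<Longrightarrow> (cut_newton_gap d e r N has_real_derivative g1 N s) (at s)"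
    "\<And>N s. 0 < N \<Longrightarrow> 0 \<le> s \<Longrightarrow> (g1 N has_real_derivative g2 N s) (at s)"
    "\<And>N s. 0 < N \<Longrightarrow> 0 \<le> s \<Longrightarrow> \<bar>cut_newton_gap d e r N s\<bar> \<le> B"
    "\<And>N s. 1 \<le> N \<Longrightarrow> 0 \<le> s \<Longrightarrow> \<bar>4 * s * g2 N s + 2 * real d * g1 N s\<bar> \<le> B"
    "\<And>s. 0 \<le> s \<Longrightarrow> (\<lambda>n. cut_newton_gap d e r (real (Suc n)) s) \<longlonglongrightarrow> newton_gap d e r s"
    "\<And>s. 0 \<le> s \<Longrightarrow> (\<lambda>n. 4 * s * g2 (real (Suc n)) s + 2 * real d * g1 (real (Suc n)) s) \<longlonglongrightarrow> mollifier d r s - mollifier d e s"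
proof -
  define k where "k = newton_gap d e r"
  define k1 where "k1 s = (s + r) powr (- real d / 2) - (s + e) powr (- real d / 2)" for s
  define k2 where "k2 s = real d / 2 * ((s + e) powr (- real d / 2 - 1) - (s + r) powr (- real d / 2 - 1))" for s
  define c where "c s = exp 1 * bump 0 (1 - s)" for s
  define c1 where "c1 s = - (exp 1 * bump 2 (1 - s))" for s
  define c2 where "c2 s = exp 1 * (bump 4 (1 - s) - 2 * bump 3 (1 - s))" for s
  have k_d: "(k has_real_derivative k1 s) (at s)" if "0 \<le> s" for s
  proof -
    have "((\<lambda>s. newton d (s + u)) has_real_derivative - ((s + u) powr (- real d / 2))) (at s)" if "u > 0" for u
      by (rule DERIV_chain2[OF newton_deriv, THEN DERIV_cong]) (use that \<open>0 \<le> s\<close> in \<open>auto intro!: derivative_eq_intros\<close>)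
    from DERIV_diff[OF this[OF e] this[OF r]] show ?thesis
      by (simp add: k_def newton_gap_def[abs_def] k1_def)
  qed
  have k1_d: "(k1 has_real_derivative k2 s) (at s)" if "0 \<le> s" for s
  proof -
    have "((\<lambda>s. (s + u) powr q) has_real_derivative q * (s + u) powr (q - 1)) (at s)" if "u > 0" for u q
      by (rule DERIV_chain2[OF has_real_derivative_powr, THEN DERIV_cong]) (use that \<open>0 \<le> s\<close> in \<open>auto intro!: derivative_eq_intros\<close>)
    from DERIV_diff[OF this[OF r, of "- real d / 2"] this[OF e, of "- real d / 2"]] show ?thesis
      by (simp add: k1_def[abs_def] k2_def algebra_simps)
  qed
  have bump_d: "((\<lambda>s. bump m (1 - s / N)) has_real_derivative
      (bump (m + 2) (1 - s / N) - real m * bump (m + 1) (1 - s / N)) * (0 - 1 / N)) (at s)" for s N m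
    by (rule DERIV_chain2[OF bump_deriv]) (intro DERIV_diff DERIV_const DERIV_cdivide DERIV_ident)
  have c_d: "((\<lambda>s. c (s / N)) has_real_derivative c1 (s / N) / N) (at s)" for s N
    using DERIV_cmult[OF bump_d[of 0 N s], of "exp 1"] by (simp add: c_def[abs_def] c1_def eval_nat_numeral)
  have c1_d: "((\<lambda>s. c1 (s / N)) has_real_derivative c2 (s / N) / N) (at s)" for s N
    using DERIV_cmult[OF bump_d[of 2 N s], of "- exp 1"] by (simp add: c1_def[abs_def] c2_def eval_nat_numeral algebra_simps diff_divide_distrib)
  define g1 where "g1 N s = k1 s * c (s / N) + k s * (c1 (s / N) / N)" for N s
  define g2 where "g2 N s = k2 s * c (s / N) + 2 * k1 s * (c1 (s / N) / N) + k s * (c2 (s / N) / N / N)" for N s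
  \<comment> \<open>Splitting one factor \<open>s + u\<close> off the lower power makes the terms
    with \<open>s\<close> cancel; the remainder
    \<open>2 * d * u * (s + u) powr (- d / 2 - 1)\<close> is the mollifier.\<close>
  have lap: "4 * s * k2 s + 2 * real d * k1 s = mollifier d r s - mollifier d e s" if "0 \<le> s" for s
  proof -
    have "(s + u) powr (- real d / 2) = (s + u) * (s + u) powr (- real d / 2 - 1)" if "u > 0" for u
      using powr_mult_base[of "s + u" "- real d / 2 - 1"] that \<open>0 \<le> s\<close> by simp
    from this[OF e] this[OF r] show ?thesis
      unfolding k1_def k2_def mollifier_def by (simp add: algebra_simps)
  qed
  \<comment> \<open>The terms are grouped so that every unbounded factor \<open>s\<close> occurs as
    \<open>s / N\<close> next to a derivative of the cut-off.\<close>
  have lap_N: "4 * s * g2 N s + 2 * real d * g1 N s = (mollifier d r s - mollifier d e s) * c (s / N)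
      + 8 * k1 s * (s / N * c1 (s / N)) + 4 * k s * (s / N * c2 (s / N)) / N + 2 * real d * k s * c1 (s / N) / N"
    if "0 \<le> s" for s N
    unfolding lap[OF that, symmetric] g1_def g2_def by (simp add: algebra_simps add_divide_distrib)
  obtain Bk where Bk: "\<And>s. 0 \<le> s \<Longrightarrow> \<bar>k s\<bar> \<le> Bk" using newton_gap_abs_bound[OF e r, of d] unfolding k_def by blast
  define Bk1 where "Bk1 = r powr (- real d / 2) + e powr (- real d / 2)"
  have Bk1: "\<bar>k1 s\<bar> \<le> Bk1" if "0 \<le> s" for s
  proof -
    have "(s + u) powr (- real d / 2) \<le> u powr (- real d / 2)" if "u > 0" for u
      using that \<open>0 \<le> s\<close> by (intro powr_mono2') auto
    from this[OF e] this[OF r] show ?thesis unfolding k1_def Bk1_def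
      by (smt (verit) powr_ge_zero)
  qed
  define Bp where "Bp = 2 * real d * r powr (- real d / 2) + 2 * real d * e powr (- real d / 2)"
  have Bp: "\<bar>mollifier d r s - mollifier d e s\<bar> \<le> Bp" if "0 \<le> s" for s
    using mollifier_le[OF e that, of d] mollifier_le[OF r that, of d] mollifier_nonneg[of e d s] mollifier_nonneg[of r d s] e r
    unfolding Bp_def by linarith
  obtain b0 b2 b3 b4 where b: "b0 > 0" "b2 > 0" "b3 > 0" "b4 > 0"
     "\<And>s. s \<le> 1 \<Longrightarrow> \<bar>bump 0 s\<bar> \<le> b0" "\<And>s. s \<le> 1 \<Longrightarrow> \<bar>bump 2 s\<bar> \<le> b2"
     "\<And>s. s \<le> 1 \<Longrightarrow> \<bar>bump 3 s\<bar> \<le> b3" "\<And>s. s \<le> 1 \<Longrightarrow> \<bar>bump 4 s\<bar> \<le> b4"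
    using bump_bound[of 0] bump_bound[of 2] bump_bound[of 3] bump_bound[of 4] by metis
  define Bc where "Bc = exp 1 * (b0 + b2 + 2 * b3 + b4)"
  have Bc: "\<bar>c s\<bar> \<le> Bc" "\<bar>c1 s\<bar> \<le> Bc" "\<bar>c2 s\<bar> \<le> Bc" if "0 \<le> s" for s
  proof -
    have 1: "\<bar>bump 0 (1 - s)\<bar> \<le> b0" "\<bar>bump 2 (1 - s)\<bar> \<le> b2" "\<bar>bump 3 (1 - s)\<bar> \<le> b3" "\<bar>bump 4 (1 - s)\<bar> \<le> b4"
      using b that by auto
    show "\<bar>c s\<bar> \<le> Bc" "\<bar>c1 s\<bar> \<le> Bc" "\<bar>c2 s\<bar> \<le> Bc"
      unfolding c_def c1_def c2_def Bc_def abs_mult abs_minus_cancel abs_exp_cancel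
      using 1 b by (intro mult_left_mono; simp)+
  qed
  \<comment> \<open>\<open>c1\<close> and \<open>c2\<close> vanish beyond 1, so the extra factor
    \<open>s\<close> costs nothing.\<close>
  have Bc_s: "\<bar>s * c1 s\<bar> \<le> Bc" "\<bar>s * c2 s\<bar> \<le> Bc" if "0 \<le> s" for s
  proof -
    have *: "\<bar>s * v\<bar> \<le> Bc" if "\<bar>v\<bar> \<le> Bc" "s \<le> 1" for v
      using mult_mono[of "\<bar>s\<bar>" 1 "\<bar>v\<bar>" Bc] that \<open>0 \<le> s\<close> by (simp add: abs_mult)
    have Bc0: "Bc \<ge> 0" using b(1-4) by (simp add: Bc_def)
    have "c1 s = 0" "c2 s = 0" if "\<not> s \<le> 1" using that by (auto simp: c1_def c2_def bump_def)
    then show "\<bar>s * c1 s\<bar> \<le> Bc" "\<bar>s * c2 s\<bar> \<le> Bc"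
      using *[OF Bc(2)[OF that]] *[OF Bc(3)[OF that]] Bc0 by fastforce+
  qed
  have cut: "cut_newton_gap d e r N s = k s * c (s / N)" for N s by (simp add: cut_newton_gap_def k_def c_def)
  have nn: "0 \<le> Bk" "0 \<le> Bk1" "0 \<le> Bp" "0 \<le> Bc"
    by (rule order_trans[OF abs_ge_zero Bk[OF order_refl]] order_trans[OF abs_ge_zero Bk1[OF order_refl]]
      order_trans[OF abs_ge_zero Bp[OF order_refl]] order_trans[OF abs_ge_zero Bc(1)[OF order_refl]])+
  define B where "B = Bk * Bc + (Bp * Bc + 8 * Bk1 * Bc + 4 * Bk * Bc + 2 * real d * Bk * Bc)"
  have lim0: "(\<lambda>n. s / real (Suc n)) \<longlonglongrightarrow> 0" for s :: real by real_asymp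
  have c0: "c 0 = 1" by (simp add: c_def bump_def exp_minus)
  have limc: "(\<lambda>n. v (s / real (Suc n))) \<longlonglongrightarrow> v 0" if "continuous_on UNIV v" for v :: "real \<Rightarrow> real" and s :: real
    by (rule continuous_on_tendsto_compose[OF that lim0]) auto
  have cc: "continuous_on UNIV c" "continuous_on UNIV c1" "continuous_on UNIV c2"
    unfolding c_def c1_def c2_def
    by (intro continuous_intros continuous_on_compose2[OF continuous_on_bump[of UNIV]] subset_UNIV)+
  show ?thesis
  proof (rule that[of g1 g2 B])
    show "(cut_newton_gap d e r N has_real_derivative g1 N s) (at s)" if "0 < N" "0 \<le> s" for N s
      using DERIV_mult[OF k_d[OF that(2)] c_d] by (simp add: cut[abs_def] g1_def algebra_simps)
    show "(g1 N has_real_derivative g2 N s) (at s)" if "0 < N" "0 \<le> s" for N s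
      unfolding g1_def[abs_def]
      by (rule DERIV_cong[OF DERIV_add[OF DERIV_mult[OF k1_d[OF that(2)] c_d[where N = N]]
            DERIV_mult[OF k_d[OF that(2)] DERIV_cdivide[OF c1_d[where N = N], of N]]]])
        (use that in \<open>simp add: g2_def field_simps\<close>)
    show "\<bar>cut_newton_gap d e r N s\<bar> \<le> B" if "0 < N" "0 \<le> s" for N s
    proof -
      have "\<bar>k s * c (s / N)\<bar> \<le> Bk * Bc" unfolding abs_mult using that nn by (intro mult_mono Bk Bc) auto
      also have "\<dots> \<le> B" unfolding B_def using nn by simp
      finally show ?thesis by (simp add: cut)
    qed
    show "\<bar>4 * s * g2 N s + 2 * real d * g1 N s\<bar> \<le> B" if N: "1 \<le> N" and s: "0 \<le> s" for N s
    proof -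
      have sN: "0 \<le> s / N" using N s by auto
      have div: "\<bar>v / N\<bar> \<le> w" if "\<bar>v\<bar> \<le> w" for v w
      proof -
        have "\<bar>v\<bar> / N \<le> \<bar>v\<bar> / 1" using N by (intro divide_left_mono) auto
        then show ?thesis using that N by (simp add: abs_divide)
      qed
      have "\<bar>(mollifier d r s - mollifier d e s) * c (s / N)\<bar> \<le> Bp * Bc"
        unfolding abs_mult using s sN nn by (intro mult_mono Bp Bc) auto
      moreover have "\<bar>8 * k1 s * (s / N * c1 (s / N))\<bar> \<le> 8 * Bk1 * Bc"
        unfolding abs_mult[of "8 * k1 s"] using s sN nn Bk1[OF s] by (intro mult_mono Bc_s) auto
      moreover have "\<bar>4 * k s * (s / N * c2 (s / N)) / N\<bar> \<le> 4 * Bk * Bc"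
        unfolding abs_mult[of "4 * k s"] using s sN nn Bk[OF s] by (intro div, unfold abs_mult[of "4 * k s"]) (intro mult_mono Bc_s, auto)
      moreover have "\<bar>2 * real d * k s * c1 (s / N) / N\<bar> \<le> 2 * real d * Bk * Bc"
        using s sN nn Bk[OF s] by (intro div, unfold abs_mult[of "2 * real d * k s"]) (intro mult_mono Bc, auto simp: abs_mult mult_left_mono)
      moreover have "0 \<le> Bk * Bc" using nn by simp
      moreover have "\<bar>q1 + q2 + q3 + q4\<bar> \<le> v + (w1 + w2 + w3 + w4)"
        if "\<bar>q1\<bar> \<le> w1" "\<bar>q2\<bar> \<le> w2" "\<bar>q3\<bar> \<le> w3" "\<bar>q4\<bar> \<le> w4" "0 \<le> v" for q1 q2 q3 q4 w1 w2 w3 w4 v :: real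
        using that by linarith
      ultimately show ?thesis unfolding lap_N[OF s] B_def by blast
    qed
    show "(\<lambda>n. cut_newton_gap d e r (real (Suc n)) s) \<longlonglongrightarrow> newton_gap d e r s" for s
      using tendsto_mult[OF tendsto_const[of "k s"] limc[OF cc(1), of s]] unfolding cut c0 by (simp add: k_def)
    show "(\<lambda>n. 4 * s * g2 (real (Suc n)) s + 2 * real d * g1 (real (Suc n)) s) \<longlonglongrightarrow> mollifier d r s - mollifier d e s"
      if s: "0 \<le> s" for s
    proof -
      have inv: "(\<lambda>n. 1 / real (Suc n)) \<longlonglongrightarrow> 0" using lim0[of 1] .
      have "(\<lambda>n. (mollifier d r s - mollifier d e s) * c (s / real (Suc n))
        + 8 * k1 s * (s / real (Suc n) * c1 (s / real (Suc n))) 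
        + 4 * k s * (s / real (Suc n) * c2 (s / real (Suc n))) * (1 / real (Suc n)) 
        + 2 * real d * k s * c1 (s / real (Suc n)) * (1 / real (Suc n))) \<longlonglongrightarrow>
        (mollifier d r s - mollifier d e s) * c 0 + 8 * k1 s * (0 * c1 0) + 4 * k s * (0 * c2 0) * 0 + 2 * real d * k s * c1 0 * 0"
        by (intro tendsto_intros lim0 inv limc cc)
      then show ?thesis unfolding lap_N[OF s] by (simp add: c0)
    qed
  qed
qed

lemma smooth_compact_support_cut_newton_gap:
  fixes p :: "'a::euclidean_space"
  assumes "0 < e" "0 < r" "0 < N"
  shows "(\<lambda>z. cut_newton_gap d e r N ((norm (z - p))\<^sup>2)) \<in> smooth_compact_support"
proof -
  have "radial_alg p N (\<lambda>z. (newton d ((norm (z - p))\<^sup>2 + e) + (- 1) * newton d ((norm (z - p))\<^sup>2 + r)) *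
      (exp 1 * bump 0 (1 - (norm (z - p))\<^sup>2 / N)))"
    by (intro radial_alg.intros assms)
  then have "smooth (\<lambda>z. cut_newton_gap d e r N ((norm (z - p))\<^sup>2))"
    by (intro smooth_radial_alg[of p N]) (simp add: cut_newton_gap_def newton_gap_def)
  moreover have "bounded {z. cut_newton_gap d e r N ((norm (z - p))\<^sup>2) \<noteq> 0}"
  proof (rule bounded_subset[OF bounded_cball])
    show "{z. cut_newton_gap d e r N ((norm (z - p))\<^sup>2) \<noteq> 0} \<subseteq> cball p (sqrt N)"
    proof
      fix z assume "z \<in> {z. cut_newton_gap d e r N ((norm (z - p))\<^sup>2) \<noteq> 0}"
      then have "(norm (z - p))\<^sup>2 / N < 1"
        by (auto simp: cut_newton_gap_def bump_def split: if_splits)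
      then have "(norm (z - p))\<^sup>2 \<le> N" using assms by simp
      then show "z \<in> cball p (sqrt N)" by (simp add: dist_norm norm_minus_commute real_le_rsqrt)
    qed
  qed
  then have "compact (closure {z. cut_newton_gap d e r N ((norm (z - p))\<^sup>2) \<noteq> 0})"
    by (simp add: compact_closure)
  ultimately show ?thesis by (simp add: smooth_compact_support_def)
qed

section \<open>Laplace transforms on the half line\<close>

text \<open>By Stone--Weierstrass, polynomials in \<open>exp (- t)\<close> approximate a tent supported where the
  right-continuous function \<open>D\<close> keeps its sign.\<close>

lemma laplace_nonpos:
  fixes D :: "real \<Rightarrow> real"
  assumes meas: "D \<in> borel_measurable borel"
    and bnd: "\<And>t. 0 \<le> t \<Longrightarrow> \<bar>D t\<bar> \<le> C * (1 + t)"
    and rc: "\<And>t. 0 \<le> t \<Longrightarrow> (D \<longlongrightarrow> D t) (at_right t)"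
    and zero0: "\<And>n. (\<integral>t. D t \<partial>density lborel (exponential_density (real (Suc n)))) = 0"
    and t0: "0 \<le> t0"
  shows "D t0 \<le> 0"
proof (rule ccontr)
  note [measurable] = meas
  have zero: "(\<integral>t. indicator {0..} t * (exp (- (real (Suc n) * t)) * D t) \<partial>lborel) = 0" for n
  proof -
    have "0 = (\<integral>t. exponential_density (real (Suc n)) t * D t \<partial>lborel)"
      using zero0[of n] by (subst (asm) integral_density) auto
    also have "\<dots> = (\<integral>t. real (Suc n) * (indicator {0..} t * (exp (- (real (Suc n) * t)) * D t)) \<partial>lborel)"
      by (intro Bochner_Integration.integral_cong) (auto simp: exponential_density_def indicator_def mult_ac)
    finally show ?thesis by simp
  qed
  assume "\<not> D t0 \<le> 0"
  then have "D t0 > 0" by simp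
  from order_tendstoD(1)[OF rc[OF t0] this]
  obtain b where b: "b > t0" "\<And>t. t0 < t \<Longrightarrow> t < b \<Longrightarrow> D t > 0"
    unfolding eventually_at_right_field by auto
  \<comment> \<open>In the variable \<open>s = exp (- t)\<close> the tent is centred at
    \<open>s1\<close>, the image of the midpoint of \<open>t0\<close> and \<open>b\<close>; its half
    width \<open>\<eta>\<close> is the largest that keeps it between \<open>exp (- b)\<close> and
    \<open>exp (- t0)\<close>.\<close>
  define m where "m = (t0 + b) / 2"
  define s1 where "s1 = exp (- m)"
  define \<eta> where "\<eta> = min (exp (- t0) - s1) (s1 - exp (- b))"
  have \<eta>: "\<eta> > 0" using b by (auto simp: \<eta>_def s1_def m_def)
  define f where "f = (\<lambda>s. max 0 (\<eta> - \<bar>s - s1\<bar>))"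
  \<comment> \<open>One factor \<open>exp (- t)\<close> is kept aside to absorb the linear growth of
    \<open>D\<close>. This is why the monomial of degree \<open>i\<close> corresponds to the
    transform at \<open>Suc i\<close>, and the transform at 0 never occurs.\<close>
  define w where "w = (\<lambda>t. indicator {0..} t * (exp (- t) * (1 + t)) :: real)"
  have w: "integrable lborel w"
  proof -
    have "integrable lborel (\<lambda>t::real. t ^ 0 * exp (- t) * indicator {0..} t + t ^ 1 * exp (- t) * indicator {0..} t)"
      by (intro Bochner_Integration.integrable_add integrable.intros[OF has_bochner_integral_I0i_power_exp_m'])
    then show ?thesis by (simp add: w_def algebra_simps)
  qed
  have Cw: "\<bar>indicator {0..} t * (exp (- t) * g * D t)\<bar> \<le> \<bar>C\<bar> * B * w t" if "\<bar>g\<bar> \<le> B" for t g B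
  proof (cases "t \<ge> 0")
    case True
    have "\<bar>g\<bar> * \<bar>D t\<bar> \<le> B * (\<bar>C\<bar> * (1 + t))"
      using that bnd[OF True] True
      by (intro mult_mono) (auto intro: order_trans[OF _ mult_right_mono])
    then have "exp (- t) * (\<bar>g\<bar> * \<bar>D t\<bar>) \<le> exp (- t) * (B * (\<bar>C\<bar> * (1 + t)))" by (intro mult_left_mono) auto
    then show ?thesis using True by (simp add: w_def abs_mult mult_ac)
  qed (simp add: w_def)
  have int_bnd: "integrable lborel (\<lambda>t. indicator {0..} t * (exp (- t) * g (exp (- t)) * D t))"
    if [measurable]: "g \<in> borel_measurable borel" and "\<And>s. 0 \<le> s \<Longrightarrow> s \<le> 1 \<Longrightarrow> \<bar>g s\<bar> \<le> B" for g B
  proof (rule Bochner_Integration.integrable_bound[OF integrable_mult_right[OF w, of "\<bar>C\<bar> * B"]])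
    show "AE t in lborel. norm (indicator {0..} t * (exp (- t) * g (exp (- t)) * D t)) \<le> norm (\<bar>C\<bar> * B * w t)"
    proof (rule AE_I2)
      fix t :: real
      show "norm (indicator {0..} t * (exp (- t) * g (exp (- t)) * D t)) \<le> norm (\<bar>C\<bar> * B * w t)"
      proof (cases "t \<ge> 0")
        case True
        then have "\<bar>g (exp (-t))\<bar> \<le> B" using that(2) by auto
        from Cw[OF this, of t] show ?thesis by auto
      qed simp
    qed
  qed measurable
  have poly: "(\<integral>t. indicator {0..} t * (exp (- t) * g (exp (- t)) * D t) \<partial>lborel) = 0"
    if pg: "real_polynomial_function g" for g :: "real \<Rightarrow> real"
  proof -
    obtain c n where g: "g = (\<lambda>x. \<Sum>i\<le>n. c i * x ^ i)"
      using pg unfolding real_polynomial_function_iff_sum by blast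
    have *: "integrable lborel (\<lambda>t. indicator {0..} t * (exp (- t) * (exp (- t)) ^ i * D t))" for i
      by (rule int_bnd[of "\<lambda>s. s ^ i" 1]) (auto simp: power_le_one)
    have **: "exp (- t) * (exp (- t)) ^ i = exp (- (real (Suc i) * t))" for t :: real and i
      by (simp add: exp_of_nat_mult[symmetric] exp_add[symmetric] algebra_simps)
    have "(\<integral>t. indicator {0..} t * (exp (- t) * g (exp (- t)) * D t) \<partial>lborel) =
       (\<integral>t. (\<Sum>i\<le>n. c i * (indicator {0..} t * (exp (- t) * (exp (- t)) ^ i * D t))) \<partial>lborel)"
      by (simp add: g sum_distrib_left sum_distrib_right mult_ac)
    also have "\<dots> = (\<Sum>i\<le>n. c i * (\<integral>t. (indicator {0..} t * (exp (- t) * (exp (- t)) ^ i * D t)) \<partial>lborel))"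
      using * by (simp add: Bochner_Integration.integral_sum)
    also have "\<dots> = 0" unfolding ** using zero by simp
    finally show ?thesis .
  qed
  have f_cont: "continuous_on A f" for A unfolding f_def by (intro continuous_intros)
  have f_meas [measurable]: "f \<in> borel_measurable borel" using f_cont by (rule borel_measurable_continuous_onI)
  have f_bnd: "\<bar>f s\<bar> \<le> \<eta>" for s using \<eta> by (auto simp: f_def)
  let ?F = "\<lambda>t. indicator {0..} t * (exp (- t) * f (exp (- t)) * D t)"
  have intF: "integrable lborel ?F" by (rule int_bnd) (use f_bnd in auto)
  have F0: "(\<integral>t. ?F t \<partial>lborel) = 0"
  proof (rule ccontr)
    assume ne: "(\<integral>t. ?F t \<partial>lborel) \<noteq> 0"
    define I where "I = (\<integral>t. \<bar>C\<bar> * w t \<partial>lborel)"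
    have I: "I \<ge> 0" unfolding I_def by (intro integral_nonneg_AE AE_I2) (auto simp: w_def indicator_def)
    \<comment> \<open>Uniform error \<open>\<delta>\<close> changes the integral by at most
      \<open>\<delta> * I\<close>, which is less than its modulus; the summand 1 covers
      \<open>I = 0\<close>.\<close>
    define \<delta> where "\<delta> = \<bar>\<integral>t. ?F t \<partial>lborel\<bar> / (I + 1)"
    have \<delta>: "\<delta> > 0" using ne I by (auto simp: \<delta>_def)
    obtain g where g: "real_polynomial_function g" "\<And>s. s \<in> {0..1} \<Longrightarrow> \<bar>f s - g s\<bar> < \<delta>"
      using Stone_Weierstrass_real_polynomial_function[OF _ f_cont \<delta>, of "{0..1}"] by auto
    have [measurable]: "g \<in> borel_measurable borel"
      using continuous_on_polymonial_function[of g UNIV] g(1)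
      by (intro borel_measurable_continuous_onI) (simp add: real_polynomial_function_eq)
    have gb: "\<bar>g s\<bar> \<le> \<eta> + \<delta>" if "0 \<le> s" "s \<le> 1" for s
      using g(2)[of s] f_bnd[of s] that by auto
    let ?G = "\<lambda>t. indicator {0..} t * (exp (- t) * g (exp (- t)) * D t)"
    have intG: "integrable lborel ?G" by (rule int_bnd[OF _ gb]) auto
    have "\<bar>\<integral>t. ?F t \<partial>lborel\<bar> = \<bar>(\<integral>t. ?F t - ?G t \<partial>lborel)\<bar>"
      using poly[OF g(1)] intF intG by simp
    also have "\<dots> \<le> (\<integral>t. \<bar>?F t - ?G t\<bar> \<partial>lborel)" by (rule integral_abs_bound)
    also have "\<dots> \<le> (\<integral>t. \<delta> * (\<bar>C\<bar> * w t) \<partial>lborel)"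
    proof (rule integral_mono)
      fix t :: real
      show "\<bar>?F t - ?G t\<bar> \<le> \<delta> * (\<bar>C\<bar> * w t)"
      proof (cases "t \<ge> 0")
        case True
        then have "\<bar>f (exp (-t)) - g (exp (-t))\<bar> \<le> \<delta>" using g(2)[of "exp (-t)"] by auto
        from Cw[OF this, of t] show ?thesis by (simp add: algebra_simps)
      qed (simp add: w_def)
    qed (use intF intG w in auto)
    also have "\<dots> = \<delta> * I" by (simp add: I_def)
    also have "\<dots> < \<delta> * (I + 1)" using \<delta> by simp
    also have "\<dots> = \<bar>\<integral>t. ?F t \<partial>lborel\<bar>" using I by (simp add: \<delta>_def)
    finally show False by simp
  qed
  have supp: "t0 < t \<and> t < b" if "f (exp (- t)) \<noteq> 0" for t
  proof -
    have "exp (- t) < exp (- t0)" "exp (- b) < exp (- t)"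
      using that \<eta> unfolding f_def \<eta>_def by (smt (verit) min.cobounded1 min.cobounded2)+
    then show ?thesis by simp
  qed
  have nn: "?F t \<ge> 0" for t
    using supp[of t] b(2)[of t] by (cases "f (exp (-t)) = 0") (auto simp: f_def indicator_def)
  have "AE t in lborel. ?F t = 0"
    using integral_nonneg_eq_0_iff_AE[OF intF] nn F0 by auto
  moreover have "isCont (\<lambda>t. f (exp (- t))) m"
    by (intro continuous_intros continuous_at_compose[unfolded o_def, of m "\<lambda>t. exp (- t)" f]) 
       (use f_cont[of UNIV] in \<open>auto simp: continuous_on_eq_continuous_at\<close>)
  moreover have "f (exp (- m)) > 0" using \<eta> by (simp add: f_def s1_def)
  ultimately obtain c where c: "c > 0" "\<And>t. \<bar>t - m\<bar> < c \<Longrightarrow> f (exp (- t)) > 0"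
    using order_tendstoD(1)[of "\<lambda>t. f (exp (- t))" "f (exp (- m))" "at m" 0]
    unfolding isCont_def eventually_at by (auto simp: dist_real_def) (metis)
  have "AE t in lborel. t \<notin> {m - c<..<m + c}"
    using \<open>AE t in lborel. ?F t = 0\<close>
  proof eventually_elim
    case (elim t)
    show ?case
    proof
      assume "t \<in> {m - c<..<m + c}"
      then have "f (exp (- t)) > 0" using c(2)[of t] by auto
      moreover from this supp[of t] b(2)[of t] t0 have "D t > 0" "t \<ge> 0" by auto
      ultimately show False using elim by auto
    qed
  qed
  then have "emeasure lborel {m - c<..<m + c} = 0"
    by (subst (asm) AE_iff_measurable[where N = "{m - c<..<m + c}"]) auto
  then show False using c(1) by simp
qed

lemma exponential_integrable_linear_growth:
  fixes U :: "real \<Rightarrow> real"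
  assumes [measurable]: "U \<in> borel_measurable borel" and l: "0 < l"
    and U: "\<And>t. 0 \<le> t \<Longrightarrow> \<bar>U t\<bar> \<le> C * (1 + t)"
  shows "integrable (density lborel (exponential_density l)) U"
proof (subst integrable_density)
  have moment: "integrable lborel (\<lambda>t. exponential_density l t * t ^ i)" for i
  proof (rule integrableI_nonneg)
    show "AE t in lborel. 0 \<le> exponential_density l t * t ^ i"
      using l by (auto simp: exponential_density_def)
    show "(\<integral>\<^sup>+ t. ennreal (exponential_density l t * t ^ i) \<partial>lborel) < \<infinity>"
      unfolding nn_integral_erlang_ith_moment[OF l] by (simp add: less_top[symmetric])
  qed measurable
  have "integrable lborel (\<lambda>t. C * (exponential_density l t * t ^ 0 + exponential_density l t * t ^ 1))"
    by (intro Bochner_Integration.integrable_mult_right Bochner_Integration.integrable_add moment)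
  then show "integrable lborel (\<lambda>t. exponential_density l t *\<^sub>R U t)"
  proof (rule Bochner_Integration.integrable_bound)
    have "\<bar>exponential_density l t * U t\<bar> \<le> \<bar>C * (exponential_density l t * t ^ 0 + exponential_density l t * t ^ 1)\<bar>" for t
    proof (cases "t \<ge> 0")
      case True
      then have "exponential_density l t * \<bar>U t\<bar> \<le> exponential_density l t * (C * (1 + t))"
        using U l by (intro mult_left_mono) auto
      then show ?thesis using l by (simp add: abs_mult algebra_simps)
    qed (simp add: exponential_density_def)
    then show "AE t in lborel. norm (exponential_density l t *\<^sub>R U t) \<le> norm (C * (exponential_density l t * t ^ 0 + exponential_density l t * t ^ 1))"
      by simp
  qed measurable
qed (use l in auto)

text \<open>Integration by parts: \<open>- exp (- l * t) * U t\<close> is a primitive of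
  \<open>exp (- l * t) * (l * U t - c t)\<close>, and linear growth kills the boundary term at
  infinity. For an exponential time this is Dynkin's formula.\<close>

lemma exponential_integral_deriv:
  fixes U c :: "real \<Rightarrow> real"
  assumes [measurable]: "U \<in> borel_measurable borel" "c \<in> borel_measurable borel" and l: "0 < l"
    and deriv: "\<And>t. 0 \<le> t \<Longrightarrow> (U has_real_derivative c t) (at t within {0..})"
    and cont: "continuous_on {0..} c"
    and U: "\<And>t. 0 \<le> t \<Longrightarrow> \<bar>U t\<bar> \<le> C * (1 + t)"
    and c: "\<And>t. 0 \<le> t \<Longrightarrow> \<bar>c t\<bar> \<le> C * (1 + t)"
  shows "(\<integral>t. U t \<partial>density lborel (exponential_density l)) =
    U 0 + (\<integral>t. c t \<partial>density lborel (exponential_density l)) / l"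
proof -
  let ?E = "density lborel (exponential_density l)"
  note intU = exponential_integrable_linear_growth[OF assms(1) l U]
  note intc = exponential_integrable_linear_growth[OF assms(2) l c]
  let ?G = "\<lambda>t. U t - c t / l"
  have intG: "integrable ?E ?G" using intU intc by auto
  have contU: "continuous_on {0..} U" by (rule DERIV_continuous_on[of _ _ c]) (use deriv in auto)
  have "(\<lambda>n. \<integral>t. indicator {0..real n} t * ?G t \<partial>?E) \<longlonglongrightarrow> (\<integral>t. indicator {0..} t * ?G t \<partial>?E)"
  proof (rule integral_dominated_convergence)
    show "integrable ?E (\<lambda>t. \<bar>?G t\<bar>)" using intG by auto
    show "AE t in ?E. (\<lambda>n. indicator {0..real n} t * ?G t) \<longlonglongrightarrow> indicator {0..} t * ?G t"
    proof (rule AE_I2, rule tendsto_eventually)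
      fix t :: real
      obtain m where "t \<le> real m" using real_arch_simple by blast
      then have "\<forall>n\<ge>m. indicator {0..real n} t * ?G t = indicator {0..} t * ?G t"
        by (auto simp: indicator_def)
      then show "\<forall>\<^sub>F n in sequentially. indicator {0..real n} t * ?G t = indicator {0..} t * ?G t"
        by (auto simp: eventually_sequentially)
    qed
    show "AE t in ?E. norm (indicator {0..real n} t * ?G t) \<le> \<bar>?G t\<bar>" for n
      by (auto simp: indicator_def)
  qed auto
  moreover have "(\<integral>t. indicator {0..real n} t * ?G t \<partial>?E) = U 0 - exp (- (l * n)) * U n" for n
  proof -
    have "(\<integral>t. indicator {0..real n} t * ?G t \<partial>?E) = (\<integral>t. exponential_density l t * (indicator {0..real n} t * ?G t) \<partial>lborel)"
      using l by (subst integral_density) auto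
    also have "\<dots> = (\<integral>t. indicator {0..real n} t *\<^sub>R (l * exp (- (l * t)) * U t - exp (- (l * t)) * c t) \<partial>lborel)"
      using l by (intro Bochner_Integration.integral_cong) (auto simp: exponential_density_def indicator_def algebra_simps)
    also have "\<dots> = (- exp (- (l * n)) * U n) - (- exp (- (l * 0)) * U 0)"
    proof (rule integral_FTC_Icc)
      fix t assume t: "0 \<le> t" "t \<le> real n"
      have "(U has_real_derivative c t) (at t within {0..real n})"
        using deriv[OF t(1)] by (rule DERIV_subset) auto
      then have "((\<lambda>t. - exp (- (l * t)) * U t) has_real_derivative l * exp (- (l * t)) * U t - exp (- (l * t)) * c t) (at t within {0..real n})"
        by (auto intro!: derivative_eq_intros)
      then show "((\<lambda>t. - exp (- (l * t)) * U t) has_vector_derivative l * exp (- (l * t)) * U t - exp (- (l * t)) * c t) (at t within {0..real n})"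
        by (simp add: has_real_derivative_iff_has_vector_derivative)
    next
      show "continuous_on {0..real n} (\<lambda>t. l * exp (- (l * t)) * U t - exp (- (l * t)) * c t)"
        by (intro continuous_intros continuous_on_subset[OF contU] continuous_on_subset[OF cont]) auto
    qed auto
    finally show ?thesis by simp
  qed
  moreover have "(\<lambda>n. exp (- (l * real n)) * U n) \<longlonglongrightarrow> 0"
  proof (rule Lim_null_comparison[OF always_eventually], rule allI)
    show "norm (exp (- (l * real n)) * U n) \<le> exp (- (l * real n)) * (C * (1 + real n))" for n
      using U[of "real n"] by (simp add: abs_mult)
    show "(\<lambda>n. exp (- (l * real n)) * (C * (1 + real n))) \<longlonglongrightarrow> 0"
      using l by real_asymp
  qed
  then have "(\<lambda>n. U 0 - exp (- (l * real n)) * U n) \<longlonglongrightarrow> U 0 - 0"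
    by (intro tendsto_diff tendsto_const)
  ultimately have "(\<integral>t. indicator {0..} t * ?G t \<partial>?E) = U 0 - 0"
    by (intro LIMSEQ_unique) auto
  moreover have "(\<integral>t. indicator {0..} t * ?G t \<partial>?E) = (\<integral>t. ?G t \<partial>?E)"
  proof (rule integral_cong_AE)
    show "AE t in ?E. indicator {0..} t * ?G t = ?G t"
      by (subst AE_density) (auto simp: exponential_density_def indicator_def)
  qed auto
  ultimately show ?thesis using intU intc by simp
qed

section \<open>The semigroup and its kernels\<close>

lemma integral_deriv_Ici:
  fixes c :: "real \<Rightarrow> real"
  assumes c: "continuous_on UNIV c" and t: "0 \<le> t"
  shows "((\<lambda>u. integral {0..u} c) has_real_derivative c t) (at t within {0..})"
proof -
  have "((\<lambda>u. integral {0..u} c) has_real_derivative c t) (at t within {0..t + 1})"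
    by (rule integral_has_real_derivative) (use t in \<open>auto intro: continuous_on_subset[OF c]\<close>)
  moreover have "at t within {0..t + 1} = at t within {0..}"
    by (rule at_within_nhd[of _ "{t - 1<..<t + 1}"]) (use t in auto)
  ultimately show ?thesis by simp
qed

lemma C_zero_bounded:
  assumes "f \<in> C_zero" obtains B where "B > 0" "\<And>z. \<bar>f z\<bar> \<le> B"
proof -
  have c: "continuous_on UNIV f" and l: "(f \<longlongrightarrow> 0) at_infinity"
    using assms by (auto simp: C_zero_def)
  from tendstoD[OF l zero_less_one] obtain R where R: "\<And>z. R \<le> norm z \<Longrightarrow> \<bar>f z\<bar> < 1"
    by (auto simp: eventually_at_infinity dist_real_def)
  have "bounded (f ` cball 0 R)"
    by (intro compact_imp_bounded compact_continuous_image continuous_on_subset[OF c]) auto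
  then obtain B where B: "\<And>y. y \<in> f ` cball 0 R \<Longrightarrow> norm y \<le> B" unfolding bounded_iff by blast
  have "\<bar>f z\<bar> \<le> max B 1" for z
    using R[of z] B[of "f z"] by (cases "norm z \<le> R") auto
  then show ?thesis by (rule that[of "max B 1", rotated]) auto
qed

lemma C_zero_measurable: "f \<in> C_zero \<Longrightarrow> f \<in> borel_measurable borel"
  by (auto simp: C_zero_def intro: borel_measurable_continuous_onI)

lemma C_zero_radial:
  fixes p :: "'a::euclidean_space"
  assumes "continuous_on {0..} g" "(g \<longlongrightarrow> 0) at_top"
  shows "(\<lambda>z. g ((norm (z - p))\<^sup>2)) \<in> C_zero"
proof -
  have "filterlim (\<lambda>z::'a. norm (z - p)) at_top at_infinity"
  proof (rule filterlim_at_top_mono)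
    show "filterlim (\<lambda>z::'a. - norm p + norm z) at_top at_infinity"
      by (rule filterlim_tendsto_add_at_top[OF tendsto_const filterlim_norm_at_top])
    show "\<forall>\<^sub>F z in at_infinity. - norm p + norm z \<le> norm (z - p)"
      by (simp add: norm_triangle_ineq2)
  qed
  then have "filterlim (\<lambda>z::'a. (norm (z - p))\<^sup>2) at_top at_infinity"
    by (rule filterlim_pow_at_top[rotated]) simp
  moreover have "continuous_on UNIV (\<lambda>z. g ((norm (z - p))\<^sup>2))"
    by (rule continuous_on_compose2[OF assms(1)]) (auto intro!: continuous_intros)
  ultimately show ?thesis unfolding C_zero_def by (auto intro: filterlim_compose[OF assms(2)])
qed

definition eps :: "nat \<Rightarrow> real" where "eps n = 1 / real (Suc n)"

lemma eps_pos [simp]: "0 < eps n" and eps_le_1 [simp]: "eps n \<le> 1"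
  by (auto simp: eps_def)

lemma eps_tendsto: "eps \<longlonglongrightarrow> 0"
  unfolding eps_def[abs_def] by real_asymp

lemma eps_antimono: "m \<le> n \<Longrightarrow> eps n \<le> eps m"
  by (auto simp: eps_def intro!: divide_left_mono)

lemma abs_integral_le_bound:
  fixes f :: "'a::topological_space \<Rightarrow> real"
  assumes "prob_space \<mu>" "sets \<mu> = sets borel" "f \<in> borel_measurable borel" "\<And>z. \<bar>f z\<bar> \<le> B"
  shows "integrable \<mu> f" "\<bar>\<integral>z. f z \<partial>\<mu>\<bar> \<le> B"
proof -
  interpret prob_space \<mu> by fact
  have [measurable]: "f \<in> borel_measurable \<mu>" using assms(2,3) by (simp cong: measurable_cong_sets)
  show int: "integrable \<mu> f" using assms by (intro integrable_const_bound[of _ B]) auto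
  have "\<bar>\<integral>z. f z \<partial>\<mu>\<bar> \<le> (\<integral>z. \<bar>f z\<bar> \<partial>\<mu>)" by (rule integral_abs_bound)
  also have "\<dots> \<le> (\<integral>z. B \<partial>\<mu>)" using int assms(4) by (intro integral_mono) auto
  finally show "\<bar>\<integral>z. f z \<partial>\<mu>\<bar> \<le> B" by (simp add: prob_space)
qed

text \<open>Only the laws of the process enter the argument, so the probability spaces are forgotten
  here. Times below 0 are frozen at 0 to make \<open>P x\<close> a kernel on the whole real line, as
  its composition with the exponential law requires. \<open>a_zero\<close> records the effect of
  smoothness together with nonnegativity at the zeros of \<open>a\<close>.\<close>

locale feller_kernel =
  fixes T :: "real \<Rightarrow> ('a::euclidean_space \<Rightarrow> real) \<Rightarrow> 'a \<Rightarrow> real"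
    and P :: "'a \<Rightarrow> real \<Rightarrow> 'a measure"
    and a :: "'a \<Rightarrow> real" and A :: real
  assumes T: "feller_semigroup T"
    and gen: "\<And>g. g \<in> smooth_compact_support \<Longrightarrow> in_generator T g (\<lambda>z. a z * laplacian g z)"
    and prob_P: "\<And>x t. prob_space (P x t)"
    and sets_P [measurable_cong, simp]: "\<And>x t. sets (P x t) = sets borel"
    and P_neg: "\<And>x t. t < 0 \<Longrightarrow> P x t = P x 0"
    and T_eq: "\<And>f t x. f \<in> C_zero \<Longrightarrow> 0 \<le> t \<Longrightarrow> T t f x = (\<integral>z. f z \<partial>P x t)"
    and a_nonneg: "\<And>z. 0 \<le> a z" and a_le: "\<And>z. a z \<le> A"
    and a_cont: "continuous_on UNIV a"
    and a_zero: "\<And>z. a z = 0 \<Longrightarrow> \<exists>r>0. \<exists>C. \<forall>w. norm (w - z) < r \<longrightarrow> a w \<le> C * (norm (w - z))\<^sup>2"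
    and dim: "DIM('a) \<ge> 2"
begin

section \<open>Contraction, continuity and differentiation in time\<close>

lemma integrable_P:
  fixes f :: "'a \<Rightarrow> real"
  assumes "f \<in> borel_measurable borel" and "\<And>z. \<bar>f z\<bar> \<le> B"
  shows "integrable (P x t) f"
  using abs_integral_le_bound(1)[OF prob_P sets_P assms] .

lemma integrable_P_C_zero: "f \<in> C_zero \<Longrightarrow> integrable (P x t) f"
  using C_zero_bounded C_zero_measurable integrable_P by metis

lemma abs_integral_P_le:
  fixes f :: "'a \<Rightarrow> real"
  assumes "f \<in> borel_measurable borel" and "\<And>z. \<bar>f z\<bar> \<le> B"
  shows "\<bar>\<integral>z. f z \<partial>P x t\<bar> \<le> B"
  using abs_integral_le_bound(2)[OF prob_P sets_P assms] .

lemma T_C_zero: "f \<in> C_zero \<Longrightarrow> 0 \<le> t \<Longrightarrow> T t f \<in> C_zero"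
  using T by (auto simp: feller_semigroup_def)

lemma T_add: "f \<in> C_zero \<Longrightarrow> 0 \<le> t \<Longrightarrow> 0 \<le> s \<Longrightarrow> T (t + s) f x = T t (T s f) x"
  using T by (auto simp: feller_semigroup_def)

lemma T_zero: "f \<in> C_zero \<Longrightarrow> T 0 f x = f x"
  using T by (auto simp: feller_semigroup_def)

lemma T_diff_le:
  assumes "f \<in> C_zero" "g \<in> C_zero" "0 \<le> t" "\<And>z. \<bar>f z - g z\<bar> \<le> B"
  shows "\<bar>T t f x - T t g x\<bar> \<le> B"
proof -
  have "T t f x - T t g x = (\<integral>z. f z - g z \<partial>P x t)"
    using assms by (simp add: T_eq integrable_P_C_zero)
  also have "\<bar>\<dots>\<bar> \<le> B"
    using assms C_zero_measurable by (intro abs_integral_P_le borel_measurable_diff) auto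
  finally show ?thesis .
qed

text \<open>For \<open>t \<le> s\<close> the difference is \<open>T t\<close> applied to
  \<open>T (s - t) f - f\<close>, and \<open>T t\<close> is a contraction. The modulus of continuity
  at time 0 therefore serves at all times and points.\<close>

lemma T_uniformly_continuous:
  assumes f: "f \<in> C_zero" and "e > 0"
  obtains \<delta> where "\<delta> > 0" "\<And>s t x. 0 \<le> s \<Longrightarrow> 0 \<le> t \<Longrightarrow> \<bar>s - t\<bar> < \<delta> \<Longrightarrow> \<bar>T s f x - T t f x\<bar> \<le> e"
proof -
  have "uniform_limit UNIV (\<lambda>t. T t f) f (at_right 0)" using T f by (auto simp: feller_semigroup_def)
  from uniform_limitD[OF this \<open>e > 0\<close>] obtain \<delta> where \<delta>: "\<delta> > 0"
    "\<And>s z. 0 < s \<Longrightarrow> s < \<delta> \<Longrightarrow> \<bar>T s f z - f z\<bar> < e"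
    by (auto simp: eventually_at_right_field dist_real_def)
  have 1: "\<bar>T s f x - T t f x\<bar> \<le> e" if "0 \<le> t" "t \<le> s" "s - t < \<delta>" for s t x
  proof (cases "s = t")
    case False
    then have "\<bar>T t (T (s - t) f) x - T t f x\<bar> \<le> e"
      using that \<delta>(2)[of "s - t"] by (intro T_diff_le f T_C_zero) (auto intro: less_imp_le)
    then show ?thesis using T_add[OF f, of t "s - t" x] that by simp
  qed (use \<open>e > 0\<close> in auto)
  have "\<bar>T s f x - T t f x\<bar> \<le> e" if "0 \<le> s" "0 \<le> t" "\<bar>s - t\<bar> < \<delta>" for s t x
    using 1[of s t x] 1[of t s x] that by (cases "s \<le> t") (auto simp: abs_minus_commute)
  then show ?thesis using \<delta>(1) that by blast
qed

lemma T_continuous: "f \<in> C_zero \<Longrightarrow> continuous_on {0..} (\<lambda>t. T t f x)"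
proof (rule continuous_onI)
  fix t e :: real assume f: "f \<in> C_zero" and "0 < e" "t \<in> {0..}"
  moreover obtain \<delta> where "\<delta> > 0" "\<And>s t x. 0 \<le> s \<Longrightarrow> 0 \<le> t \<Longrightarrow> \<bar>s - t\<bar> < \<delta> \<Longrightarrow> \<bar>T s f x - T t f x\<bar> \<le> e"
    using T_uniformly_continuous[OF f \<open>0 < e\<close>] by blast
  ultimately show "\<exists>d>0. \<forall>t'\<in>{0..}. dist t' t < d \<longrightarrow> dist (T t' f x) (T t f x) \<le> e"
    by (intro exI[of _ \<delta>]) (auto simp: dist_real_def)
qed

text \<open>The generator gives the right derivative, with an error uniform in the base time. For
  \<open>y < t\<close> the increment is expanded at the base \<open>y\<close>, and
  \<open>T y h\<close> is then replaced by \<open>T t h\<close> through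
  \<open>T_uniformly_continuous\<close>; each of the two errors takes half of
  \<open>e\<close>.\<close>

lemma T_deriv:
  assumes "in_generator T f h" and t: "0 \<le> t"
  shows "((\<lambda>t. T t f x) has_real_derivative T t h x) (at t within {0..})"
proof -
  have f: "f \<in> C_zero" and h: "h \<in> C_zero"
    and lim: "uniform_limit UNIV (\<lambda>t x. (T t f x - f x) / t) h (at_right 0)"
    using assms by (auto simp: in_generator_def)
  have bound: "\<exists>\<delta>>0. \<forall>t s. 0 \<le> t \<longrightarrow> 0 < s \<longrightarrow> s < \<delta> \<longrightarrow> \<bar>T (t + s) f x - T t f x - s * T t h x\<bar> \<le> e * s" 
    if "e > 0" for e
  proof -
    from uniform_limitD[OF lim \<open>e > 0\<close>] obtain \<delta> where \<delta>: "\<delta> > 0"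
      "\<And>s z. 0 < s \<Longrightarrow> s < \<delta> \<Longrightarrow> \<bar>(T s f z - f z) / s - h z\<bar> < e"
      by (auto simp: eventually_at_right_field dist_real_def)
    have "\<bar>T (t + s) f x - T t f x - s * T t h x\<bar> \<le> e * s" if "0 \<le> t" "0 < s" "s < \<delta>" for t s
    proof -
      have Ts: "T s f \<in> C_zero" using T_C_zero[OF f] that by simp
      note [measurable] = C_zero_measurable[OF f] C_zero_measurable[OF h] C_zero_measurable[OF Ts]
      have "T (t + s) f x - T t f x - s * T t h x = (\<integral>z. T s f z - f z - s * h z \<partial>P x t)"
        using that T_add[OF f, of t s x] T_eq[OF Ts, of t x] T_eq[OF f, of t x] T_eq[OF h, of t x]
          integrable_P_C_zero[OF f, of x t] integrable_P_C_zero[OF h, of x t] integrable_P_C_zero[OF Ts, of x t]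
        by simp
      also have "\<bar>\<dots>\<bar> \<le> e * s"
      proof (rule abs_integral_P_le)
        fix z
        have "T s f z - f z - s * h z = ((T s f z - f z) / s - h z) * s"
          using that by (simp add: field_simps)
        then have "\<bar>T s f z - f z - s * h z\<bar> = \<bar>(T s f z - f z) / s - h z\<bar> * s"
          using that by (simp only: abs_mult abs_of_pos)
        also have "\<dots> \<le> e * s" using \<delta>(2)[of s z] that by (intro mult_right_mono) auto
        finally show "\<bar>T s f z - f z - s * h z\<bar> \<le> e * s" .
      qed measurable
      finally show ?thesis .
    qed
    then show ?thesis using \<delta>(1) by blast
  qed
  show ?thesis unfolding has_field_derivative_def has_derivative_within_alt
  proof (intro conjI allI impI)
    show "bounded_linear ((*) (T t h x))" by (rule bounded_linear_mult_right)
    fix e :: real assume "e > 0"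
    then have e2: "e / 2 > 0" by simp
    obtain \<delta>1 where \<delta>1: "\<delta>1 > 0" "\<And>t s. 0 \<le> t \<Longrightarrow> 0 < s \<Longrightarrow> s < \<delta>1 \<Longrightarrow> \<bar>T (t + s) f x - T t f x - s * T t h x\<bar> \<le> e / 2 * s"
      using bound[OF e2] by blast
    obtain \<delta>2 where \<delta>2: "\<delta>2 > 0" "\<And>s t x. 0 \<le> s \<Longrightarrow> 0 \<le> t \<Longrightarrow> \<bar>s - t\<bar> < \<delta>2 \<Longrightarrow> \<bar>T s h x - T t h x\<bar> \<le> e / 2"
      using T_uniformly_continuous[OF h e2] by blast
    show "\<exists>d>0. \<forall>y\<in>{0..}. norm (y - t) < d \<longrightarrow> norm (T y f x - T t f x - T t h x * (y - t)) \<le> e * norm (y - t)"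
    proof (intro exI[of _ "min \<delta>1 \<delta>2"] conjI ballI impI)
      fix y assume y: "y \<in> {0..}" "norm (y - t) < min \<delta>1 \<delta>2"
      consider "y = t" | "y > t" | "y < t" by linarith
      then show "norm (T y f x - T t f x - T t h x * (y - t)) \<le> e * norm (y - t)"
      proof cases
        case 2
        have "\<bar>T y f x - T t f x - T t h x * (y - t)\<bar> \<le> e / 2 * (y - t)"
          using \<delta>1(2)[of t "y - t"] 2 t y by (simp add: mult.commute)
        also have "\<dots> \<le> e * (y - t)" using 2 \<open>e > 0\<close> by (intro mult_right_mono) auto
        finally show ?thesis using 2 by simp
      next
        case 3
        have 1: "\<bar>T t f x - T y f x - (t - y) * T y h x\<bar> \<le> e / 2 * (t - y)"
          using \<delta>1(2)[of y "t - y"] 3 t y by simp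
        have "\<bar>T y h x - T t h x\<bar> \<le> e / 2" using \<delta>2(2)[of y t x] y t 3 by auto
        then have "\<bar>(t - y) * (T y h x - T t h x)\<bar> \<le> (t - y) * (e / 2)"
          using 3 unfolding abs_mult by (intro mult_mono) auto
        then have 2: "\<bar>(t - y) * T y h x - (t - y) * T t h x\<bar> \<le> e / 2 * (t - y)"
          by (simp add: algebra_simps)
        have "T y f x - T t f x - T t h x * (y - t) = 
          - (T t f x - T y f x - (t - y) * T y h x) - ((t - y) * T y h x - (t - y) * T t h x)"
          by (simp add: algebra_simps)
        then have "\<bar>T y f x - T t f x - T t h x * (y - t)\<bar> \<le> e / 2 * (t - y) + e / 2 * (t - y)"
          using 1 2 by linarith
        then show ?thesis using 3 by simp
      qed simp
    qed (use \<delta>1 \<delta>2 in auto)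
  qed
qed

lemma integral_P_max: "f \<in> C_zero \<Longrightarrow> (\<integral>z. f z \<partial>P x t) = T (max 0 t) f x"
  using P_neg[of t x] by (auto simp: T_eq max_def)

lemma integral_P_continuous:
  assumes f: "f \<in> C_zero"
  shows "continuous_on UNIV (\<lambda>t. \<integral>z. f z \<partial>P x t)"
proof -
  have "continuous_on UNIV (\<lambda>t. T (max 0 t) f x)"
    by (rule continuous_on_compose2[OF T_continuous[OF f]]) (auto intro!: continuous_intros)
  then show ?thesis by (simp only: integral_P_max[OF f])
qed

text \<open>Continuity in time is known for integrals of \<open>C_zero\<close> functions. The
  indicator of a bounded open box is a pointwise limit of such functions, truncated multiples of the
  distance to the complement, and boxes generate the Borel sets.\<close>

lemma P_measurable [measurable]: "P x \<in> borel \<rightarrow>\<^sub>M subprob_algebra borel"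
proof (rule measurable_subprob_algebra_generated[where \<Omega> = UNIV and G = "range (\<lambda>(u, v). box u v)"])
  show "sets borel = sigma_sets UNIV (range (\<lambda>(u, v::'a). box u v))"
    unfolding borel_eq_box by (simp add: case_prod_beta' sets_measure_of)
  show "Int_stable (range (\<lambda>(u, v::'a). box u v))"
    by (auto simp: Int_stable_def box_Int_box)
  fix t :: real
  interpret prob_space "P x t" by (rule prob_P)
  show "subprob_space (P x t)" by unfold_locales
next
  have 1: "emeasure (P x t) UNIV = 1" for t
    using prob_space.emeasure_space_1[OF prob_P, of x t] sets_eq_imp_space_eq[OF sets_P, of x t] by simp
  show "(\<lambda>t. emeasure (P x t) UNIV) \<in> borel_measurable borel" by (simp add: 1)
  fix U assume "U \<in> range (\<lambda>(u, v::'a). box u v)"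
  then have U: "open U" "bounded U" by auto
  then have [measurable]: "U \<in> sets borel" by auto
  define f where "f n z = min 1 (real n * infdist z (- U))" for n :: nat and z
  \<comment> \<open>\<open>infdist\<close> to the empty set is 0 by convention, so the functions
    \<open>f n\<close> reach 1 inside \<open>U\<close> only because the complement is
    nonempty.\<close>
  have "- U \<noteq> {}" using U(2) by (metis Compl_empty_eq double_complement not_bounded_UNIV)
  have f0: "f n z = 0" if "z \<notin> U" for n z using that by (simp add: f_def)
  have f_C: "f n \<in> C_zero" for n
  proof -
    obtain R where R: "\<And>z. z \<in> U \<Longrightarrow> norm z \<le> R" using U(2) by (auto simp: bounded_iff)
    have "\<forall>\<^sub>F z in at_infinity. 0 = f n z"
      unfolding eventually_at_infinity using R f0 by (intro exI[of _ "R + 1"]) force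
    then have "(f n \<longlongrightarrow> 0) at_infinity" by (rule Lim_transform_eventually[OF tendsto_const])
    then show ?thesis unfolding C_zero_def f_def by (auto intro!: continuous_intros)
  qed
  have lim: "(\<lambda>n. f n z) \<longlonglongrightarrow> indicator U z" for z
  proof (cases "z \<in> U")
    case True
    then have "infdist z (- U) > 0"
      using U \<open>- U \<noteq> {}\<close> by (metis ComplD closed_Compl in_closed_iff_infdist_zero infdist_nonneg less_eq_real_def)
    then obtain m where m: "real m * infdist z (- U) > 1" using ex_less_of_nat_mult by blast
    have "\<forall>\<^sub>F n in sequentially. 1 = f n z"
      using eventually_ge_at_top[of m]
    proof eventually_elim
      case (elim n)
      then have "real m * infdist z (- U) \<le> real n * infdist z (- U)" by (intro mult_right_mono) (auto simp: infdist_nonneg)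
      with m show ?case by (simp add: f_def)
    qed
    then show ?thesis using True by (simp add: Lim_transform_eventually[OF tendsto_const])
  qed (simp add: f0)
  have lim_m: "(\<lambda>n. \<integral>z. f n z \<partial>P x t) \<longlonglongrightarrow> measure (P x t) U" for t
  proof -
    interpret prob_space "P x t" by (rule prob_P)
    have [measurable]: "f n \<in> borel_measurable borel" for n by (rule C_zero_measurable[OF f_C])
    have f1: "\<bar>f n z\<bar> \<le> 1" for n z by (simp add: f_def infdist_nonneg)
    have "(\<lambda>n. \<integral>z. f n z \<partial>P x t) \<longlonglongrightarrow> (\<integral>z. indicator U z \<partial>P x t)"
      by (rule integral_dominated_convergence[where w = "\<lambda>_. 1"]) (use lim f1 in auto)
    then show ?thesis by simp
  qed
  have meas_m: "(\<lambda>t. \<integral>z. f n z \<partial>P x t) \<in> borel_measurable borel" for n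
    by (intro borel_measurable_continuous_onI integral_P_continuous f_C)
  have "(\<lambda>t. measure (P x t) U) \<in> borel_measurable borel"
    using lim_m meas_m by (rule borel_measurable_LIMSEQ_real[where u = "\<lambda>n t. \<integral>z. f n z \<partial>P x t"])
  moreover have "emeasure (P x t) U = ennreal (measure (P x t) U)" for t
  proof -
    interpret prob_space "P x t" by (rule prob_P)
    show ?thesis by (simp add: emeasure_eq_measure)
  qed
  ultimately show "(\<lambda>t. emeasure (P x t) U) \<in> borel_measurable borel" by simp
qed auto

section \<open>Newton kernels under the semigroup\<close>

abbreviation K :: "real \<Rightarrow> real \<Rightarrow> 'a \<Rightarrow> 'a \<Rightarrow> real" where
  "K e r p z \<equiv> newton_gap DIM('a) e r ((norm (z - p))\<^sup>2)"

abbreviation moll :: "real \<Rightarrow> 'a \<Rightarrow> 'a \<Rightarrow> real" where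
  "moll e p z \<equiv> mollifier DIM('a) e ((norm (z - p))\<^sup>2)"

lemma integrable_P_const: "integrable (P x t) (\<lambda>_. c :: real)"
  by (rule integrable_P[of _ "\<bar>c\<bar>"]) auto

lemma K_C_zero: "0 < e \<Longrightarrow> 0 < r \<Longrightarrow> K e r p \<in> C_zero"
proof (rule C_zero_radial)
  assume "0 < e" "0 < r"
  moreover have "isCont (\<lambda>s. newton DIM('a) (s + u)) s" if "0 < u" "0 \<le> s" for u s
    by (rule isCont_o2[where f = "\<lambda>s. s + u"]) (use that in \<open>auto intro!: isCont_newton\<close>)
  ultimately show "continuous_on {0..} (newton_gap DIM('a) e r)"
    unfolding newton_gap_def[abs_def] by (intro continuous_at_imp_continuous_on ballI continuous_diff) auto
qed (rule newton_gap_tendsto_0, auto)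

lemma a_measurable [measurable]: "a \<in> borel_measurable borel"
  using a_cont by (rule borel_measurable_continuous_onI)

lemma a_moll_C_zero:
  assumes e: "0 < e" shows "(\<lambda>z. a z * moll e p z) \<in> C_zero"
proof -
  have "continuous_on {0..} (mollifier DIM('a) e)"
    by (intro continuous_at_imp_continuous_on ballI mollifier_isCont) (use e in auto)
  from C_zero_radial[OF this mollifier_tendsto_0[OF e], of p]
  have moll: "continuous_on UNIV (moll e p)" "(moll e p \<longlongrightarrow> 0) at_infinity" by (auto simp: C_zero_def)
  have "((\<lambda>z. A * moll e p z) \<longlongrightarrow> 0) at_infinity" using moll(2) by (rule tendsto_mult_right_zero)
  then have "((\<lambda>z. a z * moll e p z) \<longlongrightarrow> 0) at_infinity"
    by (rule Lim_null_comparison[rotated])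
       (use a_nonneg a_le mollifier_nonneg[of e] e in \<open>auto simp: abs_mult intro!: always_eventually mult_right_mono\<close>)
  then show ?thesis unfolding C_zero_def using moll(1) a_cont by (auto intro!: continuous_intros)
qed

lemma C_zero_minus: "f \<in> C_zero \<Longrightarrow> g \<in> C_zero \<Longrightarrow> (\<lambda>z. f z - g z :: real) \<in> C_zero"
  by (auto simp: C_zero_def intro!: continuous_intros tendsto_diff[where b = 0, simplified] tendsto_eq_intros)

text \<open>Membership of the gap in the domain of the generator is avoided: the identity integrated
  over time holds for its cut-offs and passes to the limit by dominated convergence in space and in
  time. Continuity of the limiting integrand then returns the derivative.\<close>

lemma K_deriv:
  assumes e: "0 < e" and r: "0 < r" and t: "0 \<le> t"
  shows "((\<lambda>t. \<integral>z. K e r p z \<partial>P x t) has_real_derivative (\<integral>z. a z * (moll r p z - moll e p z) \<partial>P x t)) (at t within {0..})"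
proof -
  let ?d = "DIM('a)"
  let ?h = "\<lambda>z. a z * (moll r p z - moll e p z)"
  obtain g1 g2 B where g: 
    "\<And>N s. 0 < N \<Longrightarrow> 0 \<le> s \<Longrightarrow> (cut_newton_gap ?d e r N has_real_derivative g1 N s) (at s)"
    "\<And>N s. 0 < N \<Longrightarrow> 0 \<le> s \<Longrightarrow> (g1 N has_real_derivative g2 N s) (at s)"
    "\<And>N s. 0 < N \<Longrightarrow> 0 \<le> s \<Longrightarrow> \<bar>cut_newton_gap ?d e r N s\<bar> \<le> B"
    "\<And>N s. 1 \<le> N \<Longrightarrow> 0 \<le> s \<Longrightarrow> \<bar>4 * s * g2 N s + 2 * real ?d * g1 N s\<bar> \<le> B"
    "\<And>s. 0 \<le> s \<Longrightarrow> (\<lambda>n. cut_newton_gap ?d e r (real (Suc n)) s) \<longlonglongrightarrow> newton_gap ?d e r s"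
    "\<And>s. 0 \<le> s \<Longrightarrow> (\<lambda>n. 4 * s * g2 (real (Suc n)) s + 2 * real ?d * g1 (real (Suc n)) s) \<longlonglongrightarrow> mollifier ?d r s - mollifier ?d e s"
    using cut_newton_gap_properties[OF e r, of ?d] by blast
  define f where "f n z = cut_newton_gap ?d e r (real (Suc n)) ((norm (z - p))\<^sup>2)" for n :: nat and z
  define h where "h n z = a z * laplacian (f n) z" for n z
  have h_eq: "h n z = a z * (4 * (norm (z - p))\<^sup>2 * g2 (real (Suc n)) ((norm (z - p))\<^sup>2)
      + 2 * real ?d * g1 (real (Suc n)) ((norm (z - p))\<^sup>2))" for n z
    unfolding h_def f_def by (subst laplacian_radial[OF g(1) g(2)]) auto
  have gen_f: "in_generator T (f n) (h n)" for n
    unfolding h_def f_def[abs_def] by (intro gen smooth_compact_support_cut_newton_gap e r) simp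
  then have f_C: "f n \<in> C_zero" and h_C: "h n \<in> C_zero" for n by (auto simp: in_generator_def)
  have K_C: "K e r p \<in> C_zero" using e r by (rule K_C_zero)
  have h0_C: "?h \<in> C_zero"
    using C_zero_minus[OF a_moll_C_zero[OF r, of p] a_moll_C_zero[OF e, of p]] by (simp add: algebra_simps)
  note [measurable] = C_zero_measurable[OF f_C] C_zero_measurable[OF h_C] C_zero_measurable[OF K_C] C_zero_measurable[OF h0_C]
  have A: "A \<ge> 0" using a_nonneg[of undefined] a_le[of undefined] by linarith
  have B: "B \<ge> 0" using g(3)[of 1 0] by simp
  have f_B: "\<bar>f n z\<bar> \<le> B" for n z unfolding f_def by (rule g(3)) auto
  have h_B: "\<bar>h n z\<bar> \<le> A * B" for n z
    unfolding h_eq abs_mult[of "a z"] using a_nonneg a_le A B g(4) by (intro mult_mono) auto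
  have f_lim: "(\<lambda>n. f n z) \<longlonglongrightarrow> K e r p z" for z unfolding f_def by (rule g(5)) simp
  have h_lim: "(\<lambda>n. h n z) \<longlonglongrightarrow> ?h z" for z unfolding h_eq by (intro tendsto_mult tendsto_const g(6)) simp
  have lim_f: "(\<lambda>n. \<integral>z. f n z \<partial>P x t) \<longlonglongrightarrow> (\<integral>z. K e r p z \<partial>P x t)" for t
    by (rule integral_dominated_convergence[where w = "\<lambda>_. B"]) (use f_lim f_B in \<open>auto simp: integrable_P_const\<close>)
  have lim_h: "(\<lambda>n. \<integral>z. h n z \<partial>P x t) \<longlonglongrightarrow> (\<integral>z. ?h z \<partial>P x t)" for t
    by (rule integral_dominated_convergence[where w = "\<lambda>_. A * B"]) (use h_lim h_B in \<open>auto simp: integrable_P_const\<close>)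
  have int_n: "((\<lambda>s. \<integral>z. h n z \<partial>P x s) has_integral (\<integral>z. f n z \<partial>P x u) - f n x) {0..u}" if "0 \<le> u" for n u
  proof -
    have "((\<lambda>s. T s (h n) x) has_integral T u (f n) x - T 0 (f n) x) {0..u}"
    proof (rule fundamental_theorem_of_calculus[OF that])
      fix s assume "s \<in> {0..u}"
      then have "((\<lambda>t. T t (f n) x) has_real_derivative T s (h n) x) (at s within {0..u})"
        by (intro DERIV_subset[OF T_deriv[OF gen_f]]) auto
      then show "((\<lambda>t. T t (f n) x) has_vector_derivative T s (h n) x) (at s within {0..u})"
        by (simp add: has_real_derivative_iff_has_vector_derivative)
    qed
    then have "((\<lambda>s. T s (h n) x) has_integral (\<integral>z. f n z \<partial>P x u) - f n x) {0..u}"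
      using that by (simp only: T_zero[OF f_C] T_eq[OF f_C])
    then show ?thesis by (rule has_integral_eq[rotated]) (auto simp: T_eq[OF h_C])
  qed
  have int: "((\<integral>z. K e r p z \<partial>P x u) - K e r p x) = integral {0..u} (\<lambda>s. \<integral>z. ?h z \<partial>P x s)" if "0 \<le> u" for u
  proof (rule LIMSEQ_unique)
    show "(\<lambda>n. (\<integral>z. f n z \<partial>P x u) - f n x) \<longlonglongrightarrow> (\<integral>z. K e r p z \<partial>P x u) - K e r p x"
      by (intro tendsto_diff lim_f f_lim)
    have "(\<lambda>n. integral {0..u} (\<lambda>s. \<integral>z. h n z \<partial>P x s)) \<longlonglongrightarrow> integral {0..u} (\<lambda>s. \<integral>z. ?h z \<partial>P x s)"
    proof (rule dominated_convergence(2)[where h = "\<lambda>_. A * B"])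
      show "(\<lambda>s. \<integral>z. h n z \<partial>P x s) integrable_on {0..u}" for n using int_n[OF that] by blast
      show "norm (\<integral>z. h n z \<partial>P x s) \<le> A * B" for n s
        using abs_integral_P_le[OF _ h_B] by (simp add: C_zero_measurable[OF h_C])
    qed (use lim_h in auto)
    then show "(\<lambda>n. (\<integral>z. f n z \<partial>P x u) - f n x) \<longlonglongrightarrow> integral {0..u} (\<lambda>s. \<integral>z. ?h z \<partial>P x s)"
      using integral_unique[OF int_n[OF that]] by simp
  qed
  note integral_deriv_Ici[OF integral_P_continuous[OF h0_C, of x] t]
  then have "((\<lambda>u. K e r p x + integral {0..u} (\<lambda>s. \<integral>z. ?h z \<partial>P x s)) has_real_derivative (\<integral>z. ?h z \<partial>P x t)) (at t within {0..})"
    using DERIV_add[OF DERIV_const] by fastforce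
  then show ?thesis
    by (rule has_field_derivative_transform_within[OF _ zero_less_one]) (use t int in \<open>auto simp: algebra_simps\<close>)
qed

section \<open>Resolvent measures\<close>

lemma A_nonneg: "0 \<le> A"
  using a_nonneg[of undefined] a_le[of undefined] by linarith

lemma K_commute: "K e r p z = K e r z p" by (simp add: norm_minus_commute)

lemma moll_commute: "moll e p z = moll e z p" by (simp add: norm_minus_commute)

lemma K_measurable [measurable]: "(\<lambda>z. K e r p z) \<in> borel_measurable borel" by measurable

lemma moll_measurable [measurable]: "(\<lambda>z. moll e p z) \<in> borel_measurable borel" by measurable

text \<open>A uniform bound on the regularised potentials excludes an atom at \<open>p\<close>,
  since the kernel at its centre grows beyond any bound. The value of \<open>K 0 1 p\<close> at
  \<open>p\<close>, which is arbitrary, is then irrelevant, and off \<open>p\<close> the regularised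
  kernels increase to the singular one.\<close>

lemma kernel_monotone_limit:
  fixes \<mu> :: "'a measure"
  assumes "prob_space \<mu>" and [measurable_cong]: "sets \<mu> = sets borel"
    and bound: "\<And>n. (\<integral>z. K (eps n) 1 p z \<partial>\<mu>) \<le> C"
  shows "AE z in \<mu>. z \<noteq> p" and "integrable \<mu> (K 0 1 p)"
    and "(\<lambda>n. \<integral>z. K (eps n) 1 p z \<partial>\<mu>) \<longlonglongrightarrow> (\<integral>z. K 0 1 p z \<partial>\<mu>)"
    and "\<And>n. (\<integral>z. K (eps n) 1 p z \<partial>\<mu>) \<le> (\<integral>z. K 0 1 p z \<partial>\<mu>)"
proof -
  interpret prob_space \<mu> by fact
  have int: "integrable \<mu> (K (eps n) 1 p)" for n
  proof -
    obtain B where "\<And>z. \<bar>K (eps n) 1 p z\<bar> \<le> B" using C_zero_bounded[OF K_C_zero[of "eps n" 1 p]] by auto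
    then show ?thesis by (intro integrable_const_bound[of _ B]) auto
  qed
  have nn: "0 \<le> K (eps n) 1 p z" for n z by (rule newton_gap_nonneg) (auto intro: add_nonneg_pos)
  have "measure \<mu> {p} = 0"
  proof (rule ccontr)
    assume "measure \<mu> {p} \<noteq> 0"
    then have pos: "measure \<mu> {p} > 0" by (simp add: zero_less_measure_iff)
    have "filterlim (\<lambda>n. newton DIM('a) (eps n)) at_top sequentially"
      by (rule filterlim_compose[OF newton_filterlim[OF dim]])
         (auto simp: filterlim_at eps_tendsto less_imp_neq[OF eps_pos, symmetric] intro!: always_eventually)
    from this[THEN filterlim_at_top_dense[THEN iffD1], THEN spec, of "C / measure \<mu> {p} + newton DIM('a) 1"]
    obtain n where n: "newton DIM('a) (eps n) > C / measure \<mu> {p} + newton DIM('a) 1"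
      by (auto simp: eventually_sequentially)
    have "C < measure \<mu> {p} * K (eps n) 1 p p" using n pos by (simp add: newton_gap_def field_simps)
    also have "\<dots> = (\<integral>z. indicator {p} z * K (eps n) 1 p p \<partial>\<mu>)" by simp
    also have "\<dots> \<le> (\<integral>z. K (eps n) 1 p z \<partial>\<mu>)"
    proof (rule integral_mono[OF _ int])
      show "integrable \<mu> (\<lambda>z. indicator {p} z * K (eps n) 1 p p)"
        by (intro integrable_mult_left integrable_real_indicator) (auto simp: emeasure_eq_measure)
      show "indicator {p} z * K (eps n) 1 p p \<le> K (eps n) 1 p z" for z
        using nn[of n z] by (auto simp: indicator_def)
    qed
    finally show False using bound[of n] by simp
  qed
  then have "emeasure \<mu> {p} = 0" by (simp add: emeasure_eq_measure)
  then show AE_p: "AE z in \<mu>. z \<noteq> p"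
    by (subst AE_iff_measurable[where N = "{p}"]) (auto simp: sets_eq_imp_space_eq[OF assms(2)])
  have mono: "mono (\<lambda>n. K (eps n) 1 p z)" for z
    by (intro monoI newton_gap_antimono eps_antimono) (auto intro: add_nonneg_pos)
  have lim: "AE z in \<mu>. (\<lambda>n. K (eps n) 1 p z) \<longlonglongrightarrow> K 0 1 p z"
    using AE_p by eventually_elim (intro newton_gap_tendsto eps_tendsto, auto)
  have inc: "incseq (\<lambda>n. \<integral>z. K (eps n) 1 p z \<partial>\<mu>)"
    by (intro incseq_SucI integral_mono int monoD[OF mono]) auto
  obtain c where c: "(\<lambda>n. \<integral>z. K (eps n) 1 p z \<partial>\<mu>) \<longlonglongrightarrow> c" "\<And>n. (\<integral>z. K (eps n) 1 p z \<partial>\<mu>) \<le> c"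
    using incseq_convergent[OF inc] bound by (metis)
  have *: "integrable \<mu> (K 0 1 p)" "(\<integral>z. K 0 1 p z \<partial>\<mu>) = c"
    by (rule integrable_monotone_convergence[OF int _ lim c(1)] integral_monotone_convergence[OF int _ lim c(1)]; use mono in auto)+
  show "integrable \<mu> (K 0 1 p)" by (rule *)
  show "(\<lambda>n. \<integral>z. K (eps n) 1 p z \<partial>\<mu>) \<longlonglongrightarrow> (\<integral>z. K 0 1 p z \<partial>\<mu>)"
    "(\<integral>z. K (eps n) 1 p z \<partial>\<mu>) \<le> (\<integral>z. K 0 1 p z \<partial>\<mu>)" for n using c * by auto
qed

text \<open>The law of the process at an independent exponential time of rate \<open>l\<close>; as
  an operator, \<open>l\<close> times the usual resolvent.\<close>

definition resolvent :: "real \<Rightarrow> 'a \<Rightarrow> 'a measure" where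
  "resolvent l x = density lborel (exponential_density l) \<bind> P x"

text \<open>This is \<open>W_e(x, p)\<close>. By scaling, the total integral of the mollifier does
  not depend on \<open>e\<close>, so up to a constant this is the density at \<open>p\<close> of the
  mollified measure with weight \<open>a\<close>; it makes sense even if the measure has no
  density.\<close>

definition res_density :: "real \<Rightarrow> real \<Rightarrow> 'a \<Rightarrow> 'a \<Rightarrow> real" where
  "res_density l e x p = (\<integral>z. a z * moll e p z \<partial>resolvent l x)"

lemma
  assumes l: "0 < l"
  shows prob_resolvent: "prob_space (resolvent l x)" and sets_resolvent: "sets (resolvent l x) = sets borel"
    and integral_resolvent: "\<And>(f :: 'a \<Rightarrow> real) B. f \<in> borel_measurable borel \<Longrightarrow> (\<And>z. \<bar>f z\<bar> \<le> B) \<Longrightarrow>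
      (\<integral>z. f z \<partial>resolvent l x) = (\<integral>t. (\<integral>z. f z \<partial>P x t) \<partial>density lborel (exponential_density l))"
proof -
  let ?E = "density lborel (exponential_density l)"
  interpret E: prob_space ?E by (rule prob_space_exponential_density[OF l])
  have P: "P x \<in> ?E \<rightarrow>\<^sub>M subprob_algebra borel" using P_measurable[of x] by simp
  show "prob_space (resolvent l x)" unfolding resolvent_def by (rule E.prob_space_bind[OF _ P]) (simp add: prob_P)
  show "sets (resolvent l x) = sets borel" unfolding resolvent_def by (rule sets_bind) auto
  show "(\<integral>z. f z \<partial>resolvent l x) = (\<integral>t. (\<integral>z. f z \<partial>P x t) \<partial>?E)"
    if "f \<in> borel_measurable borel" "\<And>z. \<bar>f z\<bar> \<le> B" for f :: "'a \<Rightarrow> real" and B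
    unfolding resolvent_def
    by (rule integral_bind[where B = B and B' = 1, OF that(1) _ P])
       (use that(2) prob_space.emeasure_space_1[OF prob_P] in \<open>auto intro: E.finite_measure_axioms\<close>)
qed

lemma K_bounded:
  assumes "0 < e" "0 < r" obtains B where "\<And>p z. \<bar>K e r p z\<bar> \<le> B"
  using newton_gap_abs_bound[OF assms] by (metis zero_le_power2)

lemma a_moll_bound:
  assumes "0 < e" shows "\<bar>a z * moll e p z\<bar> \<le> A * (2 * real DIM('a) * e powr (- real DIM('a) / 2))"
  unfolding abs_mult using mollifier_le[OF assms] mollifier_nonneg[of e] a_nonneg a_le A_nonneg assms
  by (intro mult_mono) auto

lemma res_density_bounds:
  assumes "0 < l" "0 < e"
  shows "0 \<le> res_density l e x p" "res_density l e x p \<le> A * (2 * real DIM('a) * e powr (- real DIM('a) / 2))"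
proof -
  show "0 \<le> res_density l e x p" unfolding res_density_def
    by (intro integral_nonneg_AE AE_I2 mult_nonneg_nonneg a_nonneg mollifier_nonneg) (use assms in auto)
  show "res_density l e x p \<le> A * (2 * real DIM('a) * e powr (- real DIM('a) / 2))"
    using abs_integral_le_bound(2)[where f = "\<lambda>z. a z * moll e p z" and \<mu> = "resolvent l x",
        OF prob_resolvent[OF assms(1)] sets_resolvent[OF assms(1)] _ a_moll_bound[OF assms(2)]]
    unfolding res_density_def by (simp add: abs_le_iff)
qed

lemma integral_P_zero: "f \<in> C_zero \<Longrightarrow> (\<integral>z. f z \<partial>P x 0) = f x"
  using T_eq[of f 0 x] T_zero[of f x] by simp

text \<open>\<open>K_deriv\<close> averaged over an exponential time. The two mollifiers of the gap
  produce the two densities.\<close>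

lemma resolvent_identity:
  assumes l: "0 < l" and e: "0 < e" and r: "0 < r"
  shows "(\<integral>z. K e r p z \<partial>resolvent l x) = K e r p x - (res_density l e x p - res_density l r x p) / l"
proof -
  let ?h = "\<lambda>z. a z * (moll r p z - moll e p z)"
  have K_C: "K e r p \<in> C_zero" by (rule K_C_zero[OF e r])
  have h_C: "?h \<in> C_zero"
    using C_zero_minus[OF a_moll_C_zero[OF r, of p] a_moll_C_zero[OF e, of p]] by (simp add: algebra_simps)
  obtain BK where BK: "\<And>z. \<bar>K e r p z\<bar> \<le> BK" using C_zero_bounded[OF K_C] by blast
  obtain Bh where Bh: "\<And>z. \<bar>?h z\<bar> \<le> Bh" using C_zero_bounded[OF h_C] by blast
  note mK = C_zero_measurable[OF K_C] and mh = C_zero_measurable[OF h_C]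
  define B where "B = max BK Bh"
  have B: "B \<ge> 0" using BK[of x] unfolding B_def by linarith
  have le_B: "v \<le> B * (1 + t)" if "v \<le> B" "0 \<le> t" for v t :: real
    using that B mult_left_mono[of 1 "1 + t" B] by simp
  have "(\<integral>t. (\<integral>z. K e r p z \<partial>P x t) \<partial>density lborel (exponential_density l)) =
      (\<integral>z. K e r p z \<partial>P x 0) + (\<integral>t. (\<integral>z. ?h z \<partial>P x t) \<partial>density lborel (exponential_density l)) / l"
  proof (rule exponential_integral_deriv[where C = B, OF _ _ l])
    show "(\<lambda>t. \<integral>z. K e r p z \<partial>P x t) \<in> borel_measurable borel" "(\<lambda>t. \<integral>z. ?h z \<partial>P x t) \<in> borel_measurable borel"
      by (intro borel_measurable_continuous_onI integral_P_continuous K_C h_C)+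
    show "continuous_on {0..} (\<lambda>t. \<integral>z. ?h z \<partial>P x t)"
      using integral_P_continuous[OF h_C] continuous_on_subset by blast
    show "\<bar>\<integral>z. K e r p z \<partial>P x t\<bar> \<le> B * (1 + t)" if "0 \<le> t" for t
      using abs_integral_P_le[OF mK BK] that unfolding B_def[symmetric] by (intro le_B) (auto simp: B_def le_max_iff_disj)
    show "\<bar>\<integral>z. ?h z \<partial>P x t\<bar> \<le> B * (1 + t)" if "0 \<le> t" for t
      using abs_integral_P_le[OF mh Bh] that unfolding B_def[symmetric] by (intro le_B) (auto simp: B_def le_max_iff_disj)
  qed (rule K_deriv[OF e r])
  also have "(\<integral>t. (\<integral>z. K e r p z \<partial>P x t) \<partial>density lborel (exponential_density l)) = (\<integral>z. K e r p z \<partial>resolvent l x)"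
    using integral_resolvent[OF l mK BK] by simp
  also have "(\<integral>t. (\<integral>z. ?h z \<partial>P x t) \<partial>density lborel (exponential_density l)) = (\<integral>z. ?h z \<partial>resolvent l x)"
    using integral_resolvent[OF l mh Bh] by simp
  also have "(\<integral>z. ?h z \<partial>resolvent l x) = (\<integral>z. a z * moll r p z - a z * moll e p z \<partial>resolvent l x)"
    by (simp add: algebra_simps)
  also have "\<dots> = res_density l r x p - res_density l e x p"
    unfolding res_density_def
    by (intro Bochner_Integration.integral_diff abs_integral_le_bound(1)[OF prob_resolvent sets_resolvent _ a_moll_bound] l e r) auto
  finally show ?thesis unfolding integral_P_zero[OF K_C] by (simp add: diff_divide_distrib)
qed

text \<open>The potential of a nonnegative kernel is nonnegative, so the resolvent identity bounds
  the difference of the densities at \<open>e\<close> and at 1; the additive constant bounds the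
  latter.\<close>

lemma res_density_le:
  assumes l: "0 < l" and e: "0 < e" "e \<le> 1" and "p \<noteq> x"
  shows "res_density l e x p \<le> l * K 0 1 p x + A * (2 * real DIM('a))"
proof -
  have "0 \<le> (\<integral>z. K e 1 p z \<partial>resolvent l x)"
    by (intro integral_nonneg_AE AE_I2 newton_gap_nonneg) (use e in \<open>auto intro: add_nonneg_pos\<close>)
  then have "(res_density l e x p - res_density l 1 x p) / l \<le> K e 1 p x"
    unfolding resolvent_identity[OF l e(1) zero_less_one] by simp
  also have "\<dots> \<le> K 0 1 p x" by (rule newton_gap_antimono) (use assms in auto)
  finally have "res_density l e x p - res_density l 1 x p \<le> l * K 0 1 p x" using l by (simp add: field_simps)
  then show ?thesis using res_density_bounds(2)[OF l zero_less_one, of x p] by simp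
qed

text \<open>The resolvent identity read in the other direction: dropping the nonnegative density at
  \<open>e\<close> bounds the regularised potentials uniformly, as
  \<open>kernel_monotone_limit\<close> demands.\<close>

lemma K0_resolvent:
  assumes l: "0 < l" and "p \<noteq> x"
  shows "AE z in resolvent l x. z \<noteq> p" "integrable (resolvent l x) (K 0 1 p)"
proof -
  have "(\<integral>z. K (eps n) 1 p z \<partial>resolvent l x) \<le> K 0 1 p x + A * (2 * real DIM('a)) / l" for n
  proof -
    have "K (eps n) 1 p x \<le> K 0 1 p x" by (rule newton_gap_antimono) (use assms in \<open>auto intro: less_imp_le\<close>)
    moreover have "- (res_density l (eps n) x p - res_density l 1 x p) / l \<le> A * (2 * real DIM('a)) / l"
      using res_density_bounds(1)[OF l eps_pos, of n x p] res_density_bounds(2)[OF l zero_less_one, of x p] l by (intro divide_right_mono) auto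
    ultimately show ?thesis unfolding resolvent_identity[OF l eps_pos zero_less_one]
      by (simp add: diff_divide_distrib)
  qed
  from kernel_monotone_limit[OF prob_resolvent[OF l] sets_resolvent[OF l] this]
  show "AE z in resolvent l x. z \<noteq> p" "integrable (resolvent l x) (K 0 1 p)" by auto
qed

lemma fubini_resolvent:
  fixes f :: "'a \<Rightarrow> 'a \<Rightarrow> real"
  assumes l: "0 < l" and [measurable]: "(\<lambda>(u, v). f u v) \<in> borel_measurable (borel \<Otimes>\<^sub>M borel)"
    and B: "\<And>u v. \<bar>f u v\<bar> \<le> B"
  shows "(\<integral>v. (\<integral>u. f u v \<partial>resolvent l x) \<partial>resolvent l y) = (\<integral>u. (\<integral>v. f u v \<partial>resolvent l y) \<partial>resolvent l x)"
    and "(\<lambda>v. \<integral>u. f u v \<partial>resolvent l x) \<in> borel_measurable borel"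
proof -
  interpret X: prob_space "resolvent l x" by (rule prob_resolvent[OF l])
  interpret Y: prob_space "resolvent l y" by (rule prob_resolvent[OF l])
  interpret XY: pair_prob_space "resolvent l x" "resolvent l y" ..
  note [measurable_cong] = sets_resolvent[OF l, of x] sets_resolvent[OF l, of y]
  have "integrable (resolvent l x \<Otimes>\<^sub>M resolvent l y) (\<lambda>(u, v). f u v)"
    using B by (intro XY.integrable_const_bound[of _ B]) auto
  then show "(\<integral>v. (\<integral>u. f u v \<partial>resolvent l x) \<partial>resolvent l y) = (\<integral>u. (\<integral>v. f u v \<partial>resolvent l y) \<partial>resolvent l x)"
    by (rule XY.Fubini_integral)
  show "(\<lambda>v. \<integral>u. f u v \<partial>resolvent l x) \<in> borel_measurable borel" by measurable
qed

lemma res_density_measurable: "0 < l \<Longrightarrow> 0 < e \<Longrightarrow> (\<lambda>z. res_density l e x z) \<in> borel_measurable borel"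
  unfolding res_density_def using a_moll_bound[of e] by (intro fubini_resolvent(2)) auto

lemma integrable_res_density: "0 < l \<Longrightarrow> 0 < e \<Longrightarrow> integrable (resolvent l y) (\<lambda>z. res_density l e x z)"
  using res_density_bounds res_density_measurable by (intro abs_integral_le_bound(1)[OF prob_resolvent sets_resolvent]) auto

section \<open>Asymptotic symmetry of the resolvent densities\<close>

text \<open>Integrating the resolvent identity for one measure against the other gives a double integral
  that is symmetric in both points, up to terms that do not depend on \<open>e\<close> and vanish as it grows.\<close>

lemma res_density_antisymmetric_part:
  assumes l: "0 < l" and e: "0 < e"
  shows "res_density l e x y - res_density l e y x = (\<integral>z. res_density l e x z \<partial>resolvent l y) - (\<integral>z. res_density l e y z \<partial>resolvent l x)"
proof -
  \<comment> \<open>\<open>Q\<close> is the defect of the claimed identity. As \<open>K\<close> is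
    symmetric in its two points, equality of the two orders of integration leaves only terms in
    \<open>e\<close> alone and terms in \<open>r\<close> alone, which separate as
    \<open>Q e = Q r\<close>.\<close>
  define Q where "Q e = res_density l e y x + (\<integral>z. res_density l e x z \<partial>resolvent l y) - (res_density l e x y + (\<integral>z. res_density l e y z \<partial>resolvent l x))" for e
  have step: "(\<integral>p. (\<integral>z. K e r p z \<partial>resolvent l x) \<partial>resolvent l y) =
      K e r x y - (res_density l e y x - res_density l r y x) / l - ((\<integral>z. res_density l e x z \<partial>resolvent l y) - (\<integral>z. res_density l r x z \<partial>resolvent l y)) / l"
    if r: "0 < r" for r x y
  proof -
    obtain B where B: "\<And>p z. \<bar>K e r p z\<bar> \<le> B" using K_bounded[OF e r] by blast
    have "(\<integral>p. (\<integral>z. K e r p z \<partial>resolvent l x) \<partial>resolvent l y) = (\<integral>p. K e r x p - (res_density l e x p - res_density l r x p) / l \<partial>resolvent l y)"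
      unfolding resolvent_identity[OF l e r] by (simp add: norm_minus_commute)
    also have "\<dots> = (\<integral>p. K e r x p \<partial>resolvent l y) - ((\<integral>z. res_density l e x z \<partial>resolvent l y) - (\<integral>z. res_density l r x z \<partial>resolvent l y)) / l"
      using abs_integral_le_bound(1)[OF prob_resolvent[OF l] sets_resolvent[OF l] K_measurable B, of y x] integrable_res_density[OF l] e r by simp
    also have "(\<integral>p. K e r x p \<partial>resolvent l y) = K e r x y - (res_density l e y x - res_density l r y x) / l"
      by (rule resolvent_identity[OF l e r])
    finally show ?thesis by simp
  qed
  have Q_const: "Q e = Q r" if r: "0 < r" for r
  proof -
    obtain B where B: "\<And>p z. \<bar>K e r p z\<bar> \<le> B" using K_bounded[OF e r] by blast
    have "(\<integral>p. (\<integral>z. K e r p z \<partial>resolvent l x) \<partial>resolvent l y) = (\<integral>z. (\<integral>p. K e r p z \<partial>resolvent l y) \<partial>resolvent l x)"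
      using B by (intro fubini_resolvent(1)[OF l]) auto
    also have "\<dots> = (\<integral>z. (\<integral>p. K e r z p \<partial>resolvent l y) \<partial>resolvent l x)" by (simp add: norm_minus_commute)
    finally have "K e r x y - (res_density l e y x - res_density l r y x) / l - ((\<integral>z. res_density l e x z \<partial>resolvent l y) - (\<integral>z. res_density l r x z \<partial>resolvent l y)) / l
      = K e r y x - (res_density l e x y - res_density l r x y) / l - ((\<integral>z. res_density l e y z \<partial>resolvent l x) - (\<integral>z. res_density l r y z \<partial>resolvent l x)) / l"
      unfolding step[OF r] .
    then have "(Q e - Q r) / l = 0"
      by (simp add: K_commute[of e r x y] Q_def add_divide_distrib diff_divide_distrib)
    then show ?thesis using l by simp
  qed
  have Q_bound: "\<bar>Q r\<bar> \<le> 2 * (A * (2 * real DIM('a) * r powr (- real DIM('a) / 2)))" if r: "0 < r" for r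
  proof -
    let ?B = "A * (2 * real DIM('a) * r powr (- real DIM('a) / 2))"
    have i: "0 \<le> (\<integral>z. res_density l r x z \<partial>resolvent l y)" "(\<integral>z. res_density l r x z \<partial>resolvent l y) \<le> ?B" for x y
      using abs_integral_le_bound(2)[where f = "res_density l r x" and \<mu> = "resolvent l y" and B = ?B, OF prob_resolvent[OF l] sets_resolvent[OF l] res_density_measurable[OF l r]] res_density_bounds[OF l r]
      by (auto intro!: integral_nonneg_AE simp: abs_le_iff)
    show ?thesis unfolding Q_def using i[of x y] i[of y x] res_density_bounds[OF l r, of x y] res_density_bounds[OF l r, of y x] by linarith
  qed
  have "(\<lambda>n::nat. Q e) \<longlonglongrightarrow> 0"
  proof (rule Lim_null_comparison[OF always_eventually], rule allI)
    show "norm (Q e) \<le> 2 * (A * (2 * real DIM('a) * (real (Suc n)) powr (- real DIM('a) / 2)))" for n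
      using Q_bound[of "real (Suc n)"] Q_const[of "real (Suc n)"] by simp
    have "(\<lambda>n. (real (Suc n)) powr (- real DIM('a) / 2)) \<longlonglongrightarrow> 0"
      by (rule tendsto_neg_powr, simp, real_asymp)
    then show "(\<lambda>n. 2 * (A * (2 * real DIM('a) * (real (Suc n)) powr (- real DIM('a) / 2)))) \<longlonglongrightarrow> 0"
      by (intro tendsto_mult_right_zero)
  qed
  then have "Q e = 0" by (simp add: LIMSEQ_const_iff)
  then show ?thesis by (simp add: Q_def)
qed

lemma moll_far:
  assumes "0 < e" "0 < \<rho>" "\<rho> \<le> norm (z - p)"
  shows "moll e p z \<le> 2 * real DIM('a) * (\<rho>\<^sup>2) powr (- real DIM('a) / 2 - 1) * e"
proof -
  have "moll e p z \<le> mollifier DIM('a) e (\<rho>\<^sup>2)"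
    using assms by (intro mollifier_antimono power_mono) (auto intro: add_nonneg_pos)
  also have "\<dots> \<le> 2 * real DIM('a) * e * (\<rho>\<^sup>2) powr (- real DIM('a) / 2 - 1)"
    using assms by (intro mollifier_le2) auto
  finally show ?thesis by (simp add: mult_ac)
qed

lemma res_density_excess_tendsto_0:
  assumes l: "0 < l" and zx: "z \<noteq> x"
  shows "(\<lambda>n. max 0 (res_density l (eps n) x z - a z * (\<integral>u. moll (eps n) u z \<partial>resolvent l x))) \<longlonglongrightarrow> 0"
proof (cases "a z = 0")
  case True
  interpret X: prob_space "resolvent l x" by (rule prob_resolvent[OF l])
  note [measurable_cong] = sets_resolvent[OF l, of x]
  obtain \<rho>' C' where \<rho>': "\<rho>' > 0" "\<And>u. norm (u - z) < \<rho>' \<Longrightarrow> a u \<le> C' * (norm (u - z))\<^sup>2"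
    using a_zero[OF True] by blast
  \<comment> \<open>The cap at 1 is the range in which \<open>mollifier_mult_le\<close>
    holds.\<close>
  define \<rho> where "\<rho> = min \<rho>' 1"
  define C where "C = \<bar>C'\<bar>"
  have near: "a u \<le> C * (norm (u - z))\<^sup>2" if "norm (u - z) < \<rho>" for u
  proof -
    have "a u \<le> C' * (norm (u - z))\<^sup>2" using \<rho>'(2)[of u] that by (simp add: \<rho>_def)
    also have "\<dots> \<le> C * (norm (u - z))\<^sup>2" unfolding C_def by (intro mult_right_mono) auto
    finally show ?thesis .
  qed
  have \<rho>: "0 < \<rho>" "\<rho> \<le> 1" and C: "0 \<le> C" using \<rho>' by (auto simp: \<rho>_def C_def)
  define M1 where "M1 = C * (2 * real DIM('a) * 2 powr (real DIM('a) / 2))"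
  define M2 where "M2 = A * (2 * real DIM('a) * (\<rho>\<^sup>2) powr (- real DIM('a) / 2 - 1))"
  have M: "0 \<le> M1" "0 \<le> M2" using C A_nonneg by (auto simp: M1_def M2_def)
  have "(\<lambda>n. \<integral>u. a u * moll (eps n) z u \<partial>resolvent l x) \<longlonglongrightarrow> (\<integral>u. 0 \<partial>resolvent l x)"
  \<comment> \<open>The first summand dominates within distance \<open>\<rho>\<close> of
    \<open>z\<close>, the second one, with \<open>eps n \<le> 1\<close>, beyond it.\<close>
  proof (rule integral_dominated_convergence[where w = "\<lambda>u. M1 * \<bar>K 0 1 z u\<bar> + M2"])
    show "integrable (resolvent l x) (\<lambda>u. M1 * \<bar>K 0 1 z u\<bar> + M2)"
      using K0_resolvent(2)[OF l zx] by auto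
    show "AE u in resolvent l x. (\<lambda>n. a u * moll (eps n) z u) \<longlonglongrightarrow> 0"
    proof (rule AE_I2)
      fix u
      show "(\<lambda>n. a u * moll (eps n) z u) \<longlonglongrightarrow> 0"
      proof (cases "u = z")
        case False
        then have s: "0 < (norm (u - z))\<^sup>2" by simp
        show ?thesis
        proof (rule Lim_null_comparison[OF always_eventually], rule allI)
          show "norm (a u * moll (eps n) z u) \<le> A * (2 * real DIM('a) * eps n * ((norm (u - z))\<^sup>2) powr (- real DIM('a) / 2 - 1))" for n
            unfolding real_norm_def abs_mult using mollifier_nonneg[OF less_imp_le[OF eps_pos]] a_nonneg A_nonneg a_le mollifier_le2[OF eps_pos[of n] s, of "DIM('a)"]
            by (intro mult_mono) (auto intro: less_imp_le)
          show "(\<lambda>n. A * (2 * real DIM('a) * eps n * ((norm (u - z))\<^sup>2) powr (- real DIM('a) / 2 - 1))) \<longlonglongrightarrow> 0"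
            by (intro tendsto_mult_right_zero tendsto_mult_left_zero eps_tendsto)
        qed
      qed (simp add: True)
    qed
    show "AE u in resolvent l x. norm (a u * moll (eps n) z u) \<le> M1 * \<bar>K 0 1 z u\<bar> + M2" for n
    proof (rule AE_I2)
      fix u
      have nn: "0 \<le> a u * moll (eps n) z u" by (intro mult_nonneg_nonneg a_nonneg mollifier_nonneg) (simp add: less_imp_le)
      consider "u = z" | "u \<noteq> z" "norm (u - z) < \<rho>" | "\<rho> \<le> norm (u - z)" by linarith
      then show "norm (a u * moll (eps n) z u) \<le> M1 * \<bar>K 0 1 z u\<bar> + M2"
      proof cases
        case 1
        then show ?thesis using True M by simp
      next
        case 2
        then have s: "0 < (norm (u - z))\<^sup>2" "(norm (u - z))\<^sup>2 \<le> 1" using \<rho> by (auto simp: power_le_one_iff)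
        have "a u * moll (eps n) z u \<le> C * (norm (u - z))\<^sup>2 * moll (eps n) z u"
          by (intro mult_right_mono near 2 mollifier_nonneg) (simp add: less_imp_le)
        also have "\<dots> = C * (moll (eps n) z u * (norm (u - z))\<^sup>2)" by simp
        also have "\<dots> \<le> C * (2 * real DIM('a) * 2 powr (real DIM('a) / 2) * K 0 1 z u)"
          by (intro mult_left_mono mollifier_mult_le s C) simp
        also have "\<dots> \<le> M1 * \<bar>K 0 1 z u\<bar>"
          unfolding M1_def using C mult_left_mono[OF abs_ge_self, of "C * (2 * real DIM('a) * 2 powr (real DIM('a) / 2))" "K 0 1 z u"] by (simp add: mult_ac)
        finally show ?thesis using nn M by simp
      next
        case 3
        have "a u * moll (eps n) z u \<le> A * (2 * real DIM('a) * (\<rho>\<^sup>2) powr (- real DIM('a) / 2 - 1) * eps n)"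
          using moll_far[OF eps_pos[of n] \<rho>(1) 3] mollifier_nonneg[OF less_imp_le[OF eps_pos]] a_le A_nonneg by (intro mult_mono) (auto intro: less_imp_le)
        also have "\<dots> = M2 * eps n" by (simp add: M2_def)
        also have "\<dots> \<le> M2" using M by (simp add: mult_left_le)
        finally have "a u * moll (eps n) z u \<le> M2" .
        moreover have "0 \<le> M1 * \<bar>K 0 1 z u\<bar>" using M by simp
        ultimately show ?thesis using nn by simp
      qed
    qed
  qed auto
  then have "(\<lambda>n. res_density l (eps n) x z) \<longlonglongrightarrow> 0" by (simp add: res_density_def)
  then have "(\<lambda>n. max 0 (res_density l (eps n) x z)) \<longlonglongrightarrow> max 0 0" by (intro tendsto_max tendsto_const)
  then show ?thesis using True by simp
next
  case False
  then have az: "a z > 0" using a_nonneg[of z] by linarith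
  define H where "H = l * K 0 1 z x + A * (2 * real DIM('a))"
  have H: "res_density l (eps n) x z \<le> H" for n unfolding H_def by (rule res_density_le) (use l zx in auto)
  have H0: "0 \<le> H" using res_density_bounds(1)[OF l eps_pos] H order_trans by blast
  interpret X: prob_space "resolvent l x" by (rule prob_resolvent[OF l])
  note [measurable_cong] = sets_resolvent[OF l, of x]
  show ?thesis
  proof (rule LIMSEQ_I)
    fix \<epsilon> :: real assume \<epsilon>: "0 < \<epsilon>"
    \<comment> \<open>The first bound keeps \<open>1 - \<delta>\<close> positive, the second makes
      \<open>\<delta> * H\<close> less than \<open>\<epsilon> / 2\<close>; the summand 1 covers
      \<open>H = 0\<close>.\<close>
    define \<delta> where "\<delta> = min (1 / 2) (\<epsilon> / (2 * (H + 1)))"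
    have \<delta>: "0 < \<delta>" "\<delta> < 1" using \<epsilon> H0 by (auto simp: \<delta>_def)
    have "\<delta> * H \<le> \<epsilon> / (2 * (H + 1)) * H" using H0 by (intro mult_right_mono) (auto simp: \<delta>_def)
    also have "\<dots> < \<epsilon> / 2" using \<epsilon> H0 by (simp add: field_simps)
    finally have \<delta>H: "\<delta> * H < \<epsilon> / 2" .
    have "a z < a z / (1 - \<delta>)" using az \<delta> by (simp add: field_simps)
    moreover have "isCont a z" using a_cont by (simp add: continuous_on_eq_continuous_at)
    ultimately have "\<forall>\<^sub>F u in nhds z. a u < a z / (1 - \<delta>)"
      by (auto simp: isCont_def intro: order_tendstoD(2) tendsto_at_iff_tendsto_nhds[THEN iffD1])
    then obtain \<rho> where \<rho>: "\<rho> > 0" "\<And>u. norm (u - z) < \<rho> \<Longrightarrow> a u < a z / (1 - \<delta>)"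
      by (auto simp: eventually_nhds_metric dist_norm)
    define M2 where "M2 = A * (2 * real DIM('a) * (\<rho>\<^sup>2) powr (- real DIM('a) / 2 - 1))"
    have M2: "0 \<le> M2" using A_nonneg by (simp add: M2_def)
    have bound: "res_density l (eps n) x z - a z * (\<integral>u. moll (eps n) u z \<partial>resolvent l x) \<le> \<delta> * H + M2 * eps n" for n
    proof -
      have moll_i: "integrable (resolvent l x) (moll (eps n) z)"
        using mollifier_le[OF eps_pos[of n], of _ "DIM('a)"] mollifier_nonneg[OF less_imp_le[OF eps_pos[of n]], of "DIM('a)"]
        by (intro abs_integral_le_bound(1)[OF prob_resolvent[OF l] sets_resolvent[OF l], where B = "2 * real DIM('a) * eps n powr (- real DIM('a) / 2)"])
          (auto simp: less_imp_le)
      have amoll_i: "integrable (resolvent l x) (\<lambda>u. a u * moll (eps n) z u)"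
        using a_moll_bound[OF eps_pos] by (intro abs_integral_le_bound(1)[OF prob_resolvent[OF l] sets_resolvent[OF l]]) auto
      have pw: "a u * moll (eps n) z u - a z * moll (eps n) z u \<le> \<delta> * (a u * moll (eps n) z u) + M2 * eps n" for u
      proof (cases "norm (u - z) < \<rho>")
        case True
        then have "(1 - \<delta>) * a u \<le> a z" using \<rho>(2)[OF True] \<delta> by (simp add: field_simps)
        then have "(1 - \<delta>) * a u * moll (eps n) z u \<le> a z * moll (eps n) z u"
          by (intro mult_right_mono mollifier_nonneg) (simp_all add: less_imp_le)
        moreover have "0 \<le> M2 * eps n" using M2 by (simp add: less_imp_le)
        ultimately show ?thesis by (simp add: algebra_simps)
      next
        case False
        have "a u * moll (eps n) z u \<le> A * (2 * real DIM('a) * (\<rho>\<^sup>2) powr (- real DIM('a) / 2 - 1) * eps n)"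
          using moll_far[OF eps_pos[of n] \<rho>(1), of u z] False mollifier_nonneg[OF less_imp_le[OF eps_pos]] a_le A_nonneg by (intro mult_mono) (auto intro: less_imp_le)
        also have "\<dots> = M2 * eps n" by (simp add: M2_def)
        finally have "a u * moll (eps n) z u \<le> M2 * eps n" .
        moreover have "0 \<le> a z * moll (eps n) z u" "0 \<le> \<delta> * (a u * moll (eps n) z u)"
          using \<delta> by (intro mult_nonneg_nonneg a_nonneg mollifier_nonneg; simp add: less_imp_le)+
        ultimately show ?thesis by linarith
      qed
      have "res_density l (eps n) x z - a z * (\<integral>u. moll (eps n) u z \<partial>resolvent l x) = (\<integral>u. a u * moll (eps n) z u - a z * moll (eps n) z u \<partial>resolvent l x)"
        using moll_i amoll_i by (simp add: res_density_def moll_commute[of "eps n" _ z])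
      also have "\<dots> \<le> (\<integral>u. \<delta> * (a u * moll (eps n) z u) + M2 * eps n \<partial>resolvent l x)"
        using moll_i amoll_i by (intro integral_mono pw) auto
      also have "\<dots> = \<delta> * res_density l (eps n) x z + M2 * eps n"
        using amoll_i by (simp add: res_density_def X.prob_space)
      also have "\<dots> \<le> \<delta> * H + M2 * eps n" using H \<delta> by (intro add_right_mono mult_left_mono) auto
      finally show ?thesis .
    qed
    have "(\<lambda>n. M2 * eps n) \<longlonglongrightarrow> 0" by (intro tendsto_mult_right_zero eps_tendsto)
    from LIMSEQ_D[OF this, of "\<epsilon> / 2"] \<epsilon> obtain m where m: "\<And>n. n \<ge> m \<Longrightarrow> \<bar>M2 * eps n\<bar> < \<epsilon> / 2"
      by (auto)
    show "\<exists>m. \<forall>n\<ge>m. norm (max 0 (res_density l (eps n) x z - a z * (\<integral>u. moll (eps n) u z \<partial>resolvent l x)) - 0) < \<epsilon>"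
    proof (intro exI[of _ m] allI impI)
      fix n assume "m \<le> n"
      then have "\<delta> * H + M2 * eps n < \<epsilon>" using m[of n] \<delta>H by linarith
      then show "norm (max 0 (res_density l (eps n) x z - a z * (\<integral>u. moll (eps n) u z \<partial>resolvent l x)) - 0) < \<epsilon>"
        using bound[of n] \<epsilon> by simp
    qed
  qed
qed

text \<open>Dominated convergence under the measure of \<open>y\<close>. The majorant comes from
  \<open>res_density_le\<close> and controls the positive part because the subtracted term is
  nonnegative; hence an upper bound \<open>D\<close> in place of a limit.\<close>

lemma res_density_difference_upper:
  assumes l: "0 < l" and xy: "x \<noteq> y"
  obtains D where "D \<longlonglongrightarrow> 0" "\<And>n. res_density l (eps n) x y - res_density l (eps n) y x \<le> D n"
proof -
  interpret Y: prob_space "resolvent l y" by (rule prob_resolvent[OF l])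
  note [measurable_cong] = sets_resolvent[OF l, of y]
  let ?b = "\<lambda>n z. a z * (\<integral>u. moll (eps n) u z \<partial>resolvent l x)"
  have moll_B: "\<bar>moll (eps n) u z\<bar> \<le> 2 * real DIM('a) * eps n powr (- real DIM('a) / 2)" for n u z
    using mollifier_le[OF eps_pos[of n], of _ "DIM('a)"] mollifier_nonneg[OF less_imp_le[OF eps_pos[of n]], of "DIM('a)"] by (simp add: less_imp_le)
  have [measurable]: "(\<lambda>z. res_density l (eps n) x z) \<in> borel_measurable borel" for n by (rule res_density_measurable[OF l eps_pos])
  have b_meas [measurable]: "(\<lambda>z. ?b n z) \<in> borel_measurable borel" for n
    by (intro borel_measurable_times a_measurable fubini_resolvent(2)[OF l]) (use moll_B in auto)
  have b_nn: "0 \<le> ?b n z" for n z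
    by (intro mult_nonneg_nonneg a_nonneg integral_nonneg_AE AE_I2 mollifier_nonneg) (simp add: less_imp_le)
  have moll_int: "\<bar>\<integral>u. moll (eps n) u z \<partial>resolvent l x\<bar> \<le> 2 * real DIM('a) * eps n powr (- real DIM('a) / 2)" for n z
    by (intro abs_integral_le_bound(2)[OF prob_resolvent[OF l] sets_resolvent[OF l] _ moll_B]) measurable
  have b_int: "integrable (resolvent l y) (?b n)" for n
  proof (rule abs_integral_le_bound(1)[OF prob_resolvent[OF l] sets_resolvent[OF l] b_meas])
    show "\<bar>?b n z\<bar> \<le> A * (2 * real DIM('a) * eps n powr (- real DIM('a) / 2))" for z
      unfolding abs_mult using moll_int a_nonneg a_le A_nonneg by (intro mult_mono) auto
  qed
  define D where "D n = (\<integral>z. max 0 (res_density l (eps n) x z - ?b n z) \<partial>resolvent l y)" for n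
  have "D \<longlonglongrightarrow> (\<integral>z. 0 \<partial>resolvent l y)"
    unfolding D_def
  proof (rule integral_dominated_convergence[where w = "\<lambda>z. l * K 0 1 x z + A * (2 * real DIM('a))"])
    show "integrable (resolvent l y) (\<lambda>z. l * K 0 1 x z + A * (2 * real DIM('a)))"
      using K0_resolvent(2)[OF l xy] by auto
    show "AE z in resolvent l y. (\<lambda>n. max 0 (res_density l (eps n) x z - ?b n z)) \<longlonglongrightarrow> 0"
      using K0_resolvent(1)[OF l xy] by eventually_elim (rule res_density_excess_tendsto_0[OF l])
    show "AE z in resolvent l y. norm (max 0 (res_density l (eps n) x z - ?b n z)) \<le> l * K 0 1 x z + A * (2 * real DIM('a))" for n
      using K0_resolvent(1)[OF l xy]
    proof eventually_elim
      case (elim z)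
      have "res_density l (eps n) x z \<le> l * K 0 1 x z + A * (2 * real DIM('a))"
        using res_density_le[OF l eps_pos[of n] eps_le_1 elim] by (simp add: norm_minus_commute)
      then show ?case using b_nn[of z n] res_density_bounds(1)[OF l eps_pos[of n], of x z] by auto
    qed
  qed auto
  moreover have "res_density l (eps n) x y - res_density l (eps n) y x \<le> D n" for n
  \<comment> \<open>Exchanging the order of integration moves the measure of \<open>y\<close>
    outside in the second double integral as well; there \<open>a\<close> depends on the outer
    variable and leaves the inner integral, giving \<open>?b\<close>.\<close>
  proof -
    have "(\<integral>z. res_density l (eps n) y z \<partial>resolvent l x) = (\<integral>v. (\<integral>u. a u * moll (eps n) v u \<partial>resolvent l y) \<partial>resolvent l x)"
      by (simp add: res_density_def)
    also have "\<dots> = (\<integral>u. (\<integral>v. a u * moll (eps n) v u \<partial>resolvent l x) \<partial>resolvent l y)"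
      using a_moll_bound[OF eps_pos] by (intro fubini_resolvent(1)[OF l]) auto
    finally have *: "(\<integral>z. res_density l (eps n) y z \<partial>resolvent l x) = (\<integral>z. ?b n z \<partial>resolvent l y)"
      by (simp add: norm_minus_commute)
    have "res_density l (eps n) x y - res_density l (eps n) y x = (\<integral>z. res_density l (eps n) x z - ?b n z \<partial>resolvent l y)"
      unfolding res_density_antisymmetric_part[OF l eps_pos] * using integrable_res_density[OF l eps_pos] b_int by simp
    also have "\<dots> \<le> D n" unfolding D_def
      using integrable_res_density[OF l eps_pos] b_int by (intro integral_mono) auto
    finally show ?thesis .
  qed
  ultimately show ?thesis using that by simp
qed

lemma res_density_difference_tendsto_0:
  assumes l: "0 < l" and xy: "x \<noteq> y"
  shows "(\<lambda>n. res_density l (eps n) x y - res_density l (eps n) y x) \<longlonglongrightarrow> 0"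
proof -
  obtain D where D: "D \<longlonglongrightarrow> 0" "\<And>n. res_density l (eps n) x y - res_density l (eps n) y x \<le> D n"
    using res_density_difference_upper[OF l xy] by blast
  obtain D' where D': "D' \<longlonglongrightarrow> 0" "\<And>n. res_density l (eps n) y x - res_density l (eps n) x y \<le> D' n"
    using res_density_difference_upper[OF l xy[symmetric]] by blast
  show ?thesis
  proof (rule tendsto_sandwich)
    show "\<forall>\<^sub>F n in sequentially. - D' n \<le> res_density l (eps n) x y - res_density l (eps n) y x"
      using D'(2) by (intro always_eventually allI) (smt (verit))
    show "\<forall>\<^sub>F n in sequentially. res_density l (eps n) x y - res_density l (eps n) y x \<le> D n"
      using D(2) by (intro always_eventually allI)
    show "(\<lambda>n. - D' n) \<longlonglongrightarrow> 0" using tendsto_minus[OF D'(1)] by simp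
  qed (rule D(1))
qed

section \<open>Symmetry in time\<close>

text \<open>The counterpart of \<open>res_density\<close> at a fixed time: up to a constant, the
  mollified density at \<open>p\<close> of the occupation measure up to time \<open>t\<close>,
  weighted by \<open>a\<close>. Its exponential average is \<open>res_density\<close> divided by
  \<open>l\<close>.\<close>

definition occ_density :: "real \<Rightarrow> 'a \<Rightarrow> 'a \<Rightarrow> real \<Rightarrow> real" where
  "occ_density e x p t = integral {0..t} (\<lambda>s. \<integral>z. a z * moll e p z \<partial>P x s)"

lemma a_moll_P_bounds:
  assumes e: "0 < e"
  shows "0 \<le> (\<integral>z. a z * moll e p z \<partial>P x s)"
    "(\<integral>z. a z * moll e p z \<partial>P x s) \<le> A * (2 * real DIM('a) * e powr (- real DIM('a) / 2))"
proof -
  show "0 \<le> (\<integral>z. a z * moll e p z \<partial>P x s)"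
    by (intro integral_nonneg_AE AE_I2 mult_nonneg_nonneg a_nonneg mollifier_nonneg) (use assms in auto)
  show "(\<integral>z. a z * moll e p z \<partial>P x s) \<le> A * (2 * real DIM('a) * e powr (- real DIM('a) / 2))"
    using abs_integral_P_le[OF _ a_moll_bound[OF e], where x = x and t = s] by (simp add: abs_le_iff)
qed

lemma occ_density_deriv:
  assumes e: "0 < e" and t: "0 \<le> t"
  shows "(occ_density e x p has_real_derivative (\<integral>z. a z * moll e p z \<partial>P x t)) (at t within {0..})"
  unfolding occ_density_def[abs_def] by (rule integral_deriv_Ici[OF integral_P_continuous[OF a_moll_C_zero[OF e]] t])

lemma a_moll_P_integrable_on:
  assumes e: "0 < e" shows "(\<lambda>s. \<integral>z. a z * moll e p z \<partial>P x s) integrable_on {u..t}"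
  by (intro integrable_continuous_real continuous_on_subset[OF integral_P_continuous[OF a_moll_C_zero[OF e]]]) simp

lemma occ_density_bounds:
  assumes e: "0 < e" and t: "0 \<le> t"
  shows "0 \<le> occ_density e x p t" "occ_density e x p t \<le> A * (2 * real DIM('a) * e powr (- real DIM('a) / 2)) * t"
proof -
  show "0 \<le> occ_density e x p t" unfolding occ_density_def
    by (intro Henstock_Kurzweil_Integration.integral_nonneg a_moll_P_integrable_on a_moll_P_bounds e)
  have "occ_density e x p t \<le> integral {0..t} (\<lambda>_. A * (2 * real DIM('a) * e powr (- real DIM('a) / 2)))"
    unfolding occ_density_def by (intro integral_le a_moll_P_integrable_on a_moll_P_bounds e) auto
  also have "\<dots> = A * (2 * real DIM('a) * e powr (- real DIM('a) / 2)) * t" using t by simp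
  finally show "occ_density e x p t \<le> A * (2 * real DIM('a) * e powr (- real DIM('a) / 2)) * t" .
qed

lemma occ_density_mono:
  assumes e: "0 < e" and "0 \<le> s" "s \<le> t"
  shows "occ_density e x p s \<le> occ_density e x p t"
  unfolding occ_density_def using assms by (intro integral_subset_le a_moll_P_integrable_on) (auto intro: a_moll_P_bounds)

lemma occ_density_continuous: "0 < e \<Longrightarrow> continuous_on {0..} (occ_density e x p)"
  by (rule DERIV_continuous_on[OF occ_density_deriv]) auto

lemma occ_density_measurable: 
  assumes e: "0 < e" shows "occ_density e x p \<in> borel_measurable borel"
proof -
  have "continuous_on UNIV (\<lambda>t. occ_density e x p (max 0 t))"
    by (rule continuous_on_compose2[OF occ_density_continuous[OF e]]) (auto intro!: continuous_intros)
  \<comment> \<open>For \<open>t < 0\<close> the interval of integration is empty, so the value is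
    0, as at \<open>t = 0\<close>.\<close>
  moreover have "occ_density e x p (max 0 t) = occ_density e x p t" for t by (auto simp: occ_density_def max_def)
  ultimately show ?thesis by (intro borel_measurable_continuous_onI) simp
qed

lemma K_time:
  assumes e: "0 < e" and r: "0 < r" and t: "0 \<le> t"
  shows "(\<integral>z. K e r p z \<partial>P x t) = K e r p x - occ_density e x p t + occ_density r x p t"
proof -
  have "((\<lambda>s. \<integral>z. a z * (moll r p z - moll e p z) \<partial>P x s) has_integral (\<integral>z. K e r p z \<partial>P x t) - (\<integral>z. K e r p z \<partial>P x 0)) {0..t}"
  proof (rule fundamental_theorem_of_calculus[OF t])
    fix s assume "s \<in> {0..t}"
    then have "((\<lambda>t. \<integral>z. K e r p z \<partial>P x t) has_real_derivative (\<integral>z. a z * (moll r p z - moll e p z) \<partial>P x s)) (at s within {0..t})"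
      by (intro DERIV_subset[OF K_deriv[OF e r]]) auto
    then show "((\<lambda>t. \<integral>z. K e r p z \<partial>P x t) has_vector_derivative (\<integral>z. a z * (moll r p z - moll e p z) \<partial>P x s)) (at s within {0..t})"
      by (simp add: has_real_derivative_iff_has_vector_derivative)
  qed
  then have "(\<integral>z. K e r p z \<partial>P x t) - K e r p x = integral {0..t} (\<lambda>s. \<integral>z. a z * (moll r p z - moll e p z) \<partial>P x s)"
    unfolding integral_P_zero[OF K_C_zero[OF e r]] by (rule integral_unique[symmetric])
  also have "(\<lambda>s. \<integral>z. a z * (moll r p z - moll e p z) \<partial>P x s) = (\<lambda>s. (\<integral>z. a z * moll r p z \<partial>P x s) - (\<integral>z. a z * moll e p z \<partial>P x s))"
    using integrable_P_C_zero[OF a_moll_C_zero] e r by (simp add: right_diff_distrib)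
  also have "integral {0..t} \<dots> = occ_density r x p t - occ_density e x p t"
    unfolding occ_density_def by (intro Henstock_Kurzweil_Integration.integral_diff a_moll_P_integrable_on e r)
  finally show ?thesis by simp
qed

lemma occ_density_laplace:
  assumes l: "0 < l" and e: "0 < e"
  shows "(\<integral>t. occ_density e x p t \<partial>density lborel (exponential_density l)) = res_density l e x p / l"
proof -
  let ?B = "A * (2 * real DIM('a) * e powr (- real DIM('a) / 2))"
  have B: "0 \<le> ?B" using A_nonneg by simp
  have "(\<integral>t. occ_density e x p t \<partial>density lborel (exponential_density l)) =
     occ_density e x p 0 + (\<integral>t. (\<integral>z. a z * moll e p z \<partial>P x t) \<partial>density lborel (exponential_density l)) / l"
  proof (rule exponential_integral_deriv[where C = ?B, OF occ_density_measurable[OF e] _ l occ_density_deriv[OF e]])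
    show "(\<lambda>t. \<integral>z. a z * moll e p z \<partial>P x t) \<in> borel_measurable borel"
      by (intro borel_measurable_continuous_onI integral_P_continuous a_moll_C_zero e)
    show "continuous_on {0..} (\<lambda>t. \<integral>z. a z * moll e p z \<partial>P x t)"
      by (rule continuous_on_subset[OF integral_P_continuous[OF a_moll_C_zero[OF e]]]) simp
    fix t :: real assume t: "0 \<le> t"
    have "?B * t \<le> ?B * (1 + t)" "?B * 1 \<le> ?B * (1 + t)" using B t by (intro mult_left_mono; simp)+
    then show "\<bar>occ_density e x p t\<bar> \<le> ?B * (1 + t)" "\<bar>\<integral>z. a z * moll e p z \<partial>P x t\<bar> \<le> ?B * (1 + t)"
      using occ_density_bounds[OF e t, of x p] a_moll_P_bounds[OF e, of x t p] by linarith+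
  qed
  also have "occ_density e x p 0 = 0" by (simp add: occ_density_def)
  also have "(\<integral>t. (\<integral>z. a z * moll e p z \<partial>P x t) \<partial>density lborel (exponential_density l)) = res_density l e x p"
    unfolding res_density_def by (rule integral_resolvent[OF l _ a_moll_bound[OF e], symmetric]) measurable
  finally show ?thesis by simp
qed

text \<open>The limit of \<open>occ_density e x p t\<close> as \<open>e\<close> tends to \<open>0\<close>, written so that only one singular integral occurs.\<close>

definition pot_loss :: "'a \<Rightarrow> 'a \<Rightarrow> real \<Rightarrow> real" where
  "pot_loss x p t = K 0 1 p x + occ_density 1 x p t - (\<integral>z. K 0 1 p z \<partial>P x t)"

text \<open>Nonnegativity of \<open>occ_density\<close> at \<open>eps n\<close> bounds the
  regularised potentials at time \<open>t\<close>, so \<open>kernel_monotone_limit\<close> applies.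
  Because these potentials stay below their limit, \<open>pot_loss\<close> lies below each
  approximation up to a constant in time, which later gives its upper semicontinuity.\<close>

lemma
  assumes t: "0 \<le> t" and xp: "x \<noteq> p"
  shows K0_P_AE: "AE z in P x t. z \<noteq> p"
    and K0_P_integrable: "integrable (P x t) (K 0 1 p)"
    and occ_density_tendsto: "(\<lambda>n. occ_density (eps n) x p t) \<longlonglongrightarrow> pot_loss x p t"
    and pot_loss_le: "pot_loss x p t \<le> occ_density (eps n) x p t - K (eps n) 1 p x + K 0 1 p x"
    and occ_density_eps_le: "occ_density (eps n) x p t \<le> K 0 1 p x + occ_density 1 x p t"
proof -
  have pos: "0 < (norm (x - p))\<^sup>2" using xp by simp
  have K_le: "K (eps n) 1 p x \<le> K 0 1 p x" for n
    by (rule newton_gap_antimono) (use pos in \<open>auto simp: less_imp_le\<close>)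
  have "(\<integral>z. K (eps n) 1 p z \<partial>P x t) \<le> K 0 1 p x + occ_density 1 x p t" for n
    using K_time[OF eps_pos[of n] zero_less_one t, of x p] K_le[of n] occ_density_bounds(1)[OF eps_pos[of n] t, of x p] by simp
  note lim = kernel_monotone_limit[OF prob_P sets_P this]
  show "AE z in P x t. z \<noteq> p" "integrable (P x t) (K 0 1 p)" by (rule lim)+
  have occ_density_eq: "occ_density (eps n) x p t = K (eps n) 1 p x + occ_density 1 x p t - (\<integral>z. K (eps n) 1 p z \<partial>P x t)" for n
    using K_time[OF eps_pos[of n] zero_less_one t, of x p] by simp
  show "(\<lambda>n. occ_density (eps n) x p t) \<longlonglongrightarrow> pot_loss x p t"
    unfolding occ_density_eq pot_loss_def by (intro tendsto_intros lim(3) newton_gap_tendsto eps_tendsto) (use pos in simp)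
  show "pot_loss x p t \<le> occ_density (eps n) x p t - K (eps n) 1 p x + K 0 1 p x"
    unfolding occ_density_eq pot_loss_def using lim(4)[of n] by simp
  have "0 \<le> (\<integral>z. K (eps n) 1 p z \<partial>P x t)"
    by (intro integral_nonneg_AE AE_I2 newton_gap_nonneg) (auto intro: add_nonneg_pos)
  then show "occ_density (eps n) x p t \<le> K 0 1 p x + occ_density 1 x p t"
    unfolding occ_density_eq using K_le[of n] by simp
qed

section \<open>Regularity in time and inversion of the Laplace transform\<close>

lemma pot_loss_mono:
  assumes "x \<noteq> p" "0 \<le> s" "s \<le> t"
  shows "pot_loss x p s \<le> pot_loss x p t"
  by (rule LIMSEQ_le[OF occ_density_tendsto occ_density_tendsto]) (use assms occ_density_mono in auto)

text \<open>Monotonicity gives the lower half. For the upper half, \<open>pot_loss\<close> lies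
  below continuous functions of time that converge to it, by \<open>pot_loss_le\<close>.\<close>

lemma pot_loss_right_continuous:
  assumes xp: "x \<noteq> p" and t: "0 \<le> t"
  shows "(pot_loss x p \<longlongrightarrow> pot_loss x p t) (at_right t)"
proof (rule order_tendstoI)
  fix c assume "c < pot_loss x p t"
  then show "\<forall>\<^sub>F s in at_right t. c < pot_loss x p s"
    using pot_loss_mono[OF xp t] by (intro eventually_mono[OF eventually_at_right_less[of t]]) (force intro: less_le_trans)
next
  fix c assume c: "pot_loss x p t < c"
  have "(\<lambda>n. occ_density (eps n) x p t - K (eps n) 1 p x + K 0 1 p x) \<longlonglongrightarrow> pot_loss x p t - K 0 1 p x + K 0 1 p x"
    by (intro tendsto_intros occ_density_tendsto[OF t xp] newton_gap_tendsto eps_tendsto) (use xp in simp)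
  then have "(\<lambda>n. occ_density (eps n) x p t - K (eps n) 1 p x + K 0 1 p x) \<longlonglongrightarrow> pot_loss x p t" by simp
  from order_tendstoD(2)[OF this c] obtain n where n: "occ_density (eps n) x p t - K (eps n) 1 p x + K 0 1 p x < c"
    by (auto simp: eventually_sequentially)
  have "(occ_density (eps n) x p \<longlongrightarrow> occ_density (eps n) x p t) (at t within {0..})"
    using occ_density_continuous[OF eps_pos[of n], of x p] t by (auto simp: continuous_on_def)
  then have "(occ_density (eps n) x p \<longlongrightarrow> occ_density (eps n) x p t) (at_right t)"
    by (rule tendsto_within_subset) (use t in auto)
  then have "((\<lambda>s. occ_density (eps n) x p s - K (eps n) 1 p x + K 0 1 p x) \<longlongrightarrow> occ_density (eps n) x p t - K (eps n) 1 p x + K 0 1 p x) (at_right t)"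
    by (intro tendsto_intros)
  from order_tendstoD(2)[OF this n] eventually_at_right_less[of t]
  show "\<forall>\<^sub>F s in at_right t. pot_loss x p s < c"
  proof eventually_elim
    case (elim s)
    then show ?case using pot_loss_le[of s x p n] xp t by simp
  qed
qed

text \<open>The transform of the difference \<open>D\<close> at rate \<open>l\<close> is the limit
  of differences of resolvent densities, hence 0; \<open>laplace_nonpos\<close> turns this into a
  sign at each single time.\<close>

lemma pot_loss_le_commute:
  assumes xy: "x \<noteq> y" and t: "0 \<le> t"
  shows "pot_loss x y t \<le> pot_loss y x t"
proof -
  define F where "F n t = occ_density (eps n) x y t - occ_density (eps n) y x t" for n t
  \<comment> \<open>At negative times every \<open>F n\<close> is 0, so with this value
    \<open>D\<close> is the limit of \<open>F\<close> on the whole line and measurable. The constant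
    \<open>C\<close> of the next line adds the initial kernel to the growth rate of
    \<open>occ_density\<close> at \<open>e = 1\<close>.\<close>
  define D where "D t = (if 0 \<le> t then pot_loss x y t - pot_loss y x t else 0)" for t
  define C where "C = K 0 1 y x + A * (2 * real DIM('a))"
  have K0: "0 \<le> K 0 1 y x" by (rule newton_gap_nonneg) (use xy in auto)
  have [measurable]: "F n \<in> borel_measurable borel" for n
    unfolding F_def[abs_def] using occ_density_measurable[OF eps_pos] by measurable
  have F_lim: "(\<lambda>n. F n s) \<longlonglongrightarrow> D s" for s
  proof (cases "0 \<le> s")
    case True
    then show ?thesis unfolding F_def D_def using occ_density_tendsto[OF True xy] occ_density_tendsto[OF True xy[symmetric]]
      by (auto intro!: tendsto_diff)
  qed (simp add: F_def D_def occ_density_def)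
  have D_meas: "D \<in> borel_measurable borel"
    by (rule borel_measurable_LIMSEQ_real[where u = F]) (use F_lim in auto)
  have up: "K 0 1 y x + occ_density 1 x' p' s \<le> C * (1 + s)" if "0 \<le> s" for s x' p'
  proof -
    have "occ_density 1 x' p' s \<le> A * (2 * real DIM('a)) * s" using occ_density_bounds(2)[OF zero_less_one that, of x' p'] by simp
    moreover have "C * (1 + s) = K 0 1 y x + A * (2 * real DIM('a)) * s + (K 0 1 y x * s + A * (2 * real DIM('a)))"
      by (simp add: C_def algebra_simps)
    moreover have "0 \<le> K 0 1 y x * s + A * (2 * real DIM('a))" using K0 A_nonneg that by (intro add_nonneg_nonneg mult_nonneg_nonneg) auto
    ultimately show ?thesis by linarith
  qed
  have F_bound: "\<bar>F n s\<bar> \<le> C * (1 + s)" if s: "0 \<le> s" for n s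
    using occ_density_eps_le[OF s xy, of n] occ_density_eps_le[OF s xy[symmetric], of n] occ_density_bounds(1)[OF eps_pos[of n] s, of x y]
      occ_density_bounds(1)[OF eps_pos[of n] s, of y x] up[OF s, of x y] up[OF s, of y x] K_commute[of 0 1 x y]
    unfolding F_def abs_le_iff by (intro conjI; linarith)
  have D_bound: "\<bar>D s\<bar> \<le> C * (1 + s)" if s: "0 \<le> s" for s
    by (rule LIMSEQ_le_const2[OF tendsto_rabs[OF F_lim]]) (use F_bound[OF s] in auto)
  have "D t \<le> 0"
  proof (rule laplace_nonpos[OF D_meas D_bound _ _ t])
    fix s :: real assume s: "0 \<le> s"
    have "((\<lambda>u. pot_loss x y u - pot_loss y x u) \<longlongrightarrow> D s) (at_right s)"
      unfolding D_def using s xy by (auto intro!: tendsto_diff pot_loss_right_continuous)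
    then show "(D \<longlongrightarrow> D s) (at_right s)"
    proof (rule Lim_transform_eventually)
      show "\<forall>\<^sub>F u in at_right s. pot_loss x y u - pot_loss y x u = D u"
        using eventually_at_right_less[of s] by eventually_elim (use s in \<open>auto simp: D_def\<close>)
    qed
  next
    fix m :: nat
    define l where "l = real (Suc m)"
    have l: "0 < l" by (simp add: l_def)
    let ?E = "density lborel (exponential_density l)"
    have occ_density_int: "integrable ?E (occ_density (eps n) x y)" if "x \<noteq> y" for n x y
    proof (rule exponential_integrable_linear_growth[OF occ_density_measurable[OF eps_pos] l])
      let ?B = "A * (2 * real DIM('a) * eps n powr (- real DIM('a) / 2))"
      fix t :: real assume t: "0 \<le> t"
      have "?B * t \<le> ?B * (1 + t)" using A_nonneg t by (intro mult_left_mono) auto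
      then show "\<bar>occ_density (eps n) x y t\<bar> \<le> ?B * (1 + t)" using occ_density_bounds[OF eps_pos[of n] t, of x y] by linarith
    qed
    have "(\<lambda>n. \<integral>s. F n s \<partial>?E) \<longlonglongrightarrow> (\<integral>s. D s \<partial>?E)"
    proof (rule integral_dominated_convergence[where w = "\<lambda>s. C * (1 + s)"])
      show "integrable ?E (\<lambda>s. C * (1 + s))"
      proof (rule exponential_integrable_linear_growth[OF _ l])
        show "\<bar>C * (1 + s)\<bar> \<le> C * (1 + s)" if "0 \<le> s" for s
          using order_trans[OF abs_ge_zero F_bound[OF that]] by simp
      qed measurable
      show "AE s in ?E. norm (F n s) \<le> C * (1 + s)" for n
        using F_bound by (subst AE_density) (auto simp: exponential_density_def)
    qed (use F_lim D_meas in auto)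
    moreover have "(\<integral>s. F n s \<partial>?E) = (res_density l (eps n) x y - res_density l (eps n) y x) / l" for n
      unfolding F_def using occ_density_int[OF xy] occ_density_int[OF xy[symmetric]] occ_density_laplace[OF l eps_pos]
      by (simp add: diff_divide_distrib)
    moreover have "(\<lambda>n. (res_density l (eps n) x y - res_density l (eps n) y x) / l) \<longlonglongrightarrow> 0 / l"
      by (intro tendsto_divide res_density_difference_tendsto_0[OF l xy] tendsto_const) (use l in simp)
    ultimately have "(\<integral>s. D s \<partial>?E) = 0" by (intro LIMSEQ_unique) auto
    then show "(\<integral>s. D s \<partial>density lborel (exponential_density (real (Suc m)))) = 0" by (simp add: l_def)
  qed
  then show ?thesis using t by (simp add: D_def)
qed

lemma pot_loss_commute: "x \<noteq> y \<Longrightarrow> 0 \<le> t \<Longrightarrow> pot_loss x y t = pot_loss y x t"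
  using pot_loss_le_commute[of x y t] pot_loss_le_commute[of y x t] by auto

section \<open>From gaps to the Newton kernel itself\<close>

lemma
  assumes t: "0 \<le> t"
  shows newton_shift_integrable: "integrable (P x t) (\<lambda>z. newton DIM('a) ((norm (z - p))\<^sup>2 + 1))"
    and integral_newton_shift: "(\<integral>z. newton DIM('a) ((norm (z - p))\<^sup>2 + 1) \<partial>P x t) = newton DIM('a) ((norm (x - p))\<^sup>2 + 1) - occ_density 1 x p t"
proof -
  let ?d = "DIM('a)"
  interpret prob_space "P x t" by (rule prob_P)
  \<comment> \<open>The second gap parameter now tends to infinity. Adding the constant
    \<open>newton (Suc n)\<close> keeps the limit finite also for \<open>d = 2\<close>, and the sign
    makes the sequence increasing. Integrability of the limit, not known beforehand for the
    logarithm, results from convergence of the integrals.\<close>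
  define f where "f n z = - (K 1 (real (Suc n)) p z + newton ?d (real (Suc n)))" for n :: nat and z
  have f_eq: "f n z = - newton ?d ((norm (z - p))\<^sup>2 + 1) - (newton ?d (real (Suc n)) - newton ?d ((norm (z - p))\<^sup>2 + real (Suc n)))" for n z
    by (simp add: f_def newton_gap_def)
  have int: "integrable (P x t) (f n)" for n
    unfolding f_def[abs_def] using integrable_P_C_zero[OF K_C_zero[OF zero_less_one, of "real (Suc n)" p], of x t] by auto
  have "(\<integral>z. f n z \<partial>P x t) = f n x + occ_density 1 x p t - occ_density (real (Suc n)) x p t" for n
    unfolding f_def using integrable_P_C_zero[OF K_C_zero[OF zero_less_one, of "real (Suc n)" p], of x t] K_time[OF zero_less_one _ t, of "real (Suc n)" x p]
    by (simp add: prob_space)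
  moreover have f_lim: "(\<lambda>n. f n z) \<longlonglongrightarrow> - newton ?d ((norm (z - p))\<^sup>2 + 1) - 0" for z
    unfolding f_eq by (intro tendsto_diff tendsto_const newton_shift_tendsto_0) auto
  moreover have "(\<lambda>n. occ_density (real (Suc n)) x p t) \<longlonglongrightarrow> 0"
  proof (rule tendsto_sandwich[where f = "\<lambda>_. 0"])
    have "(\<lambda>n. (real (Suc n)) powr (- real ?d / 2)) \<longlonglongrightarrow> 0"
      by (rule tendsto_neg_powr, simp, real_asymp)
    then show "(\<lambda>n. A * (2 * real ?d * (real (Suc n)) powr (- real ?d / 2)) * t) \<longlonglongrightarrow> 0"
      by (intro tendsto_mult_right_zero tendsto_mult_left_zero)
  qed (use occ_density_bounds[OF _ t] in \<open>auto intro!: always_eventually simp del: of_nat_Suc\<close>)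
  ultimately have ilim: "(\<lambda>n. \<integral>z. f n z \<partial>P x t) \<longlonglongrightarrow> (- newton ?d ((norm (x - p))\<^sup>2 + 1) - 0) + occ_density 1 x p t - 0"
    by (simp only:) (intro tendsto_intros)
  have mono: "mono (\<lambda>n. f n z)" for z
    unfolding f_eq by (intro monoI diff_left_mono newton_shift_antimono) auto
  have lim: "AE z in P x t. (\<lambda>n. f n z) \<longlonglongrightarrow> - newton ?d ((norm (z - p))\<^sup>2 + 1)"
    using f_lim by simp
  have meas: "(\<lambda>z. - newton ?d ((norm (z - p))\<^sup>2 + 1)) \<in> borel_measurable (P x t)" by measurable
  have 1: "integrable (P x t) (\<lambda>z. - newton ?d ((norm (z - p))\<^sup>2 + 1))"
    by (rule integrable_monotone_convergence[OF int _ lim ilim meas]) (use mono in auto)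
  then show "integrable (P x t) (\<lambda>z. newton ?d ((norm (z - p))\<^sup>2 + 1))" by simp
  have "(\<integral>z. - newton ?d ((norm (z - p))\<^sup>2 + 1) \<partial>P x t) = (- newton ?d ((norm (x - p))\<^sup>2 + 1) - 0) + occ_density 1 x p t - 0"
    by (rule integral_monotone_convergence[OF int _ lim ilim meas]) (use mono in auto)
  then show "(\<integral>z. newton ?d ((norm (z - p))\<^sup>2 + 1) \<partial>P x t) = newton ?d ((norm (x - p))\<^sup>2 + 1) - occ_density 1 x p t" by simp
qed

lemma
  assumes t: "0 \<le> t" and xp: "x \<noteq> p"
  shows newton_integrable: "integrable (P x t) (\<lambda>z. newton DIM('a) ((norm (z - p))\<^sup>2))"
    and integral_newton: "(\<integral>z. newton DIM('a) ((norm (z - p))\<^sup>2) \<partial>P x t) = newton DIM('a) ((norm (x - p))\<^sup>2) - pot_loss x p t"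
proof -
  have eq: "newton DIM('a) ((norm (z - p))\<^sup>2) = K 0 1 p z + newton DIM('a) ((norm (z - p))\<^sup>2 + 1)" for z
    by (simp add: newton_gap_def)
  show "integrable (P x t) (\<lambda>z. newton DIM('a) ((norm (z - p))\<^sup>2))"
    unfolding eq using K0_P_integrable[OF t xp] newton_shift_integrable[OF t, of x p] by simp
  show "(\<integral>z. newton DIM('a) ((norm (z - p))\<^sup>2) \<partial>P x t) = newton DIM('a) ((norm (x - p))\<^sup>2) - pot_loss x p t"
    unfolding eq using K0_P_integrable[OF t xp] newton_shift_integrable[OF t, of x p] integral_newton_shift[OF t, of x p]
    by (simp add: pot_loss_def)
qed

lemma integral_newton_commute:
  assumes "0 \<le> t" "x \<noteq> y"
  shows "(\<integral>z. newton DIM('a) ((norm (z - y))\<^sup>2) \<partial>P x t) = (\<integral>z. newton DIM('a) ((norm (z - x))\<^sup>2) \<partial>P y t)"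
  using integral_newton[of t x y] integral_newton[of t y x] pot_loss_commute[of x y t] assms
  by (simp add: norm_minus_commute)

end

section \<open>Feller diffusions\<close>

text \<open>A zero of a nonnegative function is a minimum, so the gradient vanishes there; being
  differentiable at that point, it grows at most linearly away from it. The mean value inequality on
  a ball contributes the second factor of the distance.\<close>

lemma smooth_nonneg_zero_quadratic:
  fixes a :: "'a::euclidean_space \<Rightarrow> real"
  assumes "smooth a" and nonneg: "\<And>z. 0 \<le> a z" and z: "a z = 0"
  shows "\<exists>r>0. \<exists>C. \<forall>w. norm (w - z) < r \<longrightarrow> a w \<le> C * (norm (w - z))\<^sup>2"
proof -
  have "C_k (Suc (Suc 0)) a" using assms by (simp only: smooth_def)
  then have a_diff: "\<And>u. a differentiable (at u)"
    and p_diff: "\<And>b u. b \<in> Basis \<Longrightarrow> partial_derivative b a differentiable (at u)" by auto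
  define Da where "Da u = frechet_derivative a (at u)" for u
  have Da: "(a has_derivative Da u) (at u)" for u
    using a_diff[of u] by (simp add: Da_def frechet_derivative_works)
  have "Da z = (\<lambda>h. 0)"
    by (rule has_derivative_local_min[OF Da]) (use nonneg z in auto)
  then have p_z: "partial_derivative b a z = 0" for b by (simp add: partial_derivative_def Da_def)
  have "\<exists>r>0. \<exists>C\<ge>0. \<forall>u. norm (u - z) < r \<longrightarrow> \<bar>partial_derivative b a u\<bar> \<le> C * norm (u - z)" if b: "b \<in> Basis" for b
  proof -
    obtain p' where p': "(partial_derivative b a has_derivative p') (at z)"
      using p_diff[OF b] by (auto simp: differentiable_def)
    obtain B where B: "B > 0" "\<And>h. norm (p' h) \<le> norm h * B"
      using bounded_linear.pos_bounded[OF has_derivative_bounded_linear[OF p']] by blast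
    obtain r where r: "r > 0" "\<And>u. norm (u - z) < r \<Longrightarrow>
        norm (partial_derivative b a u - partial_derivative b a z - p' (u - z)) \<le> 1 * norm (u - z)"
      using p'[unfolded has_derivative_within_alt] zero_less_one by blast
    have "\<bar>partial_derivative b a u\<bar> \<le> (1 + B) * norm (u - z)" if "norm (u - z) < r" for u
      using r(2)[OF that] B(2)[of "u - z"] by (simp add: p_z algebra_simps)
    then show ?thesis using r(1) B(1) by (intro exI[of _ r] conjI exI[of _ "1 + B"]) auto
  qed
  then obtain r C where rC: "\<And>b. b \<in> Basis \<Longrightarrow> r b > 0" "\<And>b. b \<in> Basis \<Longrightarrow> C b \<ge> 0"
    "\<And>b u. b \<in> Basis \<Longrightarrow> norm (u - z) < r b \<Longrightarrow> \<bar>partial_derivative b a u\<bar> \<le> C b * norm (u - z)"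
    by metis
  define \<rho> where "\<rho> = Min (r ` Basis)"
  define D where "D = (\<Sum>b\<in>Basis. C b)"
  have \<rho>: "\<rho> > 0" unfolding \<rho>_def using rC(1) by (subst Min_gr_iff) auto
  have \<rho>_le: "\<rho> \<le> r b" if "b \<in> Basis" for b unfolding \<rho>_def using that by (intro Min_le) auto
  have D: "D \<ge> 0" unfolding D_def by (intro sum_nonneg rC)
  have "a w \<le> D * (norm (w - z))\<^sup>2" if w: "norm (w - z) < \<rho>" for w
  proof -
    have "norm (a w - a z) \<le> (D * norm (w - z)) * norm (w - z)"
    proof (rule differentiable_bound[where S = "cball z (norm (w - z))"])
      fix u assume u: "u \<in> cball z (norm (w - z))"
      then have uz: "norm (u - z) \<le> norm (w - z)" by (simp add: dist_norm norm_minus_commute)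
      show "(a has_derivative Da u) (at u within cball z (norm (w - z)))"
        using Da by (rule has_derivative_at_withinI)
      interpret Da: linear "Da u" using Da has_derivative_linear by blast
      show "onorm (Da u) \<le> D * norm (w - z)"
      proof (rule onorm_bound)
        fix h
        have "Da u h = Da u (\<Sum>b\<in>Basis. (h \<bullet> b) *\<^sub>R b)" by (simp add: euclidean_representation)
        also have "\<dots> = (\<Sum>b\<in>Basis. (h \<bullet> b) * partial_derivative b a u)"
          unfolding Da.sum Da.scale by (simp add: partial_derivative_def Da_def)
        also have "norm \<dots> \<le> (\<Sum>b\<in>Basis. norm h * (C b * norm (w - z)))"
        proof (rule sum_norm_le)
          fix b :: 'a assume b: "b \<in> Basis"
          have "\<bar>partial_derivative b a u\<bar> \<le> C b * norm (u - z)"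
            using uz w \<rho>_le[OF b] by (intro rC(3) b) simp
          also have "\<dots> \<le> C b * norm (w - z)" using uz rC(2)[OF b] by (intro mult_left_mono)
          finally show "norm ((h \<bullet> b) * partial_derivative b a u) \<le> norm h * (C b * norm (w - z))"
            using Basis_le_norm[OF b, of h] by (simp add: abs_mult mult_mono)
        qed
        also have "\<dots> = D * norm (w - z) * norm h"
          by (simp add: D_def sum_distrib_left sum_distrib_right mult_ac)
        finally show "norm (Da u h) \<le> D * norm (w - z) * norm h" .
      qed (use D in simp)
    qed (auto simp: dist_norm norm_minus_commute)
    then show ?thesis using z nonneg[of w] by (simp add: power2_eq_square mult_ac)
  qed
  then show ?thesis using \<rho> by blast
qed

text \<open>The Markov property at \<open>s = 0\<close>: taking expectations removes the
  conditioning, and the initial value is almost surely \<open>x\<close>.\<close>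

lemma markov_process_expectation:
  assumes T: "feller_semigroup T" and X: "markov_process_from T M X x"
    and f: "f \<in> C_zero" and t: "0 \<le> t"
  shows "T t f x = (\<integral>\<omega>. f (X t \<omega>) \<partial>M)"
proof -
  interpret prob_space M using X by (simp add: markov_process_from_def)
  have X_meas [measurable]: "X u \<in> borel_measurable M" if "0 \<le> u" for u
    using X that by (simp add: markov_process_from_def)
  define F where "F = natural_filtration M X 0"
  have "subalgebra M F"
    unfolding subalgebra_def
  proof
    show "space F = space M" by (simp add: F_def natural_filtration_def space_measure_of_conv)
    show "sets F \<subseteq> sets M"
      unfolding F_def natural_filtration_def
      by (subst sets_measure_of) (auto intro!: sets.sigma_sets_subset measurable_sets)
  qed
  then interpret finite_measure_subalgebra M F by unfold_locales
  note [measurable] = C_zero_measurable[OF f]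
  have T_C: "T t f \<in> C_zero" using T f t by (simp add: feller_semigroup_def)
  note [measurable] = C_zero_measurable[OF T_C]
  obtain B where B: "\<And>z. \<bar>f z\<bar> \<le> B" using C_zero_bounded[OF f] by blast
  have int: "integrable M (\<lambda>\<omega>. f (X t \<omega>))"
    using B X_meas[OF t] by (intro integrable_const_bound[of _ B]) auto
  have cond: "AE \<omega> in M. real_cond_exp M F (\<lambda>\<omega>. f (X (0 + t) \<omega>)) \<omega> = T t f (X 0 \<omega>)"
    using X f t unfolding markov_process_from_def F_def by blast
  have init: "AE \<omega> in M. X 0 \<omega> = x" using X by (simp add: markov_process_from_def)
  have "(\<integral>\<omega>. f (X t \<omega>) \<partial>M) = (\<integral>\<omega>. real_cond_exp M F (\<lambda>\<omega>. f (X t \<omega>)) \<omega> \<partial>M)"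
    using real_cond_exp_int(2)[OF int] by simp
  also have "\<dots> = (\<integral>\<omega>. T t f x \<partial>M)"
  proof (rule integral_cong_AE)
    show "AE \<omega> in M. real_cond_exp M F (\<lambda>\<omega>. f (X t \<omega>)) \<omega> = T t f x"
      using cond init by eventually_elim simp
  qed auto
  also have "\<dots> = T t f x" by (simp add: prob_space)
  finally show ?thesis by simp
qed

lemma feller_kernel_of_diffusion:
  fixes a :: "'a::euclidean_space \<Rightarrow> real"
  assumes a: "\<forall>z. 0 \<le> a z" "bounded (range a)" "smooth a"
    and X: "feller_diffusion (\<lambda>g z. a z * laplacian g z) M X" and dim: "DIM('a) \<ge> 2"
  obtains T A where "feller_kernel T (\<lambda>x t. distr (M x) borel (X x (max 0 t))) a A"
proof -
  obtain T where T: "feller_semigroup T"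
    and gen: "\<forall>g\<in>smooth_compact_support. in_generator T g (\<lambda>z. a z * laplacian g z)"
    and Xx: "\<And>x. markov_process_from T (M x) (X x) x"
    using X by (auto simp: feller_diffusion_def)
  obtain A where A: "\<And>z. a z \<le> A"
    using a(2) by (auto simp: bounded_iff abs_le_iff)
  have X_meas: "X x (max 0 t) \<in> borel_measurable (M x)" for x t
    using Xx[of x] by (simp add: markov_process_from_def)
  have "C_k 0 a" using a(3) by (simp only: smooth_def)
  then have a_cont: "continuous_on UNIV a" by simp
  have "feller_kernel T (\<lambda>x t. distr (M x) borel (X x (max 0 t))) a A"
  proof (rule feller_kernel.intro)
    show "prob_space (distr (M x) borel (X x (max 0 t)))" for x t
      using Xx[of x] X_meas by (intro prob_space.prob_space_distr) (auto simp: markov_process_from_def)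
    show "T t f x = (\<integral>z. f z \<partial>distr (M x) borel (X x (max 0 t)))" if "f \<in> C_zero" "0 \<le> t" for f t x
      using markov_process_expectation[OF T Xx that] that C_zero_measurable[OF that(1)]
      by (subst integral_distr[OF X_meas]) auto
    show "\<exists>r>0. \<exists>C. \<forall>w. norm (w - z) < r \<longrightarrow> a w \<le> C * (norm (w - z))\<^sup>2" if "a z = 0" for z
      using smooth_nonneg_zero_quadratic[OF a(3) _ that] a(1) by blast
  qed (use T gen a A a_cont dim in auto)
  then show ?thesis by (rule that)
qed

section \<open>Translation to the expectations in the theorem\<close>

lemma ext_expectation_eq_integral:
  assumes f: "integrable M f" and eq: "AE \<omega> in M. g \<omega> = ereal (f \<omega>)"
  shows "ext_expectation M g = ereal (\<integral>\<omega>. f \<omega> \<partial>M)"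
proof -
  obtain r q where rq: "0 \<le> r" "0 \<le> q" "(\<integral>\<^sup>+ \<omega>. ennreal (f \<omega>) \<partial>M) = ennreal r"
    "(\<integral>\<^sup>+ \<omega>. ennreal (- f \<omega>) \<partial>M) = ennreal q" "(\<integral>\<omega>. f \<omega> \<partial>M) = r - q"
    using f by (rule integrableE)
  have "(\<integral>\<^sup>+ \<omega>. e2ennreal (g \<omega>) \<partial>M) = ennreal r"
    unfolding rq(3)[symmetric] by (intro nn_integral_cong_AE) (use eq in eventually_elim, simp)
  moreover have "(\<integral>\<^sup>+ \<omega>. e2ennreal (- g \<omega>) \<partial>M) = ennreal q"
    unfolding rq(4)[symmetric] by (intro nn_integral_cong_AE) (use eq in eventually_elim, simp)
  ultimately show ?thesis using rq by (simp add: ext_expectation_def enn2ereal_ennreal)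
qed

lemma newton_norm_power:
  assumes "3 \<le> d" "0 < s"
  shows "1 / ennreal (s ^ (d - 2)) = ennreal ((real d - 2) / 2 * newton d (s\<^sup>2))"
proof -
  have "(s\<^sup>2) powr (1 - real d / 2) = s powr (2 * (1 - real d / 2))"
    using assms by (simp add: powr_powr flip: powr_numeral)
  also have "2 * (1 - real d / 2) = - real (d - 2)" using assms by (simp add: of_nat_diff)
  also have "s powr \<dots> = 1 / s ^ (d - 2)"
    unfolding powr_minus_divide powr_realpow[OF assms(2)] ..
  finally have power: "(s\<^sup>2) powr (1 - real d / 2) = 1 / s ^ (d - 2)" .
  have "c / 2 * (2 / c * q) = q" if "c \<noteq> 0" for c q :: real using that by simp
  moreover have "real d - 2 \<noteq> 0" "d \<noteq> 2" using assms by auto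
  ultimately have "(real d - 2) / 2 * newton d (s\<^sup>2) = 1 / s ^ (d - 2)"
    unfolding newton_def power by (simp only: if_False)
  then show ?thesis using assms by (simp add: divide_ennreal flip: ennreal_1)
qed

lemma log_ext_measurable [measurable]: "log_ext \<in> borel_measurable borel"
  unfolding log_ext_def[abs_def] by measurable

theorem proposition3p1:
  fixes a :: "real ^ 'd \<Rightarrow> real"
    and M :: "real ^ 'd \<Rightarrow> 'w measure"
    and X :: "real ^ 'd \<Rightarrow> real \<Rightarrow> 'w \<Rightarrow> real ^ 'd"
    and x y :: "real ^ 'd"
    and t :: real
  assumes "\<forall>z. 0 \<le> a z"
    and "bounded (range a)"
    and "smooth a"
    and "feller_diffusion (\<lambda>g z. a z * laplacian g z) M X"
    and "0 \<le> t"
  shows "(CARD('d) \<ge> 3 \<longrightarrow>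
            (\<integral>\<^sup>+ \<omega>. 1 / ennreal (norm (X x t \<omega> - y) ^ (CARD('d) - 2)) \<partial>M x) =
            (\<integral>\<^sup>+ \<omega>. 1 / ennreal (norm (X y t \<omega> - x) ^ (CARD('d) - 2)) \<partial>M y)) \<and>
         (CARD('d) = 2 \<longrightarrow>
            ext_expectation_exists (M x) (\<lambda>\<omega>. log_ext (norm (X x t \<omega> - y))) \<and>
            ext_expectation_exists (M y) (\<lambda>\<omega>. log_ext (norm (X y t \<omega> - x))) \<and>
            ext_expectation (M x) (\<lambda>\<omega>. log_ext (norm (X x t \<omega> - y))) =
            ext_expectation (M y) (\<lambda>\<omega>. log_ext (norm (X y t \<omega> - x))))"
proof (intro conjI impI)
  assume d: "CARD('d) \<ge> 3"
  obtain T A where "feller_kernel T (\<lambda>x t. distr (M x) borel (X x (max 0 t))) a A"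
    using feller_kernel_of_diffusion[OF assms(1-4)] d by auto
  then interpret feller_kernel T "\<lambda>x t. distr (M x) borel (X x (max 0 t))" a A .
  have X_meas [measurable]: "X x t \<in> borel_measurable (M x)" for x
    using assms(4,5) by (auto simp: feller_diffusion_def markov_process_from_def)
  have *: "(\<integral>\<^sup>+ \<omega>. 1 / ennreal (norm (X x t \<omega> - y) ^ (CARD('d) - 2)) \<partial>M x) =
     ennreal ((real CARD('d) - 2) / 2 * (\<integral>z. newton CARD('d) ((norm (z - y))\<^sup>2) \<partial>distr (M x) borel (X x (max 0 t))))"
    if "x \<noteq> y" for x y
  proof -
    let ?P = "distr (M x) borel (X x (max 0 t))"
    let ?f = "\<lambda>z. (real CARD('d) - 2) / 2 * newton CARD('d) ((norm (z - y))\<^sup>2)"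
    have "(\<integral>\<^sup>+ \<omega>. 1 / ennreal (norm (X x t \<omega> - y) ^ (CARD('d) - 2)) \<partial>M x) = (\<integral>\<^sup>+ z. 1 / ennreal (norm (z - y) ^ (CARD('d) - 2)) \<partial>?P)"
      using assms(5) by (subst nn_integral_distr) auto
    also have "\<dots> = (\<integral>\<^sup>+ z. ennreal (?f z) \<partial>?P)"
    proof (rule nn_integral_cong_AE)
      \<comment> \<open>At \<open>z = y\<close> the left side is infinite while
        \<open>newton\<close> has a meaningless finite value, so the absence of an atom at
        \<open>y\<close> is essential.\<close>
      show "AE z in ?P. 1 / ennreal (norm (z - y) ^ (CARD('d) - 2)) = ennreal (?f z)"
        using K0_P_AE[OF assms(5) that] by eventually_elim (rule newton_norm_power[OF d], simp)
    qed
    also have "\<dots> = ennreal (\<integral>z. ?f z \<partial>?P)"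
    proof (rule nn_integral_eq_integral)
      show "integrable ?P ?f" using newton_integrable[OF assms(5) that] by simp
      show "AE z in ?P. 0 \<le> ?f z" using d by (auto simp: newton_def)
    qed
    finally show ?thesis by simp
  qed
  show "(\<integral>\<^sup>+ \<omega>. 1 / ennreal (norm (X x t \<omega> - y) ^ (CARD('d) - 2)) \<partial>M x) =
            (\<integral>\<^sup>+ \<omega>. 1 / ennreal (norm (X y t \<omega> - x) ^ (CARD('d) - 2)) \<partial>M y)"
  proof (cases "x = y")
    case False
    then show ?thesis using *[of x y] *[of y x] integral_newton_commute[OF assms(5) False] by simp
  qed simp
next
  assume d: "CARD('d) = 2"
  obtain T A where "feller_kernel T (\<lambda>x t. distr (M x) borel (X x (max 0 t))) a A"
    using feller_kernel_of_diffusion[OF assms(1-4)] d by auto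
  then interpret feller_kernel T "\<lambda>x t. distr (M x) borel (X x (max 0 t))" a A .
  have X_meas [measurable]: "X x t \<in> borel_measurable (M x)" for x
    using assms(4,5) by (auto simp: feller_diffusion_def markov_process_from_def)
  \<comment> \<open>Finiteness of the positive part is shown, which also covers equal points, where
    the expectation can be minus infinity, for instance at \<open>t = 0\<close>. From
    \<open>s \<le> s^2 + 1\<close> the logarithm is dominated by the shifted kernel, integrable for
    all pairs of points.\<close>
  show ex: "ext_expectation_exists (M x) (\<lambda>\<omega>. log_ext (norm (X x t \<omega> - y)))" for x y
    unfolding ext_expectation_exists_def
  proof (intro conjI disjI1)
    show "(\<lambda>\<omega>. log_ext (norm (X x t \<omega> - y))) \<in> borel_measurable (M x)" by measurable
    have "integrable (distr (M x) borel (X x (max 0 t))) (\<lambda>z. - newton CARD('d) ((norm (z - y))\<^sup>2 + 1))"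
      using newton_shift_integrable[OF assms(5), of x y] by simp
    then have int: "integrable (M x) (\<lambda>\<omega>. ln ((norm (X x t \<omega> - y))\<^sup>2 + 1))"
      using assms(5) d by (subst (asm) integrable_distr_eq) (auto simp: newton_def)
    have "(\<integral>\<^sup>+ \<omega>. e2ennreal (log_ext (norm (X x t \<omega> - y))) \<partial>M x) \<le> (\<integral>\<^sup>+ \<omega>. ennreal (ln ((norm (X x t \<omega> - y))\<^sup>2 + 1)) \<partial>M x)"
    proof (rule nn_integral_mono)
      fix \<omega>
      have "log_ext s \<le> ereal (ln (s\<^sup>2 + 1))" for s
      proof (cases "0 < s")
        case True
        have "0 \<le> (s - 1)\<^sup>2" by simp
        then have "s \<le> s\<^sup>2 + 1" using True by (simp add: power2_eq_square algebra_simps)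
        then show ?thesis using True by (simp add: log_ext_def add_pos_pos)
      qed (simp add: log_ext_def)
      then show "e2ennreal (log_ext (norm (X x t \<omega> - y))) \<le> ennreal (ln ((norm (X x t \<omega> - y))\<^sup>2 + 1))"
        unfolding e2ennreal_ereal[symmetric] by (intro e2ennreal_mono)
    qed
    also have "\<dots> = ennreal (\<integral>\<omega>. ln ((norm (X x t \<omega> - y))\<^sup>2 + 1) \<partial>M x)"
      by (rule nn_integral_eq_integral[OF int]) simp
    also have "\<dots> < \<infinity>" by simp
    finally show "(\<integral>\<^sup>+ \<omega>. e2ennreal (log_ext (norm (X x t \<omega> - y))) \<partial>M x) < \<infinity>" .
  qed
  show "ext_expectation_exists (M y) (\<lambda>\<omega>. log_ext (norm (X y t \<omega> - x)))" by (rule ex)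
  \<comment> \<open>The factor one half arises because \<open>newton\<close> is minus the logarithm
    of the squared norm.\<close>
  have *: "ext_expectation (M x) (\<lambda>\<omega>. log_ext (norm (X x t \<omega> - y))) =
     ereal (- (\<integral>z. newton CARD('d) ((norm (z - y))\<^sup>2) \<partial>distr (M x) borel (X x (max 0 t))) / 2)"
    if "x \<noteq> y" for x y
  proof -
    let ?P = "distr (M x) borel (X x (max 0 t))"
    let ?f = "\<lambda>z. - newton CARD('d) ((norm (z - y))\<^sup>2) / 2"
    have f: "integrable ?P ?f" using newton_integrable[OF assms(5) that] by simp
    have "ext_expectation (M x) (\<lambda>\<omega>. log_ext (norm (X x t \<omega> - y))) = ereal (\<integral>\<omega>. ?f (X x t \<omega>) \<partial>M x)"
    proof (rule ext_expectation_eq_integral)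
      show "integrable (M x) (\<lambda>\<omega>. ?f (X x t \<omega>))"
        using f assms(5) by (subst (asm) integrable_distr_eq) auto
      have "AE \<omega> in M x. X x t \<omega> \<noteq> y"
        using K0_P_AE[OF assms(5) that] assms(5) by (subst (asm) AE_distr_iff) auto
      then show "AE \<omega> in M x. log_ext (norm (X x t \<omega> - y)) = ereal (?f (X x t \<omega>))"
        by eventually_elim (simp add: log_ext_def newton_def d ln_realpow)
    qed
    also have "(\<integral>\<omega>. ?f (X x t \<omega>) \<partial>M x) = (\<integral>z. ?f z \<partial>?P)"
      using assms(5) by (subst integral_distr) auto
    finally show ?thesis by simp
  qed
  show "ext_expectation (M x) (\<lambda>\<omega>. log_ext (norm (X x t \<omega> - y))) =
            ext_expectation (M y) (\<lambda>\<omega>. log_ext (norm (X y t \<omega> - x)))"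
  proof (cases "x = y")
    case False
    then show ?thesis using *[of x y] *[of y x] integral_newton_commute[OF assms(5) False] by simp
  qed simp
qed

end
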